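(* Let $P=(\mathcal{A},\mathcal{C})$ be a measuring left $\alpha$-pairing over $R$ and consider $\mathcal{A}$ with the $\mathcal{C}$-adic topology $\mathcal{T}_{-\mathcal{C}}(\mathcal{A})$, which equals the weak linear topology $\mathcal{A}[\mathfrak{T}^r_{ls}(\mathcal{C})]$. If $M$ is a unital right $\mathcal{A}$-module, then for every $m\in M$ the following are equivalent: 1. there exists a finite subset $F=\{c_1,\dots,c_k\}\subset\mathcal{C}$ such that $(0_{\mathcal{C}}:F)\subseteq(0_M:m)$; 2. $m\mathcal{A}$ is $\mathcal{C}$-subgenerated; 3. $m\in\mathrm{Rat}^{\mathcal{C}}(M_{\mathcal{A}})$; 4. there exists a finitely generated left $R$-submodule $K\subset\mathcal{C}$ such that $K^{\bot}\subseteq(0_M:m)$. If $R_R$ is artinian, then 1-4 are moreover equivalent to: 5. $(0_M:m)$ contains an $R$-cofinite closed $R$-submodule; 6. $(0_M:m)$ is an $R$-cofinite closed right $\mathcal{A}$-ideal.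
   Context: $R$ is an associative (not necessarily commutative) ring with $1\neq 0$. An $R$-ring is an $R$-bimodule $\mathcal{A}$ with an associative $R$-bilinear multiplication $\mathcal{A}\otimes_R\mathcal{A}\to\mathcal{A}$, with unity (given by an $R$-bilinear unit map $R\to\mathcal{A}$); morphisms are $R$-bilinear, multiplicative and preserve unities. An $R$-coring is an $R$-bimodule $\mathcal{C}$ with $R$-bilinear coassociative $\Delta(c)=\sum c_1\otimes c_2\in\mathcal{C}\otimes_R\mathcal{C}$ and counit $\varepsilon_{\mathcal{C}}:\mathcal{C}\to R$. ${}^{*}\mathcal{C}:=\mathrm{Hom}_{R-}(\mathcal{C},R)$ (left $R$-linear maps) is an $R$-ring with $(rf)(c)=f(cr)$, $(fr)(c)=f(c)r$, $(f\star g)(c)=\sum g(c_1f(c_2))$, unity $\varepsilon_{\mathcal{C}}$. A measuring left $\alpha$-pairing $P=(\mathcal{A},\mathcal{C})$ consists of an $R$-ring $\mathcal{A}$, an $R$-coring $\mathcal{C}$ and a morphism of $R$-rings $\kappa_P:\mathcal{A}\to{}^{*}\mathcal{C}$ (write $\langle a,c\rangle=\kappa_P(a)(c)$) such that for every right $R$-module $M$ the map $\alpha_M^P:M\otimes_R\mathcal{C}\to\mathrm{Hom}_{-R}(\mathcal{A},M)$, $m\otimes c\mapsto[a\mapsto m\langle a,c\rangle]$, is injective. $\mathcal{C}$ is a right $\mathcal{A}$-module by $c\leftharpoonup a=\sum c_1\langle a,c_2\rangle$. Notation: for $F\subseteq\mathcal{C}$, $(0_{\mathcal{C}}:F)=\{a\in\mathcal{A}: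 c\leftharpoonup a=0\ \forall c\in F\}$; $(0_M:m)=\{a\in\mathcal{A}: ma=0\}$; for $K\subseteq\mathcal{C}$, $K^{\bot}=\{a\in\mathcal{A}:\langle a,c\rangle=0\ \forall c\in K\}$. The $\mathcal{C}$-adic topology $\mathcal{T}_{-\mathcal{C}}(\mathcal{A})$ is the linear topology with neighbourhood base of $0$ the right ideals $(0_{\mathcal{C}}:F)$, $F\subset\mathcal{C}$ finite; the weak linear topology $\mathcal{A}[\mathfrak{T}^r_{ls}(\mathcal{C})]$ has neighbourhood base of $0$ the right $R$-submodules $F^{\bot}$, $F\subset\mathcal{C}$ finite. A right $\mathcal{A}$-module is $\mathcal{C}$-subgenerated if it is isomorphic to a submodule of a quotient of a direct sum of copies of $\mathcal{C}_{\mathcal{A}}$. $\mathrm{Rat}^{\mathcal{C}}(M_{\mathcal{A}})$ is the set of $m\in M$ for which there is $\sum m_i\otimes c_i\in M\otimes_R\mathcal{C}$ with $ma=\sum m_i\langle a,c_i\rangle$ for all $a\in\mathcal{A}$. A right $R$-submodule $X\subseteq\mathcal{A}$ is $R$-cofinite if $\mathcal{A}/X$ is a finitely generated right $R$-module. *)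

theory Defs
  imports
    "HOL-Algebra.Free_Abelian_Groups"
    "HOL-Algebra.Generated_Groups"
    "HOL-Algebra.AbelCoset"
    "HOL-Algebra.Module"
    "HOL-Analysis.Abstract_Topology"
    "HOL-Library.Infinite_Typeclass"
begin

section \<open>Modules and bimodules over a noncommutative ring\<close>

text \<open>
  As for \<^typ>\<open>('r, 'm) module\<close>, the underlying abelian group of a module is stored in the
  additive part of a ring record, and the fields \<^const>\<open>monoid.mult\<close> and \<^const>\<open>one\<close> carry no
  meaning (they do for rings and for \<open>R\<close>-rings).
\<close>

record ('r, 'm) rmodule = "'m ring" +
  rsmult :: "['m, 'r] \<Rightarrow> 'm"  (infixl \<open>\<triangleleft>\<index>\<close> 70)

record ('r, 'm) bimodule = "('r, 'm) rmodule" +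
  lsmult :: "['r, 'm] \<Rightarrow> 'm"  (infixr \<open>\<triangleright>\<index>\<close> 70)

locale right_module = R?: ring R + M?: abelian_group M
  for R :: "('r, 'x) ring_scheme" (structure) and M :: "('r, 'm, 'y) rmodule_scheme" (structure) +
  assumes rsmult_closed:
      "\<lbrakk>x \<in> carrier M; r \<in> carrier R\<rbrakk> \<Longrightarrow> x \<triangleleft>\<^bsub>M\<^esub> r \<in> carrier M"
    and rsmult_add_left:
      "\<lbrakk>x \<in> carrier M; y \<in> carrier M; r \<in> carrier R\<rbrakk> \<Longrightarrow>
        (x \<oplus>\<^bsub>M\<^esub> y) \<triangleleft>\<^bsub>M\<^esub> r = x \<triangleleft>\<^bsub>M\<^esub> r \<oplus>\<^bsub>M\<^esub> y \<triangleleft>\<^bsub>M\<^esub> r"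
    and rsmult_add_right:
      "\<lbrakk>x \<in> carrier M; r \<in> carrier R; s \<in> carrier R\<rbrakk> \<Longrightarrow>
        x \<triangleleft>\<^bsub>M\<^esub> (r \<oplus>\<^bsub>R\<^esub> s) = x \<triangleleft>\<^bsub>M\<^esub> r \<oplus>\<^bsub>M\<^esub> x \<triangleleft>\<^bsub>M\<^esub> s"
    and rsmult_assoc:
      "\<lbrakk>x \<in> carrier M; r \<in> carrier R; s \<in> carrier R\<rbrakk> \<Longrightarrow>
        x \<triangleleft>\<^bsub>M\<^esub> (r \<otimes>\<^bsub>R\<^esub> s) = (x \<triangleleft>\<^bsub>M\<^esub> r) \<triangleleft>\<^bsub>M\<^esub> s"
    and rsmult_one: "x \<in> carrier M \<Longrightarrow> x \<triangleleft>\<^bsub>M\<^esub> \<one>\<^bsub>R\<^esub> = x"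

locale bimodule = right_module R M
  for R :: "('r, 'x) ring_scheme" (structure) and M :: "('r, 'm, 'y) bimodule_scheme" (structure) +
  assumes lsmult_closed:
      "\<lbrakk>r \<in> carrier R; x \<in> carrier M\<rbrakk> \<Longrightarrow> r \<triangleright>\<^bsub>M\<^esub> x \<in> carrier M"
    and lsmult_add_right:
      "\<lbrakk>r \<in> carrier R; x \<in> carrier M; y \<in> carrier M\<rbrakk> \<Longrightarrow>
        r \<triangleright>\<^bsub>M\<^esub> (x \<oplus>\<^bsub>M\<^esub> y) = (r \<triangleright>\<^bsub>M\<^esub> x) \<oplus>\<^bsub>M\<^esub> (r \<triangleright>\<^bsub>M\<^esub> y)"
    and lsmult_add_left:
      "\<lbrakk>r \<in> carrier R; s \<in> carrier R; x \<in> carrier M\<rbrakk> \<Longrightarrow>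
        (r \<oplus>\<^bsub>R\<^esub> s) \<triangleright>\<^bsub>M\<^esub> x = (r \<triangleright>\<^bsub>M\<^esub> x) \<oplus>\<^bsub>M\<^esub> (s \<triangleright>\<^bsub>M\<^esub> x)"
    and lsmult_assoc:
      "\<lbrakk>r \<in> carrier R; s \<in> carrier R; x \<in> carrier M\<rbrakk> \<Longrightarrow>
        (r \<otimes>\<^bsub>R\<^esub> s) \<triangleright>\<^bsub>M\<^esub> x = r \<triangleright>\<^bsub>M\<^esub> (s \<triangleright>\<^bsub>M\<^esub> x)"
    and lsmult_one: "x \<in> carrier M \<Longrightarrow> \<one>\<^bsub>R\<^esub> \<triangleright>\<^bsub>M\<^esub> x = x"
    and lsmult_rsmult:
      "\<lbrakk>r \<in> carrier R; x \<in> carrier M; s \<in> carrier R\<rbrakk> \<Longrightarrow>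
        (r \<triangleright>\<^bsub>M\<^esub> x) \<triangleleft>\<^bsub>M\<^esub> s = r \<triangleright>\<^bsub>M\<^esub> (x \<triangleleft>\<^bsub>M\<^esub> s)"

definition right_hom ::
  "('r, 'x) ring_scheme \<Rightarrow> ('r, 'm, 'y) rmodule_scheme \<Rightarrow> ('r, 'n, 'z) rmodule_scheme \<Rightarrow> ('m \<Rightarrow> 'n) set" where
  "right_hom R M N = {f \<in> carrier M \<rightarrow> carrier N.
     (\<forall>x\<in>carrier M. \<forall>y\<in>carrier M. f (x \<oplus>\<^bsub>M\<^esub> y) = f x \<oplus>\<^bsub>N\<^esub> f y) \<and>
     (\<forall>x\<in>carrier M. \<forall>r\<in>carrier R. f (x \<triangleleft>\<^bsub>M\<^esub> r) = f x \<triangleleft>\<^bsub>N\<^esub> r)}"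

definition bimodule_hom ::
  "('r, 'x) ring_scheme \<Rightarrow> ('r, 'm, 'y) bimodule_scheme \<Rightarrow> ('r, 'n, 'z) bimodule_scheme \<Rightarrow> ('m \<Rightarrow> 'n) set" where
  "bimodule_hom R M N = {f \<in> right_hom R M N.
     \<forall>r\<in>carrier R. \<forall>x\<in>carrier M. f (r \<triangleright>\<^bsub>M\<^esub> x) = r \<triangleright>\<^bsub>N\<^esub> f x}"

definition right_submodule ::
  "('r, 'x) ring_scheme \<Rightarrow> ('r, 'm, 'y) rmodule_scheme \<Rightarrow> 'm set \<Rightarrow> bool" where
  "right_submodule R M N \<longleftrightarrow>
     additive_subgroup N M \<and> (\<forall>x\<in>N. \<forall>r\<in>carrier R. x \<triangleleft>\<^bsub>M\<^esub> r \<in> N)"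

definition left_submodule ::
  "('r, 'x) ring_scheme \<Rightarrow> ('r, 'm, 'y) bimodule_scheme \<Rightarrow> 'm set \<Rightarrow> bool" where
  "left_submodule R M N \<longleftrightarrow>
     additive_subgroup N M \<and> (\<forall>r\<in>carrier R. \<forall>x\<in>N. r \<triangleright>\<^bsub>M\<^esub> x \<in> N)"

definition fg_right_module :: "('r, 'x) ring_scheme \<Rightarrow> ('r, 'm, 'y) rmodule_scheme \<Rightarrow> bool" where
  "fg_right_module R M \<longleftrightarrow> (\<exists>F. finite F \<and> F \<subseteq> carrier M \<and>
     \<Inter> {N. right_submodule R M N \<and> F \<subseteq> N} = carrier M)"

definition fg_left_submodule ::
  "('r, 'x) ring_scheme \<Rightarrow> ('r, 'm, 'y) bimodule_scheme \<Rightarrow> 'm set \<Rightarrow> bool" where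
  "fg_left_submodule R M K \<longleftrightarrow> (\<exists>F. finite F \<and> F \<subseteq> carrier M \<and>
     K = \<Inter> {N. left_submodule R M N \<and> F \<subseteq> N})"

definition artinian_right_module :: "('r, 'x) ring_scheme \<Rightarrow> ('r, 'm, 'y) rmodule_scheme \<Rightarrow> bool" where
  "artinian_right_module R M \<longleftrightarrow>
     (\<forall>I :: nat \<Rightarrow> 'm set. (\<forall>n. right_submodule R M (I n)) \<and> (\<forall>n. I (Suc n) \<subseteq> I n) \<longrightarrow>
        (\<exists>n. \<forall>k\<ge>n. I k = I n))"

definition regular_bimodule :: "('r, 'x) ring_scheme \<Rightarrow> ('r, 'r) bimodule" where
  "regular_bimodule R =
     \<lparr>carrier = carrier R, monoid.mult = monoid.mult R, monoid.one = \<one>\<^bsub>R\<^esub>, ring.zero = \<zero>\<^bsub>R\<^esub>, ring.add = ring.add R,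
      rsmult = monoid.mult R, lsmult = monoid.mult R\<rparr>"

definition quotient_module :: "('r, 'm, 'y) rmodule_scheme \<Rightarrow> 'm set \<Rightarrow> ('r, 'm set) rmodule" where
  "quotient_module M N =
     \<lparr>carrier = a_rcosets\<^bsub>M\<^esub> N, monoid.mult = undefined, monoid.one = undefined,
      ring.zero = N, ring.add = set_add M,
      rsmult = (\<lambda>X r. \<Union>x\<in>X. N +>\<^bsub>M\<^esub> (x \<triangleleft>\<^bsub>M\<^esub> r))\<rparr>"

definition direct_sum_copies :: "'i set \<Rightarrow> ('r, 'm, 'y) rmodule_scheme \<Rightarrow> ('r, 'i \<Rightarrow> 'm) rmodule" where
  "direct_sum_copies I M =
     \<lparr>carrier = {f \<in> I \<rightarrow>\<^sub>E carrier M. finite {i \<in> I. f i \<noteq> \<zero>\<^bsub>M\<^esub>}},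
      monoid.mult = undefined, monoid.one = undefined,
      ring.zero = (\<lambda>i\<in>I. \<zero>\<^bsub>M\<^esub>), ring.add = (\<lambda>f g. \<lambda>i\<in>I. f i \<oplus>\<^bsub>M\<^esub> g i),
      rsmult = (\<lambda>f r. \<lambda>i\<in>I. f i \<triangleleft>\<^bsub>M\<^esub> r)\<rparr>"


section \<open>Tensor products\<close>

text \<open>
  \<open>M \<otimes>\<^sub>R N\<close> is the free abelian group on \<open>M \<times> N\<close> modulo the subgroup generated by the
  usual relators; its elements are cosets of formal sums.
\<close>

definition tensor_relators ::
  "('r, 'x) ring_scheme \<Rightarrow> ('r, 'm, 'y) rmodule_scheme \<Rightarrow> ('r, 'n, 'z) bimodule_scheme \<Rightarrow> ('m \<times> 'n \<Rightarrow>\<^sub>0 int) set" where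
  "tensor_relators R M N =
     {frag_of (x \<oplus>\<^bsub>M\<^esub> x', y) - frag_of (x, y) - frag_of (x', y) | x x' y.
        x \<in> carrier M \<and> x' \<in> carrier M \<and> y \<in> carrier N} \<union>
     {frag_of (x, y \<oplus>\<^bsub>N\<^esub> y') - frag_of (x, y) - frag_of (x, y') | x y y'.
        x \<in> carrier M \<and> y \<in> carrier N \<and> y' \<in> carrier N} \<union>
     {frag_of (x \<triangleleft>\<^bsub>M\<^esub> r, y) - frag_of (x, r \<triangleright>\<^bsub>N\<^esub> y) | x r y.
        x \<in> carrier M \<and> r \<in> carrier R \<and> y \<in> carrier N}"

abbreviation tensor_free ::
  "('r, 'm, 'y) rmodule_scheme \<Rightarrow> ('r, 'n, 'z) bimodule_scheme \<Rightarrow> ('m \<times> 'n \<Rightarrow>\<^sub>0 int) monoid" where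
  "tensor_free M N \<equiv> free_Abelian_group (carrier M \<times> carrier N)"

definition tensor_kernel ::
  "('r, 'x) ring_scheme \<Rightarrow> ('r, 'm, 'y) rmodule_scheme \<Rightarrow> ('r, 'n, 'z) bimodule_scheme \<Rightarrow> ('m \<times> 'n \<Rightarrow>\<^sub>0 int) set" where
  "tensor_kernel R M N = generate (tensor_free M N) (tensor_relators R M N)"

definition tensor ::
  "('r, 'x) ring_scheme \<Rightarrow> ('r, 'm, 'y) rmodule_scheme \<Rightarrow> ('r, 'n, 'z) bimodule_scheme \<Rightarrow> ('m \<times> 'n \<Rightarrow>\<^sub>0 int) set ring" where
  "tensor R M N = (let Q = tensor_free M N Mod tensor_kernel R M N in
     \<lparr>carrier = carrier Q, monoid.mult = undefined, monoid.one = undefined,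
      ring.zero = monoid.one Q, ring.add = monoid.mult Q\<rparr>)"

definition pure_tensor ::
  "('r, 'x) ring_scheme \<Rightarrow> ('r, 'm, 'y) rmodule_scheme \<Rightarrow> ('r, 'n, 'z) bimodule_scheme \<Rightarrow>
   'm \<Rightarrow> 'n \<Rightarrow> ('m \<times> 'n \<Rightarrow>\<^sub>0 int) set" where
  "pure_tensor R M N x y = tensor_kernel R M N #>\<^bsub>tensor_free M N\<^esub> frag_of (x, y)"

text \<open>
  \<open>tensor_lift G h\<close> is the map \<open>\<Sum> x\<^sub>i \<otimes> y\<^sub>i \<mapsto> \<Sum> h x\<^sub>i y\<^sub>i\<close> out of a tensor product into the abelian
  group \<open>G\<close>.  It is only meaningful for balanced biadditive \<open>h\<close>, and then
  independent of the chosen representative (see \<open>tensor_lift_eq\<close> below).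
\<close>

definition formal_sum :: "('g, 'x) ring_scheme \<Rightarrow> ('m \<Rightarrow> 'n \<Rightarrow> 'g) \<Rightarrow> ('m \<times> 'n \<Rightarrow>\<^sub>0 int) \<Rightarrow> 'g" where
  "formal_sum G h z = (\<Oplus>\<^bsub>G\<^esub>p\<in>Poly_Mapping.keys z. [Poly_Mapping.lookup z p] \<cdot>\<^bsub>G\<^esub> h (fst p) (snd p))"

definition tensor_lift :: "('g, 'x) ring_scheme \<Rightarrow> ('m \<Rightarrow> 'n \<Rightarrow> 'g) \<Rightarrow> ('m \<times> 'n \<Rightarrow>\<^sub>0 int) set \<Rightarrow> 'g" where
  "tensor_lift G h t = formal_sum G h (SOME z. z \<in> t)"

definition tensor_bimodule ::
  "('r, 'x) ring_scheme \<Rightarrow> ('r, 'm, 'y) bimodule_scheme \<Rightarrow> ('r, 'n, 'z) bimodule_scheme \<Rightarrow>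
   ('r, ('m \<times> 'n \<Rightarrow>\<^sub>0 int) set) bimodule" where
  "tensor_bimodule R M N =
     \<lparr>carrier = carrier (tensor R M N), monoid.mult = undefined, monoid.one = undefined,
      ring.zero = ring.zero (tensor R M N), ring.add = ring.add (tensor R M N),
      rsmult = (\<lambda>t r. tensor_lift (tensor R M N) (\<lambda>x y. pure_tensor R M N x (y \<triangleleft>\<^bsub>N\<^esub> r)) t),
      lsmult = (\<lambda>r t. tensor_lift (tensor R M N) (\<lambda>x y. pure_tensor R M N (r \<triangleright>\<^bsub>M\<^esub> x) y) t)\<rparr>"


section \<open>Rings over a base ring, corings, and the left dual ring\<close>

text \<open>
  The assumptions say that multiplication is an \<open>R\<close>-bilinear map on the tensor product of \<open>A\<close>
  with itself.  The unit map is \<open>r \<mapsto> r\<cdot>1 = 1\<cdot>r\<close>; that it is \<open>R\<close>-bilinear follows.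
\<close>

locale R_ring = bimodule R A + A?: ring A
  for R :: "('r, 'x) ring_scheme" (structure) and A :: "('r, 'a, 'y) bimodule_scheme" (structure) +
  assumes mult_lsmult:
      "\<lbrakk>r \<in> carrier R; a \<in> carrier A; b \<in> carrier A\<rbrakk> \<Longrightarrow>
        (r \<triangleright>\<^bsub>A\<^esub> a) \<otimes>\<^bsub>A\<^esub> b = r \<triangleright>\<^bsub>A\<^esub> (a \<otimes>\<^bsub>A\<^esub> b)"
    and mult_rsmult:
      "\<lbrakk>a \<in> carrier A; b \<in> carrier A; r \<in> carrier R\<rbrakk> \<Longrightarrow>
        a \<otimes>\<^bsub>A\<^esub> (b \<triangleleft>\<^bsub>A\<^esub> r) = (a \<otimes>\<^bsub>A\<^esub> b) \<triangleleft>\<^bsub>A\<^esub> r"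
    and mult_balanced:
      "\<lbrakk>a \<in> carrier A; r \<in> carrier R; b \<in> carrier A\<rbrakk> \<Longrightarrow>
        (a \<triangleleft>\<^bsub>A\<^esub> r) \<otimes>\<^bsub>A\<^esub> b = a \<otimes>\<^bsub>A\<^esub> (r \<triangleright>\<^bsub>A\<^esub> b)"

record ('r, 'c) coring = "('r, 'c) bimodule" +
  comult :: "'c \<Rightarrow> ('c \<times> 'c \<Rightarrow>\<^sub>0 int) set"
  counit :: "'c \<Rightarrow> 'r"

locale coring = bimodule R C
  for R :: "('r, 'x) ring_scheme" (structure) and C :: "('r, 'c, 'y) coring_scheme" (structure) +
  assumes comult_hom: "comult C \<in> bimodule_hom R C (tensor_bimodule R C C)"
    and counit_hom: "counit C \<in> bimodule_hom R C (regular_bimodule R)"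
    \<comment> \<open>the outer lift on the left is the associator \<open>(C \<otimes> C) \<otimes> C \<rightarrow> C \<otimes> (C \<otimes> C)\<close>\<close>
    and coassoc:
      "c \<in> carrier C \<Longrightarrow>
        (let CC = tensor_bimodule R C C; CCC = tensor R C CC in
         tensor_lift CCC
           (\<lambda>t z. tensor_lift CCC (\<lambda>x y. pure_tensor R C CC x (pure_tensor R C C y z)) t)
           (tensor_lift (tensor R CC C) (\<lambda>x y. pure_tensor R CC C (comult C x) y) (comult C c))
         = tensor_lift CCC (\<lambda>x y. pure_tensor R C CC x (comult C y)) (comult C c))"
    and counit_left:
      "c \<in> carrier C \<Longrightarrow> tensor_lift C (\<lambda>x y. counit C x \<triangleright>\<^bsub>C\<^esub> y) (comult C c) = c"
    and counit_right:
      "c \<in> carrier C \<Longrightarrow> tensor_lift C (\<lambda>x y. x \<triangleleft>\<^bsub>C\<^esub> counit C y) (comult C c) = c"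

text \<open>The \<open>R\<close>-ring of left \<open>R\<close>-linear maps \<open>C \<rightarrow> R\<close>, realised by extensional functions.\<close>

definition left_dual :: "('r, 'x) ring_scheme \<Rightarrow> ('r, 'c, 'y) coring_scheme \<Rightarrow> ('r, 'c \<Rightarrow> 'r) bimodule" where
  "left_dual R C =
     \<lparr>carrier = {f \<in> carrier C \<rightarrow>\<^sub>E carrier R.
        (\<forall>c\<in>carrier C. \<forall>d\<in>carrier C. f (c \<oplus>\<^bsub>C\<^esub> d) = f c \<oplus>\<^bsub>R\<^esub> f d) \<and>
        (\<forall>r\<in>carrier R. \<forall>c\<in>carrier C. f (r \<triangleright>\<^bsub>C\<^esub> c) = r \<otimes>\<^bsub>R\<^esub> f c)},
      monoid.mult = (\<lambda>f g. \<lambda>c\<in>carrier C. tensor_lift R (\<lambda>x y. g (x \<triangleleft>\<^bsub>C\<^esub> f y)) (comult C c)),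
      monoid.one = (\<lambda>c\<in>carrier C. counit C c),
      ring.zero = (\<lambda>c\<in>carrier C. \<zero>\<^bsub>R\<^esub>),
      ring.add = (\<lambda>f g. \<lambda>c\<in>carrier C. f c \<oplus>\<^bsub>R\<^esub> g c),
      rsmult = (\<lambda>f r. \<lambda>c\<in>carrier C. f c \<otimes>\<^bsub>R\<^esub> r),
      lsmult = (\<lambda>r f. \<lambda>c\<in>carrier C. f (c \<triangleleft>\<^bsub>C\<^esub> r))\<rparr>"


section \<open>Measuring left alpha-pairings\<close>

text \<open>Throughout, \<open>\<kappa> a c\<close> is the value \<open>\<langle>a, c\<rangle>\<close> of the pairing.\<close>

definition alpha_map ::
  "('a, 'z) ring_scheme \<Rightarrow> ('a \<Rightarrow> 'c \<Rightarrow> 'r) \<Rightarrow> ('r, 'm, 'y) rmodule_scheme \<Rightarrow> ('m \<times> 'c \<Rightarrow>\<^sub>0 int) set \<Rightarrow> 'a \<Rightarrow> 'm" where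
  "alpha_map A \<kappa> M t = (\<lambda>a\<in>carrier A. tensor_lift M (\<lambda>m c. m \<triangleleft>\<^bsub>M\<^esub> \<kappa> a c) t)"

text \<open>
  The alpha-condition quantifies over all right \<open>R\<close>-modules, which has to be cut down to the modules
  over one type.  Cosets of \<open>n\<close>-tuples over \<open>R\<close> live in \<^typ>\<open>(nat \<Rightarrow> 'r) set\<close>, so this
  type carries a copy of every finitely generated right \<open>R\<close>-module.  That is no restriction: injectivity of
  \<^const>\<open>alpha_map\<close> for those modules gives it for all modules over all types, see \<open>alpha_map_inj\<close> below.
\<close>

locale measuring_left_alpha_pairing = R_ring R A + coring R C
  for R :: "('r, 'x) ring_scheme" (structure) and A :: "('r, 'a, 'y) bimodule_scheme" (structure)
    and C :: "('r, 'c, 'z) coring_scheme" (structure) and \<kappa> :: "'a \<Rightarrow> 'c \<Rightarrow> 'r" +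
  assumes one_not_zero_R: "\<one>\<^bsub>R\<^esub> \<noteq> \<zero>\<^bsub>R\<^esub>"
    and kappa_ring_hom: "\<kappa> \<in> ring_hom A (left_dual R C)"
    and kappa_bimodule_hom: "\<kappa> \<in> bimodule_hom R A (left_dual R C)"
    and alpha_condition:
      "\<And>M :: ('r, (nat \<Rightarrow> 'r) set) rmodule. right_module R M \<Longrightarrow>
         inj_on (alpha_map A \<kappa> M) (carrier (tensor R M C))"


section \<open>Annihilators, topologies, subgenerated and rational modules\<close>

definition coring_right_module ::
  "('r, 'c, 'y) coring_scheme \<Rightarrow> ('a \<Rightarrow> 'c \<Rightarrow> 'r) \<Rightarrow> ('a, 'c) rmodule" where
  "coring_right_module C \<kappa> =
     \<lparr>carrier = carrier C, monoid.mult = undefined, monoid.one = undefined, ring.zero = \<zero>\<^bsub>C\<^esub>, ring.add = ring.add C,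
      rsmult = (\<lambda>c a. tensor_lift C (\<lambda>x y. x \<triangleleft>\<^bsub>C\<^esub> \<kappa> a y) (comult C c))\<rparr>"

definition annihilator :: "('a, 'x) ring_scheme \<Rightarrow> ('a, 'm, 'y) rmodule_scheme \<Rightarrow> 'm set \<Rightarrow> 'a set" where
  "annihilator A M F = {a \<in> carrier A. \<forall>m\<in>F. m \<triangleleft>\<^bsub>M\<^esub> a = \<zero>\<^bsub>M\<^esub>}"

definition orth :: "('r, 'x) ring_scheme \<Rightarrow> ('a, 'y) ring_scheme \<Rightarrow> ('a \<Rightarrow> 'c \<Rightarrow> 'r) \<Rightarrow> 'c set \<Rightarrow> 'a set" where
  "orth R A \<kappa> K = {a \<in> carrier A. \<forall>c\<in>K. \<kappa> a c = \<zero>\<^bsub>R\<^esub>}"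

text \<open>The translation-invariant topology on \<open>A\<close> with the given neighbourhood base of \<open>0\<close>.\<close>

definition linear_topology :: "('a, 'x) ring_scheme \<Rightarrow> 'a set set \<Rightarrow> 'a topology" where
  "linear_topology A \<B> =
     topology (\<lambda>U. U \<subseteq> carrier A \<and> (\<forall>u\<in>U. \<exists>B\<in>\<B>. u <+\<^bsub>A\<^esub> B \<subseteq> U))"

definition adic_topology ::
  "('a, 'x) ring_scheme \<Rightarrow> ('r, 'c, 'y) coring_scheme \<Rightarrow> ('a \<Rightarrow> 'c \<Rightarrow> 'r) \<Rightarrow> 'a topology" where
  "adic_topology A C \<kappa> = linear_topology A
     {annihilator A (coring_right_module C \<kappa>) F | F. finite F \<and> F \<subseteq> carrier C}"

definition weak_topology ::
  "('r, 'w) ring_scheme \<Rightarrow> ('a, 'x) ring_scheme \<Rightarrow> ('r, 'c, 'y) coring_scheme \<Rightarrow> ('a \<Rightarrow> 'c \<Rightarrow> 'r) \<Rightarrow> 'a topology" where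
  "weak_topology R A C \<kappa> = linear_topology A {orth R A \<kappa> F | F. finite F \<and> F \<subseteq> carrier C}"

text \<open>
  The direct sums range over index sets of type \<^typ>\<open>'i\<close>.  A definition cannot
  quantify over types, so \<^typ>\<open>'i\<close> is a parameter; statements are meant for an arbitrary infinite \<^typ>\<open>'i\<close>.
\<close>

definition subgenerated ::
  "'i itself \<Rightarrow> ('a, 'x) ring_scheme \<Rightarrow> ('a, 'c, 'y) rmodule_scheme \<Rightarrow> ('a, 'm, 'z) rmodule_scheme \<Rightarrow> bool" where
  "subgenerated (_ :: 'i itself) A C M \<longleftrightarrow>
     (\<exists>(I :: 'i set) V W \<phi>.
        right_submodule A (direct_sum_copies I C) V \<and>
        right_submodule A (quotient_module (direct_sum_copies I C) V) W \<and>
        \<phi> \<in> right_hom A M (quotient_module (direct_sum_copies I C) V) \<and>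
        bij_betw \<phi> (carrier M) W)"

text \<open>A right \<open>A\<close>-module is a right \<open>R\<close>-module through the unit map \<open>r \<mapsto> 1\<cdot>r\<close> of the \<open>R\<close>-ring \<open>A\<close>.\<close>

definition restrict_scalars ::
  "('r, 'a, 'x) rmodule_scheme \<Rightarrow> ('a, 'm, 'y) rmodule_scheme \<Rightarrow> ('r, 'm) rmodule" where
  "restrict_scalars A M =
     \<lparr>carrier = carrier M, monoid.mult = undefined, monoid.one = undefined, ring.zero = \<zero>\<^bsub>M\<^esub>, ring.add = ring.add M,
      rsmult = (\<lambda>m r. m \<triangleleft>\<^bsub>M\<^esub> (\<one>\<^bsub>A\<^esub> \<triangleleft>\<^bsub>A\<^esub> r))\<rparr>"

definition rational_part ::
  "('r, 'w) ring_scheme \<Rightarrow> ('r, 'a, 'x) rmodule_scheme \<Rightarrow> ('r, 'c, 'y) coring_scheme \<Rightarrow> ('a \<Rightarrow> 'c \<Rightarrow> 'r) \<Rightarrow>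
   ('a, 'm, 'z) rmodule_scheme \<Rightarrow> 'm set" where
  "rational_part R A C \<kappa> M =
     {m \<in> carrier M. \<exists>t \<in> carrier (tensor R (restrict_scalars A M) C).
        \<forall>a\<in>carrier A. m \<triangleleft>\<^bsub>M\<^esub> a = alpha_map A \<kappa> (restrict_scalars A M) t a}"

definition R_cofinite :: "('r, 'x) ring_scheme \<Rightarrow> ('r, 'a, 'y) rmodule_scheme \<Rightarrow> 'a set \<Rightarrow> bool" where
  "R_cofinite R A X \<longleftrightarrow> right_submodule R A X \<and> fg_right_module R (quotient_module A X)"


section \<open>Adequacy of the encodings\<close>

subsection \<open>Topologies\<close>

lemma istopology_linear:
  assumes "\<B> \<noteq> {}" and "\<And>B B'. \<lbrakk>B \<in> \<B>; B' \<in> \<B>\<rbrakk> \<Longrightarrow> \<exists>B''\<in>\<B>. B'' \<subseteq> B \<inter> B'"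
  shows "istopology (\<lambda>U. U \<subseteq> carrier A \<and> (\<forall>u\<in>U. \<exists>B\<in>\<B>. u <+\<^bsub>A\<^esub> B \<subseteq> U))"
proof -
  have mono: "u <+\<^bsub>A\<^esub> B \<subseteq> u <+\<^bsub>A\<^esub> B'" if "B \<subseteq> B'" for u B B'
    using that by (auto simp: a_l_coset_def l_coset_def)
  have "\<exists>B\<in>\<B>. u <+\<^bsub>A\<^esub> B \<subseteq> S \<inter> T"
    if "\<forall>u\<in>S. \<exists>B\<in>\<B>. u <+\<^bsub>A\<^esub> B \<subseteq> S" "\<forall>u\<in>T. \<exists>B\<in>\<B>. u <+\<^bsub>A\<^esub> B \<subseteq> T" "u \<in> S" "u \<in> T" for S T u
  proof -
    from bspec[OF that(1) that(3)] bspec[OF that(2) that(4)]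
    obtain B B' where "B \<in> \<B>" "u <+\<^bsub>A\<^esub> B \<subseteq> S" "B' \<in> \<B>" "u <+\<^bsub>A\<^esub> B' \<subseteq> T"
      by (elim bexE)
    moreover from this obtain B'' where "B'' \<in> \<B>" "B'' \<subseteq> B \<inter> B'" using assms(2) by blast
    ultimately show ?thesis
      using mono[of B'' B u] mono[of B'' B' u] by blast
  qed
  moreover have "\<exists>B\<in>\<B>. u <+\<^bsub>A\<^esub> B \<subseteq> \<Union>\<K>"
    if "\<forall>K\<in>\<K>. K \<subseteq> carrier A \<and> (\<forall>u\<in>K. \<exists>B\<in>\<B>. u <+\<^bsub>A\<^esub> B \<subseteq> K)" "u \<in> K" "K \<in> \<K>" for \<K> K u
    using that by (meson Union_upper subset_trans)
  ultimately show ?thesis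
    unfolding istopology_def by (intro conjI allI impI subsetI ballI) auto
qed

lemma bex_setcompr:
  "(\<exists>B\<in>{f F | F. P F \<and> Q F}. S B) \<longleftrightarrow> (\<exists>F. P F \<and> Q F \<and> S (f F))"
  by blast

lemma openin_adic_topology:
  "openin (adic_topology A C \<kappa>) U \<longleftrightarrow> U \<subseteq> carrier A \<and>
     (\<forall>u\<in>U. \<exists>F. finite F \<and> F \<subseteq> carrier C \<and>
        u <+\<^bsub>A\<^esub> annihilator A (coring_right_module C \<kappa>) F \<subseteq> U)"
proof -
  let ?\<B> = "{annihilator A (coring_right_module C \<kappa>) F | F. finite F \<and> F \<subseteq> carrier C}"
  have dir: "\<exists>B''\<in>?\<B>. B'' \<subseteq> B \<inter> B'" if BB': "B \<in> ?\<B>" "B' \<in> ?\<B>" for B B'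
  proof -
    obtain F F' where F: "B = annihilator A (coring_right_module C \<kappa>) F" "finite F" "F \<subseteq> carrier C"
      "B' = annihilator A (coring_right_module C \<kappa>) F'" "finite F'" "F' \<subseteq> carrier C"
      using BB' by auto
    have "annihilator A (coring_right_module C \<kappa>) (F \<union> F') \<subseteq> B \<inter> B'"
      unfolding F(1,4) by (auto simp: annihilator_def)
    moreover have "annihilator A (coring_right_module C \<kappa>) (F \<union> F') \<in> ?\<B>"
      using F by (intro CollectI exI[of _ "F \<union> F'"]) simp
    ultimately show ?thesis by (rule bexI)
  qed
  have "istopology (\<lambda>U. U \<subseteq> carrier A \<and> (\<forall>u\<in>U. \<exists>B\<in>?\<B>. u <+\<^bsub>A\<^esub> B \<subseteq> U))"
    by (rule istopology_linear[OF _ dir]) (auto intro: exI[of _ "{}"])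
  then show ?thesis
    unfolding adic_topology_def linear_topology_def
    by (simp only: topology_inverse' bex_setcompr)
qed

lemma openin_weak_topology:
  "openin (weak_topology R A C \<kappa>) U \<longleftrightarrow> U \<subseteq> carrier A \<and>
     (\<forall>u\<in>U. \<exists>F. finite F \<and> F \<subseteq> carrier C \<and> u <+\<^bsub>A\<^esub> orth R A \<kappa> F \<subseteq> U)"
proof -
  let ?\<B> = "{orth R A \<kappa> F | F. finite F \<and> F \<subseteq> carrier C}"
  have dir: "\<exists>B''\<in>?\<B>. B'' \<subseteq> B \<inter> B'" if BB': "B \<in> ?\<B>" "B' \<in> ?\<B>" for B B'
  proof -
    obtain F F' where F: "B = orth R A \<kappa> F" "finite F" "F \<subseteq> carrier C"
      "B' = orth R A \<kappa> F'" "finite F'" "F' \<subseteq> carrier C"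
      using BB' by auto
    have "orth R A \<kappa> (F \<union> F') \<subseteq> B \<inter> B'"
      unfolding F(1,4) by (auto simp: orth_def)
    moreover have "orth R A \<kappa> (F \<union> F') \<in> ?\<B>"
      using F by (intro CollectI exI[of _ "F \<union> F'"]) simp
    ultimately show ?thesis by (rule bexI)
  qed
  have "istopology (\<lambda>U. U \<subseteq> carrier A \<and> (\<forall>u\<in>U. \<exists>B\<in>?\<B>. u <+\<^bsub>A\<^esub> B \<subseteq> U))"
    by (rule istopology_linear[OF _ dir]) (auto intro: exI[of _ "{}"])
  then show ?thesis
    unfolding weak_topology_def linear_topology_def
    by (simp only: topology_inverse' bex_setcompr)
qed

subsection \<open>Well-definedness of maps out of a tensor product\<close>

lemma formal_sum_superset:
  fixes G (structure)
  assumes "abelian_group G" and "\<And>x y. (x, y) \<in> S \<Longrightarrow> h x y \<in> carrier G"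
    and "finite S" "Poly_Mapping.keys z \<subseteq> S"
  shows "formal_sum G h z = (\<Oplus>\<^bsub>G\<^esub>p\<in>S. [Poly_Mapping.lookup z p] \<cdot>\<^bsub>G\<^esub> h (fst p) (snd p))"
proof -
  interpret abelian_group G by fact
  show ?thesis
    unfolding formal_sum_def
  proof (rule add.finprod_mono_neutral_cong_left)
    show "[Poly_Mapping.lookup z i] \<cdot>\<^bsub>G\<^esub> h (fst i) (snd i) = \<zero>\<^bsub>G\<^esub>"
      if "i \<in> S - Poly_Mapping.keys z" for i
      using that by (auto simp: in_keys_iff add_pow_def)
  qed (use assms in auto)
qed

lemma formal_sum_closed:
  assumes "abelian_group G" and "\<And>x y. (x, y) \<in> S \<Longrightarrow> h x y \<in> carrier G"
    and "Poly_Mapping.keys z \<subseteq> S"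
  shows "formal_sum G h z \<in> carrier G"
proof -
  interpret abelian_group G by fact
  show ?thesis unfolding formal_sum_def
    by (rule finsum_closed) (use assms in auto)
qed

lemma formal_sum_add:
  fixes G (structure)
  assumes G: "abelian_group G" and h: "\<And>x y. (x, y) \<in> S \<Longrightarrow> h x y \<in> carrier G"
    and z: "Poly_Mapping.keys z \<subseteq> S" and w: "Poly_Mapping.keys w \<subseteq> S"
  shows "formal_sum G h (z + w) = formal_sum G h z \<oplus>\<^bsub>G\<^esub> formal_sum G h w"
proof -
  interpret abelian_group G by fact
  let ?S = "Poly_Mapping.keys z \<union> Poly_Mapping.keys w"
  have fin: "finite ?S" by simp
  have h': "h x y \<in> carrier G" if "(x, y) \<in> ?S" for x y using that h z w by blast
  have h'': "h (fst p) (snd p) \<in> carrier G" if "p \<in> ?S" for p using h' that by (metis prod.collapse)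
  have "formal_sum G h (z + w) = (\<Oplus>p\<in>?S. [Poly_Mapping.lookup (z + w) p] \<cdot> h (fst p) (snd p))"
    by (rule formal_sum_superset[OF G h' fin]) (auto dest: subsetD[OF keys_add])
  also have "\<dots> = (\<Oplus>p\<in>?S. [Poly_Mapping.lookup z p] \<cdot> h (fst p) (snd p) \<oplus> [Poly_Mapping.lookup w p] \<cdot> h (fst p) (snd p))"
    by (rule finsum_cong') (use h'' in \<open>auto simp: lookup_add add.int_pow_mult\<close>)
  also have "\<dots> = (\<Oplus>p\<in>?S. [Poly_Mapping.lookup z p] \<cdot> h (fst p) (snd p)) \<oplus> (\<Oplus>p\<in>?S. [Poly_Mapping.lookup w p] \<cdot> h (fst p) (snd p))"
    by (rule finsum_addf) (use h'' in auto)
  also have "\<dots> = formal_sum G h z \<oplus> formal_sum G h w"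
    using formal_sum_superset[OF G h' fin, where z = z] formal_sum_superset[OF G h' fin, where z = w] by simp
  finally show ?thesis .
qed

lemma formal_sum_frag_of:
  assumes "abelian_group G" and "h x y \<in> carrier G"
  shows "formal_sum G h (frag_of (x, y)) = h x y"
proof -
  interpret abelian_group G by fact
  show ?thesis using assms(2) by (simp add: formal_sum_def keys_frag_of)
qed

lemma formal_sum_hom:
  assumes "abelian_group G" and "\<And>x y. (x, y) \<in> S \<Longrightarrow> h x y \<in> carrier G"
  shows "group_hom (free_Abelian_group S) (add_monoid G) (formal_sum G h)"
proof -
  interpret abelian_group G by fact
  show ?thesis
    unfolding group_hom_def group_hom_axioms_def
    using formal_sum_add[OF assms] formal_sum_closed[OF assms]
    by (auto intro!: homI a_group)
qed

lemma formal_sum_diff: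
  assumes G: "abelian_group G" and h: "\<And>x y. (x, y) \<in> S \<Longrightarrow> h x y \<in> carrier G"
    and z: "Poly_Mapping.keys z \<subseteq> S" and w: "Poly_Mapping.keys w \<subseteq> S"
  shows "formal_sum G h (z - w) = formal_sum G h z \<ominus>\<^bsub>G\<^esub> formal_sum G h w"
proof -
  interpret group_hom "free_Abelian_group S" "add_monoid G" "formal_sum G h"
    by (rule formal_sum_hom[OF G h])
  have "formal_sum G h (- w) = \<ominus>\<^bsub>G\<^esub> formal_sum G h w"
    using hom_inv[of w] w by (simp add: a_inv_def)
  then show ?thesis
    using formal_sum_add[OF G h z, where w = "- w"] w by (simp add: a_minus_def)
qed

definition balanced ::
  "('r, 'x) ring_scheme \<Rightarrow> ('r, 'm, 'y) rmodule_scheme \<Rightarrow> ('r, 'n, 'z) bimodule_scheme \<Rightarrow>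
   ('g, 'w) ring_scheme \<Rightarrow> ('m \<Rightarrow> 'n \<Rightarrow> 'g) \<Rightarrow> bool" where
  "balanced R M N G h \<longleftrightarrow>
     (\<forall>x\<in>carrier M. \<forall>y\<in>carrier N. h x y \<in> carrier G) \<and>
     (\<forall>x\<in>carrier M. \<forall>x'\<in>carrier M. \<forall>y\<in>carrier N. h (x \<oplus>\<^bsub>M\<^esub> x') y = h x y \<oplus>\<^bsub>G\<^esub> h x' y) \<and>
     (\<forall>x\<in>carrier M. \<forall>y\<in>carrier N. \<forall>y'\<in>carrier N. h x (y \<oplus>\<^bsub>N\<^esub> y') = h x y \<oplus>\<^bsub>G\<^esub> h x y') \<and>
     (\<forall>x\<in>carrier M. \<forall>r\<in>carrier R. \<forall>y\<in>carrier N. h (x \<triangleleft>\<^bsub>M\<^esub> r) y = h x (r \<triangleright>\<^bsub>N\<^esub> y))"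

lemma keys_relator2:
  assumes "p \<in> S" "q \<in> S"
  shows "Poly_Mapping.keys (frag_of p - frag_of q) \<subseteq> S"
  using assms keys_diff[of "frag_of p" "frag_of q"] by (auto simp: keys_frag_of)

locale tensor_factors = MM: right_module R M + NN: bimodule R N
  for R :: "('r, 'x) ring_scheme" (structure)
    and M :: "('r, 'm, 'y) rmodule_scheme" (structure)
    and N :: "('r, 'n, 'z) bimodule_scheme" (structure)
begin

lemma relator_zero:
  assumes "abelian_group G" "a \<in> carrier G" "b \<in> carrier G"
  shows "(a \<oplus>\<^bsub>G\<^esub> b) \<ominus>\<^bsub>G\<^esub> a \<ominus>\<^bsub>G\<^esub> b = \<zero>\<^bsub>G\<^esub>"
proof -
  interpret abelian_group G by fact
  have "(a \<oplus>\<^bsub>G\<^esub> b) \<oplus>\<^bsub>G\<^esub> \<ominus>\<^bsub>G\<^esub> a = b"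
    using assms(2,3) by (metis a_comm a_inv_closed a_closed r_neg1 a_assoc r_neg2 l_neg)
  then show ?thesis using assms(2,3) by (simp add: a_minus_def r_neg)
qed

lemma keys_relator:
  assumes "p \<in> S" "q \<in> S" "r \<in> S"
  shows "Poly_Mapping.keys (frag_of p - frag_of q - frag_of r) \<subseteq> S"
  using assms keys_diff[of "frag_of p - frag_of q" "frag_of r"] keys_diff[of "frag_of p" "frag_of q"]
  by (auto simp: keys_frag_of)

lemma tensor_relators_closed: "tensor_relators R M N \<subseteq> carrier (tensor_free M N)"
proof
  fix z assume "z \<in> tensor_relators R M N"
  then have "Poly_Mapping.keys z \<subseteq> carrier M \<times> carrier N"
    unfolding tensor_relators_def
  proof (elim UnE CollectE exE conjE)
    fix x r y assume *: "z = frag_of (x \<triangleleft>\<^bsub>M\<^esub> r, y) - frag_of (x, r \<triangleright>\<^bsub>N\<^esub> y)"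
      "x \<in> carrier M" "r \<in> carrier R" "y \<in> carrier N"
    then show ?thesis
      unfolding *(1) by (intro keys_relator2 SigmaI) (simp_all add: MM.rsmult_closed NN.lsmult_closed)
  next
    fix x x' y assume *: "z = frag_of (x \<oplus>\<^bsub>M\<^esub> x', y) - frag_of (x, y) - frag_of (x', y)"
      "x \<in> carrier M" "x' \<in> carrier M" "y \<in> carrier N"
    then show ?thesis
      unfolding *(1) by (intro keys_relator SigmaI) simp_all
  next
    fix x y y' assume *: "z = frag_of (x, y \<oplus>\<^bsub>N\<^esub> y') - frag_of (x, y) - frag_of (x, y')"
      "x \<in> carrier M" "y \<in> carrier N" "y' \<in> carrier N"
    then show ?thesis
      unfolding *(1) by (intro keys_relator SigmaI) simp_all
  qed
  then show "z \<in> carrier (tensor_free M N)" by simp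
qed

lemma tensor_kernel_subgroup: "subgroup (tensor_kernel R M N) (tensor_free M N)"
  unfolding tensor_kernel_def
  by (rule group.generate_is_subgroup[OF group_free_Abelian_group tensor_relators_closed])

lemma formal_sum_tensor_kernel:
  assumes G: "abelian_group G" and h: "balanced R M N G h" and z: "z \<in> tensor_kernel R M N"
  shows "formal_sum G h z = \<zero>\<^bsub>G\<^esub>"
proof -
  interpret G: abelian_group G by fact
  have hc: "h x y \<in> carrier G" if "(x, y) \<in> carrier M \<times> carrier N" for x y
    using h that by (auto simp: balanced_def)
  have f: "group_hom (tensor_free M N) (add_monoid G) (formal_sum G h)"
    by (rule formal_sum_hom[OF G]) (rule hc)
  have diff: "formal_sum G h (v - w) = formal_sum G h v \<ominus>\<^bsub>G\<^esub> formal_sum G h w"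
    if "Poly_Mapping.keys v \<subseteq> carrier M \<times> carrier N" "Poly_Mapping.keys w \<subseteq> carrier M \<times> carrier N" for v w
    by (rule formal_sum_diff[where S = "carrier M \<times> carrier N"]) (use G hc that in simp_all)
  have of: "formal_sum G h (frag_of (x, y)) = h x y" if "x \<in> carrier M" "y \<in> carrier N" for x y
    by (rule formal_sum_frag_of[OF G]) (use hc that in simp)
  have "tensor_relators R M N \<subseteq> kernel (tensor_free M N) (add_monoid G) (formal_sum G h)"
  proof
    fix w assume w: "w \<in> tensor_relators R M N"
    have "formal_sum G h w = \<zero>\<^bsub>G\<^esub>"
      using w unfolding tensor_relators_def
    proof (elim UnE CollectE exE conjE)
      fix x x' y assume *: "w = frag_of (x \<oplus>\<^bsub>M\<^esub> x', y) - frag_of (x, y) - frag_of (x', y)"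
        "x \<in> carrier M" "x' \<in> carrier M" "y \<in> carrier N"
      have "formal_sum G h w = h (x \<oplus>\<^bsub>M\<^esub> x') y \<ominus>\<^bsub>G\<^esub> h x y \<ominus>\<^bsub>G\<^esub> h x' y"
        using * by (subst *(1)) (simp add: diff of keys_frag_of keys_relator2)
      also have "\<dots> = (h x y \<oplus>\<^bsub>G\<^esub> h x' y) \<ominus>\<^bsub>G\<^esub> h x y \<ominus>\<^bsub>G\<^esub> h x' y"
        using h * by (simp add: balanced_def)
      also have "\<dots> = \<zero>\<^bsub>G\<^esub>"
        by (rule relator_zero[OF G]) (use hc * in auto)
      finally show ?thesis .
    next
      fix x y y' assume *: "w = frag_of (x, y \<oplus>\<^bsub>N\<^esub> y') - frag_of (x, y) - frag_of (x, y')"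
        "x \<in> carrier M" "y \<in> carrier N" "y' \<in> carrier N"
      have "formal_sum G h w = h x (y \<oplus>\<^bsub>N\<^esub> y') \<ominus>\<^bsub>G\<^esub> h x y \<ominus>\<^bsub>G\<^esub> h x y'"
        using * by (subst *(1)) (simp add: diff of keys_frag_of keys_relator2)
      also have "\<dots> = (h x y \<oplus>\<^bsub>G\<^esub> h x y') \<ominus>\<^bsub>G\<^esub> h x y \<ominus>\<^bsub>G\<^esub> h x y'"
        using h * by (simp add: balanced_def)
      also have "\<dots> = \<zero>\<^bsub>G\<^esub>"
        by (rule relator_zero[OF G]) (use hc * in auto)
      finally show ?thesis .
    next
      fix x r y assume *: "w = frag_of (x \<triangleleft>\<^bsub>M\<^esub> r, y) - frag_of (x, r \<triangleright>\<^bsub>N\<^esub> y)"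
        "x \<in> carrier M" "r \<in> carrier R" "y \<in> carrier N"
      then have c: "x \<triangleleft>\<^bsub>M\<^esub> r \<in> carrier M" "r \<triangleright>\<^bsub>N\<^esub> y \<in> carrier N"
        by (simp_all add: MM.rsmult_closed NN.lsmult_closed)
      have "formal_sum G h w = h (x \<triangleleft>\<^bsub>M\<^esub> r) y \<ominus>\<^bsub>G\<^esub> h x (r \<triangleright>\<^bsub>N\<^esub> y)"
        using * c by (subst *(1)) (simp add: diff of keys_frag_of)
      then show ?thesis
        using h * c by (simp add: balanced_def G.r_neg G.minus_eq)
    qed
    then show "w \<in> kernel (tensor_free M N) (add_monoid G) (formal_sum G h)"
      using subsetD[OF tensor_relators_closed w] by (simp add: kernel_def)
  qed
  moreover have "subgroup (kernel (tensor_free M N) (add_monoid G) (formal_sum G h)) (tensor_free M N)"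
    using f by (rule group_hom.subgroup_kernel)
  ultimately have "tensor_kernel R M N \<subseteq> kernel (tensor_free M N) (add_monoid G) (formal_sum G h)"
    unfolding tensor_kernel_def
    by (rule group.generate_subgroup_incl[OF group_free_Abelian_group])
  then have "z \<in> kernel (tensor_free M N) (add_monoid G) (formal_sum G h)"
    using z by (rule subsetD)
  then show ?thesis by (simp add: kernel_def)
qed

lemma tensor_kernel_closed: "z \<in> tensor_kernel R M N \<Longrightarrow> Poly_Mapping.keys z \<subseteq> carrier M \<times> carrier N"
  by (drule subsetD[OF subgroup.subset[OF tensor_kernel_subgroup]]) (simp only: carrier_free_Abelian_group_iff)

lemma tensor_carrierE:
  assumes "t \<in> carrier (tensor R M N)"
  obtains z where "Poly_Mapping.keys z \<subseteq> carrier M \<times> carrier N" "z \<in> t"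
    "t = tensor_kernel R M N #>\<^bsub>tensor_free M N\<^esub> z"
proof -
  obtain z where z: "Poly_Mapping.keys z \<subseteq> carrier M \<times> carrier N"
    and t: "t = tensor_kernel R M N #>\<^bsub>tensor_free M N\<^esub> z"
    using assms by (auto simp: tensor_def Let_def FactGroup_def RCOSETS_def)
  moreover have "z \<in> t"
    unfolding t by (rule group.rcos_self[OF group_free_Abelian_group _ tensor_kernel_subgroup]) (simp add: z)
  ultimately show ?thesis using that by blast
qed

lemma tensor_lift_eq:
  assumes G: "abelian_group G" and h: "balanced R M N G h"
    and t: "t \<in> carrier (tensor R M N)" and z: "z \<in> t"
  shows "tensor_lift G h t = formal_sum G h z"
proof -
  interpret G: abelian_group G by fact
  have hc: "h x y \<in> carrier G" if "(x, y) \<in> carrier M \<times> carrier N" for x y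
    using h that by (auto simp: balanced_def)
  obtain w where w: "Poly_Mapping.keys w \<subseteq> carrier M \<times> carrier N"
    "t = tensor_kernel R M N #>\<^bsub>tensor_free M N\<^esub> w"
    by (rule tensor_carrierE[OF t])
  have "formal_sum G h v = formal_sum G h w" if v: "v \<in> t" for v
  proof -
    obtain k where k: "k \<in> tensor_kernel R M N" "v = k + w"
      using v w(2) by (auto simp: r_coset_def)
    have "formal_sum G h v = formal_sum G h k \<oplus>\<^bsub>G\<^esub> formal_sum G h w"
      unfolding k(2)
      by (rule formal_sum_add[where S = "carrier M \<times> carrier N"])
         (use G hc tensor_kernel_closed[OF k(1)] w(1) in simp_all)
    moreover have "formal_sum G h w \<in> carrier G"
      by (rule formal_sum_closed[where S = "carrier M \<times> carrier N"]) (use G hc w(1) in simp_all)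
    ultimately show ?thesis
      using formal_sum_tensor_kernel[OF G h k(1)] by simp
  qed
  then show ?thesis
    unfolding tensor_lift_def by (metis someI z)
qed

end

subsection \<open>The alpha-condition extends to modules over all types\<close>

lemma tensor_kernel_map:
  assumes M: "right_module R M" and M': "right_module R M'" and N: "bimodule R N"
    and \<phi>: "\<phi> \<in> right_hom R M M'" and z: "z \<in> tensor_kernel R M N"
  shows "frag_extend (\<lambda>p. frag_of (\<phi> (fst p), snd p)) z \<in> tensor_kernel R M' N"
proof -
  let ?E = "frag_extend (\<lambda>p. frag_of (\<phi> (fst p), snd p))"
  interpret T: tensor_factors R M N using M N by (intro tensor_factors.intro)
  interpret T': tensor_factors R M' N using M' N by (intro tensor_factors.intro)
  have \<phi>c: "\<phi> x \<in> carrier M'" if "x \<in> carrier M" for x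
    using \<phi> that by (auto simp: right_hom_def)
  have rel: "?E w \<in> tensor_relators R M' N" if "w \<in> tensor_relators R M N" for w
    using that unfolding tensor_relators_def[of R M N]
  proof (elim UnE CollectE exE conjE)
    fix x x' y assume *: "w = frag_of (x \<oplus>\<^bsub>M\<^esub> x', y) - frag_of (x, y) - frag_of (x', y)"
      "x \<in> carrier M" "x' \<in> carrier M" "y \<in> carrier N"
    then have "?E w = frag_of (\<phi> x \<oplus>\<^bsub>M'\<^esub> \<phi> x', y) - frag_of (\<phi> x, y) - frag_of (\<phi> x', y)"
      using \<phi> by (simp add: frag_extend_diff right_hom_def)
    then show ?thesis
      unfolding tensor_relators_def using * \<phi>c by blast
  next
    fix x y y' assume *: "w = frag_of (x, y \<oplus>\<^bsub>N\<^esub> y') - frag_of (x, y) - frag_of (x, y')"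
      "x \<in> carrier M" "y \<in> carrier N" "y' \<in> carrier N"
    then have "?E w = frag_of (\<phi> x, y \<oplus>\<^bsub>N\<^esub> y') - frag_of (\<phi> x, y) - frag_of (\<phi> x, y')"
      by (simp add: frag_extend_diff)
    then show ?thesis
      unfolding tensor_relators_def using * \<phi>c by blast
  next
    fix x r y assume *: "w = frag_of (x \<triangleleft>\<^bsub>M\<^esub> r, y) - frag_of (x, r \<triangleright>\<^bsub>N\<^esub> y)"
      "x \<in> carrier M" "r \<in> carrier R" "y \<in> carrier N"
    then have "?E w = frag_of (\<phi> x \<triangleleft>\<^bsub>M'\<^esub> r, y) - frag_of (\<phi> x, r \<triangleright>\<^bsub>N\<^esub> y)"
      using \<phi> by (simp add: frag_extend_diff right_hom_def)
    then show ?thesis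
      unfolding tensor_relators_def using * \<phi>c by blast
  qed
  have "z \<in> generate (tensor_free M N) (tensor_relators R M N)"
    using z by (simp add: tensor_kernel_def)
  then show ?thesis
  proof (induction z rule: generate.induct)
    case one
    then show ?case using subgroup.one_closed[OF T'.tensor_kernel_subgroup] by simp
  next
    case (incl w)
    then show ?case unfolding tensor_kernel_def by (intro generate.incl rel)
  next
    case (inv w)
    have "?E w \<in> tensor_kernel R M' N"
      unfolding tensor_kernel_def by (intro generate.incl rel inv)
    then have "inv\<^bsub>tensor_free M' N\<^esub> (?E w) \<in> tensor_kernel R M' N"
      by (rule subgroup.m_inv_closed[OF T'.tensor_kernel_subgroup])
    moreover have "Poly_Mapping.keys w \<subseteq> carrier M \<times> carrier N"
      using subsetD[OF T.tensor_relators_closed inv] by simp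
    moreover have "Poly_Mapping.keys (?E w) \<subseteq> carrier M' \<times> carrier N"
      using T'.tensor_kernel_closed[OF \<open>?E w \<in> tensor_kernel R M' N\<close>] .
    ultimately show ?case by (simp add: frag_extend_minus)
  next
    case (eng v w)
    then show ?case
      using subgroup.m_closed[OF T'.tensor_kernel_subgroup eng(3,4)] by (simp add: frag_extend_add)
  qed
qed

lemma transported_module:
  fixes M :: "('r, 'm, 'y) rmodule_scheme" and j :: "'m \<Rightarrow> 'u"
  assumes M: "right_module R M" and N: "right_submodule R M N" and j: "inj_on j N"
  obtains M0 :: "('r, 'u) rmodule"
  where "right_module R M0" "carrier M0 = j ` N"
    "inv_into N j \<in> right_hom R M0 M" "\<zero>\<^bsub>M0\<^esub> = j \<zero>\<^bsub>M\<^esub>"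
proof -
  interpret M: right_module R M by fact
  interpret N: additive_subgroup N M using N by (simp add: right_submodule_def)
  have Nr: "x \<triangleleft>\<^bsub>M\<^esub> r \<in> N" if "x \<in> N" "r \<in> carrier R" for x r
    using N that by (simp add: right_submodule_def)
  have NM: "x \<in> carrier M" if "x \<in> N" for x using N.a_Hcarr that .
  define d where "d = inv_into N j"
  have d[simp]: "d (j x) = x" if "x \<in> N" for x using j that by (simp add: d_def)
  define M0 :: "('r, 'u) rmodule" where
    "M0 = \<lparr>carrier = j ` N, monoid.mult = undefined, monoid.one = undefined, ring.zero = j \<zero>\<^bsub>M\<^esub>,
      ring.add = (\<lambda>X Y. j (d X \<oplus>\<^bsub>M\<^esub> d Y)), rsmult = (\<lambda>X r. j (d X \<triangleleft>\<^bsub>M\<^esub> r))\<rparr>"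
  have "abelian_group M0"
  proof (rule abelian_groupI)
    fix X assume "X \<in> carrier M0"
    then obtain x where x: "x \<in> N" "X = j x" by (auto simp: M0_def)
    then show "\<exists>Y\<in>carrier M0. Y \<oplus>\<^bsub>M0\<^esub> X = \<zero>\<^bsub>M0\<^esub>"
      by (intro bexI[of _ "j (\<ominus>\<^bsub>M\<^esub> x)"]) (auto simp: M0_def NM M.l_neg)
  qed (auto simp: M0_def NM M.a_ac)
  then have rm: "right_module R M0"
  proof (intro right_module.intro right_module_axioms.intro)
    show "ring R" by (rule M.R.ring_axioms)
  qed (auto simp: M0_def NM Nr M.rsmult_add_left M.rsmult_add_right M.rsmult_assoc M.rsmult_one)
  have "d \<in> right_hom R M0 M"
    by (auto simp: right_hom_def M0_def NM Nr)
  then show ?thesis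
    using that[of M0] rm by (simp add: M0_def d_def)
qed

lemma fg_submodule_into_type:
  fixes M :: "('r, 'm, 'y) rmodule_scheme"
  assumes M: "right_module R M" and F: "finite F" "F \<subseteq> carrier M"
  obtains N and j :: "'m \<Rightarrow> (nat \<Rightarrow> 'r) set"
  where "right_submodule R M N" "F \<subseteq> N" "inj_on j N"
proof -
  interpret M: right_module R M by fact
  obtain idx :: "'m \<Rightarrow> nat" where idx: "inj_on idx F"
    using finite_imp_inj_to_nat_seg[OF F(1)] by blast
  define G where "G = {g :: nat \<Rightarrow> 'r. \<forall>i. g i \<in> carrier R}"
  define S where "S = (\<lambda>g. \<Oplus>\<^bsub>M\<^esub>x\<in>F. x \<triangleleft>\<^bsub>M\<^esub> g (idx x))"
  have Fc: "x \<triangleleft>\<^bsub>M\<^esub> g (idx x) \<in> carrier M" if "x \<in> F" "g \<in> G" for x g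
    using that F by (auto simp: G_def M.rsmult_closed)
  have Sc: "S g \<in> carrier M" if "g \<in> G" for g
    unfolding S_def by (rule M.M.finsum_closed) (use Fc that in auto)
  have S0: "S (\<lambda>_. \<zero>\<^bsub>R\<^esub>) = \<zero>\<^bsub>M\<^esub>"
  proof -
    have "x \<triangleleft>\<^bsub>M\<^esub> \<zero>\<^bsub>R\<^esub> = \<zero>\<^bsub>M\<^esub>" if "x \<in> F" for x
    proof -
      have x: "x \<in> carrier M" using F that by auto
      have c: "x \<triangleleft>\<^bsub>M\<^esub> \<zero>\<^bsub>R\<^esub> \<in> carrier M" using x by (simp add: M.rsmult_closed)
      have "x \<triangleleft>\<^bsub>M\<^esub> \<zero>\<^bsub>R\<^esub> \<oplus>\<^bsub>M\<^esub> x \<triangleleft>\<^bsub>M\<^esub> \<zero>\<^bsub>R\<^esub> = x \<triangleleft>\<^bsub>M\<^esub> \<zero>\<^bsub>R\<^esub>"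
        using M.rsmult_add_right[OF x M.R.zero_closed M.R.zero_closed] by simp
      then show ?thesis using c M.M.add.r_cancel_one by blast
    qed
    then show ?thesis unfolding S_def by (intro M.M.add.finprod_one_eqI)
  qed
  have Sadd: "S (\<lambda>i. g i \<oplus>\<^bsub>R\<^esub> h i) = S g \<oplus>\<^bsub>M\<^esub> S h" if "g \<in> G" "h \<in> G" for g h
  proof -
    have "S (\<lambda>i. g i \<oplus>\<^bsub>R\<^esub> h i) = (\<Oplus>\<^bsub>M\<^esub>x\<in>F. x \<triangleleft>\<^bsub>M\<^esub> g (idx x) \<oplus>\<^bsub>M\<^esub> x \<triangleleft>\<^bsub>M\<^esub> h (idx x))"
      unfolding S_def
      by (rule M.M.finsum_cong') (use F that in \<open>auto simp: G_def M.rsmult_add_right M.rsmult_closed\<close>)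
    also have "\<dots> = S g \<oplus>\<^bsub>M\<^esub> S h"
      unfolding S_def by (rule M.M.finsum_addf) (use Fc that in auto)
    finally show ?thesis .
  qed
  have Sneg: "\<ominus>\<^bsub>M\<^esub> S g = S (\<lambda>i. \<ominus>\<^bsub>R\<^esub> g i)" if "g \<in> G" for g
  proof -
    have g': "(\<lambda>i. \<ominus>\<^bsub>R\<^esub> g i) \<in> G" using that by (auto simp: G_def)
    have "S (\<lambda>i. \<ominus>\<^bsub>R\<^esub> g i) \<oplus>\<^bsub>M\<^esub> S g = S (\<lambda>i. \<ominus>\<^bsub>R\<^esub> g i \<oplus>\<^bsub>R\<^esub> g i)"
      by (rule Sadd[OF g' that, symmetric])
    also have "\<dots> = \<zero>\<^bsub>M\<^esub>"
      using S0 that by (simp add: G_def M.R.l_neg)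
    finally show ?thesis
      using M.M.minus_equality Sc g' that by blast
  qed
  have Sr: "S g \<triangleleft>\<^bsub>M\<^esub> r = S (\<lambda>i. g i \<otimes>\<^bsub>R\<^esub> r)" if g: "g \<in> G" and r: "r \<in> carrier R" for g r
  proof -
    interpret f: group_hom "add_monoid M" "add_monoid M" "\<lambda>x. x \<triangleleft>\<^bsub>M\<^esub> r"
      using r by unfold_locales (auto simp: hom_def M.rsmult_closed M.rsmult_add_left)
    have "(\<Oplus>\<^bsub>M\<^esub>x\<in>F'. x \<triangleleft>\<^bsub>M\<^esub> g (idx x)) \<triangleleft>\<^bsub>M\<^esub> r = (\<Oplus>\<^bsub>M\<^esub>x\<in>F'. x \<triangleleft>\<^bsub>M\<^esub> (g (idx x) \<otimes>\<^bsub>R\<^esub> r))"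
      if "F' \<subseteq> F" for F'
      using finite_subset[OF that F(1)] that
    proof (induction F' rule: finite_induct)
      case empty
      then show ?case using f.hom_one by simp
    next
      case (insert x F')
      then have x: "x \<in> F" "x \<in> carrier M" and F': "F' \<subseteq> F" using F by auto
      have gr: "g i \<in> carrier R" for i using g by (simp add: G_def)
      have c: "(\<lambda>x. x \<triangleleft>\<^bsub>M\<^esub> g (idx x)) \<in> F' \<rightarrow> carrier M"
        "(\<lambda>x. x \<triangleleft>\<^bsub>M\<^esub> (g (idx x) \<otimes>\<^bsub>R\<^esub> r)) \<in> F' \<rightarrow> carrier M"
        using F' F gr r by (auto simp: M.rsmult_closed)
      then show ?case
        using insert x F' gr r c
        by (simp add: M.rsmult_closed M.rsmult_assoc M.rsmult_add_left)
    qed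
    then show ?thesis unfolding S_def by blast
  qed
  have sub: "right_submodule R M (S ` G)"
    unfolding right_submodule_def
  proof (intro conjI ballI additive_subgroup.intro subgroup.intro)
    show "S ` G \<subseteq> carrier (add_monoid M)" using Sc by auto
    show "x \<otimes>\<^bsub>add_monoid M\<^esub> y \<in> S ` G" if "x \<in> S ` G" "y \<in> S ` G" for x y
      using that by (auto simp: Sadd[symmetric] G_def intro!: imageI)
    show "\<one>\<^bsub>add_monoid M\<^esub> \<in> S ` G"
      using S0 by (auto simp: G_def image_iff intro!: exI[of _ "\<lambda>_. \<zero>\<^bsub>R\<^esub>"])
    show "inv\<^bsub>add_monoid M\<^esub> x \<in> S ` G" if "x \<in> S ` G" for x
      using that Sneg by (auto simp: a_inv_def[symmetric] G_def intro!: imageI)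
    show "x \<triangleleft>\<^bsub>M\<^esub> r \<in> S ` G" if "x \<in> S ` G" "r \<in> carrier R" for x r
      using that by (auto simp: Sr) (auto simp: G_def)
  qed
  have "F \<subseteq> S ` G"
  proof
    fix x assume x: "x \<in> F"
    define g where "g = (\<lambda>i. if i = idx x then \<one>\<^bsub>R\<^esub> else \<zero>\<^bsub>R\<^esub>)"
    have g: "g \<in> G" by (auto simp: g_def G_def)
    have "S g = (\<Oplus>\<^bsub>M\<^esub>y\<in>F. if x = y then y else \<zero>\<^bsub>M\<^esub>)"
      unfolding S_def
    proof (rule M.M.finsum_cong')
      fix y assume y: "y \<in> F"
      then have yc: "y \<in> carrier M" using F by auto
      have c: "y \<triangleleft>\<^bsub>M\<^esub> \<zero>\<^bsub>R\<^esub> \<in> carrier M" using yc by (simp add: M.rsmult_closed)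
      have "y \<triangleleft>\<^bsub>M\<^esub> \<zero>\<^bsub>R\<^esub> \<oplus>\<^bsub>M\<^esub> y \<triangleleft>\<^bsub>M\<^esub> \<zero>\<^bsub>R\<^esub> = y \<triangleleft>\<^bsub>M\<^esub> \<zero>\<^bsub>R\<^esub>"
        using M.rsmult_add_right[OF yc M.R.zero_closed M.R.zero_closed] by simp
      then have "y \<triangleleft>\<^bsub>M\<^esub> \<zero>\<^bsub>R\<^esub> = \<zero>\<^bsub>M\<^esub>" using c M.M.add.r_cancel_one by blast
      then show "y \<triangleleft>\<^bsub>M\<^esub> g (idx y) = (if x = y then y else \<zero>\<^bsub>M\<^esub>)"
        using inj_onD[OF idx, of y x] x y yc by (auto simp: g_def M.rsmult_one)
    qed (use F in auto)
    also have "\<dots> = x"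
      using M.M.finsum_singleton[of x F "\<lambda>y. y"] x F by auto
    finally show "x \<in> S ` G" using g by blast
  qed
  moreover have "inj_on (\<lambda>x. {g \<in> G. S g = x}) (S ` G)"
    by (rule inj_onI) blast
  ultimately show ?thesis using that sub by blast
qed

lemma formal_sum_transport:
  assumes M: "right_module R M" and M0: "right_module R M0" and d: "d \<in> right_hom R M0 M"
    and i: "\<And>x. x \<in> N \<Longrightarrow> i x \<in> carrier M0 \<and> d (i x) = x" and NM: "N \<subseteq> carrier M"
    and k: "\<And>c. c \<in> C \<Longrightarrow> k c \<in> carrier R"
    and z: "Poly_Mapping.keys z \<subseteq> N \<times> C"
  shows "d (formal_sum M0 (\<lambda>m c. m \<triangleleft>\<^bsub>M0\<^esub> k c) (frag_extend (\<lambda>p. frag_of (i (fst p), snd p)) z))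
         = formal_sum M (\<lambda>m c. m \<triangleleft>\<^bsub>M\<^esub> k c) z"
    "frag_extend (\<lambda>p. frag_of (d (fst p), snd p)) (frag_extend (\<lambda>p. frag_of (i (fst p), snd p)) z) = z"
    "Poly_Mapping.keys (frag_extend (\<lambda>p. frag_of (i (fst p), snd p)) z) \<subseteq> carrier M0 \<times> C"
proof -
  interpret M: right_module R M by fact
  interpret M0: right_module R M0 by fact
  let ?I = "frag_extend (\<lambda>p. frag_of (i (fst p), snd p))"
  let ?D = "frag_extend (\<lambda>p. frag_of (d (fst p), snd p))"
  let ?g = "formal_sum M0 (\<lambda>m c. m \<triangleleft>\<^bsub>M0\<^esub> k c)"
  let ?f = "formal_sum M (\<lambda>m c. m \<triangleleft>\<^bsub>M\<^esub> k c)"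
  interpret d: group_hom "add_monoid M0" "add_monoid M" d
    using d by unfold_locales (auto simp: hom_def right_hom_def)
  have keys: "Poly_Mapping.keys (?I w) \<subseteq> carrier M0 \<times> C" if "Poly_Mapping.keys w \<subseteq> N \<times> C" for w
    using keys_frag_extend[of "\<lambda>p. frag_of (i (fst p), snd p)" w] that i by (fastforce simp: keys_frag_of)
  have ddiff: "d (x \<ominus>\<^bsub>M0\<^esub> y) = d x \<ominus>\<^bsub>M\<^esub> d y" if "x \<in> carrier M0" "y \<in> carrier M0" for x y
    using d.hom_mult[of x "\<ominus>\<^bsub>M0\<^esub> y"] d.hom_inv[of y] that by (simp add: a_minus_def a_inv_def)
  have "d (?g (?I z)) = ?f z \<and> ?D (?I z) = z"
  proof (rule free_Abelian_group_induct[OF z])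
    show "d (?g (?I 0)) = ?f 0 \<and> ?D (?I 0) = 0"
      using d.hom_one by (simp add: formal_sum_def)
  next
    fix v w assume vw: "Poly_Mapping.keys v \<subseteq> N \<times> C" "Poly_Mapping.keys w \<subseteq> N \<times> C"
      "d (?g (?I v)) = ?f v \<and> ?D (?I v) = v" "d (?g (?I w)) = ?f w \<and> ?D (?I w) = w"
    have "?g (?I v - ?I w) = ?g (?I v) \<ominus>\<^bsub>M0\<^esub> ?g (?I w)"
      by (rule formal_sum_diff[where S = "carrier M0 \<times> C"])
         (use vw keys M0.M.abelian_group_axioms in \<open>auto simp: M0.rsmult_closed k\<close>)
    moreover have "?g (?I u) \<in> carrier M0" if "Poly_Mapping.keys u \<subseteq> N \<times> C" for u
      by (rule formal_sum_closed[where S = "carrier M0 \<times> C"])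
         (use keys that M0.M.abelian_group_axioms in \<open>auto simp: M0.rsmult_closed k\<close>)
    moreover have "?f (v - w) = ?f v \<ominus>\<^bsub>M\<^esub> ?f w"
      by (rule formal_sum_diff[where S = "N \<times> C"])
         (use vw NM M.M.abelian_group_axioms in \<open>auto simp: M.rsmult_closed k\<close>)
    ultimately show "d (?g (?I (v - w))) = ?f (v - w) \<and> ?D (?I (v - w)) = v - w"
      using vw by (simp add: frag_extend_diff ddiff)
  next
    fix p assume "p \<in> N \<times> C"
    then obtain x c where p: "p = (x, c)" "x \<in> N" "c \<in> C" by auto
    then have "x \<in> carrier M" and ix: "i x \<in> carrier M0" "d (i x) = x" using NM i by auto
    have "d (i x \<triangleleft>\<^bsub>M0\<^esub> k c) = x \<triangleleft>\<^bsub>M\<^esub> k c"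
      using d ix k[OF p(3)] by (simp add: right_hom_def)
    moreover have "?g (frag_of (i x, c)) = i x \<triangleleft>\<^bsub>M0\<^esub> k c"
      by (rule formal_sum_frag_of) (use ix k[OF p(3)] M0.M.abelian_group_axioms in \<open>auto simp: M0.rsmult_closed\<close>)
    moreover have "?f (frag_of (x, c)) = x \<triangleleft>\<^bsub>M\<^esub> k c"
      by (rule formal_sum_frag_of) (use \<open>x \<in> carrier M\<close> k[OF p(3)] M.M.abelian_group_axioms in \<open>auto simp: M.rsmult_closed\<close>)
    ultimately show "d (?g (?I (frag_of p))) = ?f (frag_of p) \<and> ?D (?I (frag_of p)) = frag_of p"
      using p ix by simp
  qed
  then show "d (?g (?I z)) = ?f z" "?D (?I z) = z" "Poly_Mapping.keys (?I z) \<subseteq> carrier M0 \<times> C"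
    using keys[OF z] by auto
qed

context measuring_left_alpha_pairing
begin

lemma kappa_closed: "\<lbrakk>a \<in> carrier A; c \<in> carrier C\<rbrakk> \<Longrightarrow> \<kappa> a c \<in> carrier R"
  using ring_hom_closed[OF kappa_ring_hom, of a] by (auto simp: left_dual_def)

lemma alpha_balanced:
  assumes M: "right_module R M" and a: "a \<in> carrier A"
  shows "balanced R M C M (\<lambda>m c. m \<triangleleft>\<^bsub>M\<^esub> \<kappa> a c)"
proof -
  interpret M: right_module R M by fact
  have "\<kappa> a \<in> carrier (left_dual R C)" using ring_hom_closed[OF kappa_ring_hom a] .
  then show ?thesis
    using kappa_closed[OF a]
    by (auto simp: balanced_def left_dual_def M.rsmult_closed M.rsmult_add_left M.rsmult_add_right M.rsmult_assoc)
qed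

lemma alpha_map_coset:
  assumes M: "right_module R M" and z: "Poly_Mapping.keys z \<subseteq> carrier M \<times> carrier C"
    and a: "a \<in> carrier A"
  shows "tensor_kernel R M C #>\<^bsub>tensor_free M C\<^esub> z \<in> carrier (tensor R M C)"
    "alpha_map A \<kappa> M (tensor_kernel R M C #>\<^bsub>tensor_free M C\<^esub> z) a = formal_sum M (\<lambda>m c. m \<triangleleft>\<^bsub>M\<^esub> \<kappa> a c) z"
proof -
  interpret M: right_module R M by fact
  have "bimodule R C" by unfold_locales
  then interpret T: tensor_factors R M C using M by (intro tensor_factors.intro)
  show t: "tensor_kernel R M C #>\<^bsub>tensor_free M C\<^esub> z \<in> carrier (tensor R M C)"
    using z by (auto simp: tensor_def Let_def FactGroup_def RCOSETS_def)
  have "z \<in> tensor_kernel R M C #>\<^bsub>tensor_free M C\<^esub> z"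
    by (rule group.rcos_self[OF group_free_Abelian_group _ T.tensor_kernel_subgroup]) (simp add: z)
  then show "alpha_map A \<kappa> M (tensor_kernel R M C #>\<^bsub>tensor_free M C\<^esub> z) a = formal_sum M (\<lambda>m c. m \<triangleleft>\<^bsub>M\<^esub> \<kappa> a c) z"
    using T.tensor_lift_eq[OF M.M.abelian_group_axioms alpha_balanced[OF M a] t] a
    by (simp add: alpha_map_def)
qed

theorem alpha_map_inj:
  fixes M :: "('r, 'm, 'w) rmodule_scheme"
  assumes M: "right_module R M"
  shows "inj_on (alpha_map A \<kappa> M) (carrier (tensor R M C))"
proof (rule inj_onI)
  interpret M: right_module R M by fact
  have bC: "bimodule R C" by unfold_locales
  interpret T: tensor_factors R M C using M bC by (intro tensor_factors.intro)
  fix t t' assume t: "t \<in> carrier (tensor R M C)" "t' \<in> carrier (tensor R M C)"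
    and eq: "alpha_map A \<kappa> M t = alpha_map A \<kappa> M t'"
  obtain v where v: "Poly_Mapping.keys v \<subseteq> carrier M \<times> carrier C"
      "t = tensor_kernel R M C #>\<^bsub>tensor_free M C\<^esub> v"
    by (rule T.tensor_carrierE[OF t(1)])
  obtain w where w: "Poly_Mapping.keys w \<subseteq> carrier M \<times> carrier C"
      "t' = tensor_kernel R M C #>\<^bsub>tensor_free M C\<^esub> w"
    by (rule T.tensor_carrierE[OF t(2)])
  define z where "z = v - w"
  have z: "Poly_Mapping.keys z \<subseteq> carrier M \<times> carrier C"
    using keys_diff[of v w] v(1) w(1) by (auto simp: z_def)
  have z0: "formal_sum M (\<lambda>m c. m \<triangleleft>\<^bsub>M\<^esub> \<kappa> a c) z = \<zero>\<^bsub>M\<^esub>" if a: "a \<in> carrier A" for a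
  proof -
    let ?f = "formal_sum M (\<lambda>m c. m \<triangleleft>\<^bsub>M\<^esub> \<kappa> a c)"
    have "?f v = ?f w"
      using eq alpha_map_coset(2)[OF M v(1) a] alpha_map_coset(2)[OF M w(1) a] v(2) w(2) by simp
    moreover have "?f w \<in> carrier M"
      by (rule formal_sum_closed[where S = "carrier M \<times> carrier C"])
         (use w(1) M.M.abelian_group_axioms in \<open>auto simp: M.rsmult_closed kappa_closed a\<close>)
    moreover have "?f z = ?f v \<ominus>\<^bsub>M\<^esub> ?f w"
      unfolding z_def by (rule formal_sum_diff[where S = "carrier M \<times> carrier C"])
         (use v(1) w(1) M.M.abelian_group_axioms in \<open>auto simp: M.rsmult_closed kappa_closed a\<close>)
    ultimately show ?thesis by (simp add: a_minus_def M.M.r_neg)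
  qed
  have "finite (fst ` Poly_Mapping.keys z)" "fst ` Poly_Mapping.keys z \<subseteq> carrier M"
    using z by auto
  then obtain N and j :: "'m \<Rightarrow> (nat \<Rightarrow> 'r) set"
    where N: "right_submodule R M N" "fst ` Poly_Mapping.keys z \<subseteq> N" and j: "inj_on j N"
    by (rule fg_submodule_into_type[OF M])
  obtain M0 :: "('r, (nat \<Rightarrow> 'r) set) rmodule"
    where M0: "right_module R M0" "carrier M0 = j ` N" and d: "inv_into N j \<in> right_hom R M0 M"
      and zero: "\<zero>\<^bsub>M0\<^esub> = j \<zero>\<^bsub>M\<^esub>"
    by (rule transported_module[OF M N(1) j])
  interpret N: additive_subgroup N M using N by (simp add: right_submodule_def)
  interpret M0: right_module R M0 by fact
  interpret T0: tensor_factors R M0 C using M0(1) bC by (intro tensor_factors.intro)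
  have i: "j x \<in> carrier M0 \<and> inv_into N j (j x) = x" if "x \<in> N" for x
    using that j M0(2) by simp
  have zN: "Poly_Mapping.keys z \<subseteq> N \<times> carrier C" using z N(2) by force
  define z' where "z' = frag_extend (\<lambda>p. frag_of (j (fst p), snd p)) z"
  note tr = formal_sum_transport[OF M M0(1) d i N.a_subset _ zN, folded z'_def]
  have zk: "Poly_Mapping.keys z' \<subseteq> carrier M0 \<times> carrier C"
    by (rule tr(3)[of "\<lambda>_. \<zero>\<^bsub>R\<^esub>"]) simp_all
  have f0: "formal_sum M0 (\<lambda>m c. m \<triangleleft>\<^bsub>M0\<^esub> \<kappa> a c) z' = \<zero>\<^bsub>M0\<^esub>" if a: "a \<in> carrier A" for a
  proof -
    let ?s = "formal_sum M0 (\<lambda>m c. m \<triangleleft>\<^bsub>M0\<^esub> \<kappa> a c) z'"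
    have "?s \<in> carrier M0"
      by (rule formal_sum_closed[where S = "carrier M0 \<times> carrier C"])
         (use zk M0.M.abelian_group_axioms in \<open>auto simp: M0.rsmult_closed kappa_closed a\<close>)
    then obtain x where x: "x \<in> N" "?s = j x" using M0(2) by auto
    moreover have "inv_into N j ?s = \<zero>\<^bsub>M\<^esub>"
      using tr(1)[of "\<kappa> a"] z0[OF a] kappa_closed[OF a] by simp
    ultimately show ?thesis using zero i by simp
  qed
  have "ring A" using R_ring_axioms by (simp add: R_ring_def)
  then have zero_A: "\<zero>\<^bsub>A\<^esub> \<in> carrier A" by (rule ring.ring_simprules(2))
  let ?t = "tensor_kernel R M0 C #>\<^bsub>tensor_free M0 C\<^esub> z'"
  let ?u = "tensor_kernel R M0 C #>\<^bsub>tensor_free M0 C\<^esub> 0"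
  have k0: "Poly_Mapping.keys (0 :: (nat \<Rightarrow> 'r) set \<times> 'c \<Rightarrow>\<^sub>0 int) \<subseteq> carrier M0 \<times> carrier C" by simp
  have "alpha_map A \<kappa> M0 ?t a = alpha_map A \<kappa> M0 ?u a" for a
  proof (cases "a \<in> carrier A")
    case True
    then show ?thesis
      using alpha_map_coset(2)[OF M0(1) zk True] alpha_map_coset(2)[OF M0(1) k0 True] f0
      by (simp add: formal_sum_def)
  qed (simp add: alpha_map_def)
  then have "alpha_map A \<kappa> M0 ?t = alpha_map A \<kappa> M0 ?u" by blast
  moreover have "?t \<in> carrier (tensor R M0 C)" "?u \<in> carrier (tensor R M0 C)"
    using alpha_map_coset(1)[OF M0(1) zk zero_A] alpha_map_coset(1)[OF M0(1) k0 zero_A] .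
  ultimately have "?t = ?u"
    using inj_onD[OF alpha_condition[OF M0(1)]] by blast
  moreover have "z' \<in> ?t"
    by (rule group.rcos_self[OF group_free_Abelian_group _ T0.tensor_kernel_subgroup]) (simp add: zk)
  ultimately have "z' \<in> tensor_kernel R M0 C"
    by (auto simp: r_coset_def)
  then have "frag_extend (\<lambda>p. frag_of (inv_into N j (fst p), snd p)) z' \<in> tensor_kernel R M C"
    by (rule tensor_kernel_map[OF M0(1) M bC d])
  moreover have "frag_extend (\<lambda>p. frag_of (inv_into N j (fst p), snd p)) z' = z"
    by (rule tr(2)[of "\<lambda>_. \<zero>\<^bsub>R\<^esub>"]) simp_all
  ultimately have "z \<in> tensor_kernel R M C" by simp
  then have "v \<in> tensor_kernel R M C #>\<^bsub>tensor_free M C\<^esub> w"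
    by (auto simp: r_coset_def z_def intro!: bexI[of _ z])
  then show "t = t'"
    unfolding v(2) w(2)
    using group.repr_independence[OF group_free_Abelian_group _ _ T.tensor_kernel_subgroup] w(1) by auto
qed

end

end

(*
  Everything is compared with the condition that (0_M : m) contains the orthogonal of a finite set F.
  Since <ab, c> = <b, c.a> for the right action c.a of A on C, and since the alpha-condition for
  M = R makes A separate the points of C, the action and the pairing define the same neighbourhoods.
  The rational and the cofinite conditions rest on a local dual basis: there are finitely many b_j in
  A and x_j in C such that a - sum_j b_j <a, x_j> lies in the orthogonal of F for every a in A.  It is
  obtained from the alpha-condition for quotients of R and right exactness of the tensor product.
  Conversely, when R is artinian, A/X is artinian for cofinite X, and closedness of X forces X to
  contain the orthogonal of some F, as otherwise A/X would have a strictly descending chain.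
*)
theory Submission
  imports Defs
begin

section \<open>Modules\<close>

text \<open>Why the dual basis decides these conditions: if the orthogonal of F kills m, then m a =
  sum_j (m b_j) <a, x_j>, so the m b_j and x_j witness rationality; if it lies in a submodule X, the
  classes of the b_j generate A/X. Over a field the b_j could be taken dual to a basis of the span
  of F. Here that span need not be free, so F is exhausted one element at a time: once F is handled,
  the error a - sum_j b_j <a, x_j> lies in the orthogonal of F, and its pairing with the next c
  takes values in a right ideal of R. The repair must use coefficients orthogonal to F, or the
  earlier elements are spoilt. That the error can be written with such coefficients is what
  injectivity of \<alpha> modulo this ideal gives. Tensors are handled through formal sums
  representing them, because lifting along a quotient map needs a section, and such a section acts
  on formal sums but not on tensor products.\<close>

lemma (in right_module) rsmult_group_hom:
  "r \<in> carrier R \<Longrightarrow> group_hom (add_monoid M) (add_monoid M) (\<lambda>x. x \<triangleleft>\<^bsub>M\<^esub> r)"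
  by unfold_locales (auto simp: hom_def rsmult_closed rsmult_add_left)

lemma (in right_module) zero_rsmult: "r \<in> carrier R \<Longrightarrow> \<zero>\<^bsub>M\<^esub> \<triangleleft>\<^bsub>M\<^esub> r = \<zero>\<^bsub>M\<^esub>"
  using group_hom.hom_one[OF rsmult_group_hom] by simp

lemma (in right_module) minus_rsmult:
  "\<lbrakk>x \<in> carrier M; r \<in> carrier R\<rbrakk> \<Longrightarrow> (\<ominus>\<^bsub>M\<^esub> x) \<triangleleft>\<^bsub>M\<^esub> r = \<ominus>\<^bsub>M\<^esub> (x \<triangleleft>\<^bsub>M\<^esub> r)"
  using group_hom.hom_inv[OF rsmult_group_hom] by (simp add: a_inv_def)

lemma (in right_module) diff_rsmult:
  "\<lbrakk>x \<in> carrier M; y \<in> carrier M; r \<in> carrier R\<rbrakk> \<Longrightarrow>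
    (x \<ominus>\<^bsub>M\<^esub> y) \<triangleleft>\<^bsub>M\<^esub> r = x \<triangleleft>\<^bsub>M\<^esub> r \<ominus>\<^bsub>M\<^esub> y \<triangleleft>\<^bsub>M\<^esub> r"
  by (simp add: M.minus_eq rsmult_add_left minus_rsmult rsmult_closed)

lemma (in right_module) left_scalar_group_hom:
  "x \<in> carrier M \<Longrightarrow> group_hom (add_monoid R) (add_monoid M) (\<lambda>r. x \<triangleleft>\<^bsub>M\<^esub> r)"
  by unfold_locales (auto simp: hom_def rsmult_closed rsmult_add_right)

lemma (in right_module) rsmult_zero: "x \<in> carrier M \<Longrightarrow> x \<triangleleft>\<^bsub>M\<^esub> \<zero>\<^bsub>R\<^esub> = \<zero>\<^bsub>M\<^esub>"
  using group_hom.hom_one[OF left_scalar_group_hom] by simp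

lemma (in right_module) rsmult_minus:
  "\<lbrakk>x \<in> carrier M; r \<in> carrier R\<rbrakk> \<Longrightarrow> x \<triangleleft>\<^bsub>M\<^esub> (\<ominus>\<^bsub>R\<^esub> r) = \<ominus>\<^bsub>M\<^esub> (x \<triangleleft>\<^bsub>M\<^esub> r)"
  using group_hom.hom_inv[OF left_scalar_group_hom] by (simp add: a_inv_def)

lemma (in right_module) rsmult_diff:
  "\<lbrakk>x \<in> carrier M; r \<in> carrier R; s \<in> carrier R\<rbrakk> \<Longrightarrow>
    x \<triangleleft>\<^bsub>M\<^esub> (r \<ominus>\<^bsub>R\<^esub> s) = x \<triangleleft>\<^bsub>M\<^esub> r \<ominus>\<^bsub>M\<^esub> x \<triangleleft>\<^bsub>M\<^esub> s"
  by (simp add: R.minus_eq M.minus_eq rsmult_add_right rsmult_minus rsmult_closed)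

text \<open>Closure under negation comes from multiplication by the scalar -1.\<close>

lemma (in right_module) right_submoduleI:
  assumes "N \<subseteq> carrier M" "\<zero>\<^bsub>M\<^esub> \<in> N" "\<And>x y. \<lbrakk>x \<in> N; y \<in> N\<rbrakk> \<Longrightarrow> x \<oplus>\<^bsub>M\<^esub> y \<in> N"
    and rs: "\<And>x r. \<lbrakk>x \<in> N; r \<in> carrier R\<rbrakk> \<Longrightarrow> x \<triangleleft>\<^bsub>M\<^esub> r \<in> N"
  shows "right_submodule R M N"
proof -
  have "inv\<^bsub>add_monoid M\<^esub> x \<in> N" if "x \<in> N" for x
  proof -
    have "x \<in> carrier M" using that assms(1) by auto
    then have "x \<triangleleft>\<^bsub>M\<^esub> (\<ominus>\<^bsub>R\<^esub> \<one>\<^bsub>R\<^esub>) = \<ominus>\<^bsub>M\<^esub> x"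
      by (simp add: rsmult_minus rsmult_one)
    then show ?thesis using rs[OF that, of "\<ominus>\<^bsub>R\<^esub> \<one>\<^bsub>R\<^esub>"] by (simp add: a_inv_def)
  qed
  with assms show ?thesis
    unfolding right_submodule_def by (auto intro!: additive_subgroup.intro subgroup.intro)
qed

lemma right_submodule_image:
  assumes M: "right_module R M" and M': "right_module R M'" and f: "f \<in> right_hom R M M'"
    and N: "right_submodule R M N"
  shows "right_submodule R M' (f ` N)"
proof -
  interpret M: right_module R M by fact
  interpret M': right_module R M' by fact
  interpret N: additive_subgroup N M using N by (simp add: right_submodule_def)
  interpret f: group_hom "add_monoid M" "add_monoid M'" f
    using f by unfold_locales (auto simp: hom_def right_hom_def)
  show ?thesis
  proof (rule M'.right_submoduleI)
    show "f ` N \<subseteq> carrier M'" using f N.a_Hcarr by (auto simp: right_hom_def)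
    show "\<zero>\<^bsub>M'\<^esub> \<in> f ` N" using f.hom_one N.zero_closed by (intro image_eqI[of _ _ "\<zero>\<^bsub>M\<^esub>"]) simp_all
    fix x assume "x \<in> f ` N"
    then obtain u where u: "u \<in> N" "x = f u" by blast
    show "x \<triangleleft>\<^bsub>M'\<^esub> r \<in> f ` N" if "r \<in> carrier R" for r
      using that u f N N.a_Hcarr by (intro image_eqI[of _ _ "u \<triangleleft>\<^bsub>M\<^esub> r"]) (auto simp: right_hom_def right_submodule_def)
    fix y assume "y \<in> f ` N"
    then obtain v where v: "v \<in> N" "y = f v" by blast
    show "x \<oplus>\<^bsub>M'\<^esub> y \<in> f ` N"
      using u v f N.a_Hcarr by (intro image_eqI[of _ _ "u \<oplus>\<^bsub>M\<^esub> v"]) (auto simp: right_hom_def)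
  qed
qed

lemma right_submodule_vimage:
  assumes M: "right_module R M" and M': "right_module R M'" and f: "f \<in> right_hom R M M'"
    and N: "right_submodule R M' N"
  shows "right_submodule R M {x \<in> carrier M. f x \<in> N}"
proof -
  interpret M: right_module R M by fact
  interpret M': right_module R M' by fact
  interpret N: additive_subgroup N M' using N by (simp add: right_submodule_def)
  interpret f: group_hom "add_monoid M" "add_monoid M'" f
    using f by unfold_locales (auto simp: hom_def right_hom_def)
  show ?thesis
    using f N f.hom_one
    by (intro M.right_submoduleI) (auto simp: right_hom_def right_submodule_def M.rsmult_closed)
qed

lemma right_module_regular:
  assumes "ring R"
  shows "right_module R (regular_bimodule R)"
proof -
  interpret ring R by fact
  have "abelian_group (regular_bimodule R)"
    by (rule abelian_groupI) (auto simp: regular_bimodule_def a_ac l_neg intro: bexI[of _ "\<ominus>\<^bsub>R\<^esub> _"])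
  then show ?thesis
    by (intro right_module.intro right_module_axioms.intro)
       (auto simp: regular_bimodule_def l_distr r_distr m_assoc assms)
qed

section \<open>Quotient modules\<close>

locale right_quotient = right_module R M
  for R :: "('r, 'x) ring_scheme" (structure) and M :: "('r, 'm, 'y) rmodule_scheme" (structure) +
  fixes N :: "'m set"
  assumes submodule: "right_submodule R M N"
begin

sublocale N: abelian_subgroup N M
  using submodule M.abelian_group_axioms
  by (intro abelian_subgroupI3) (simp_all add: right_submodule_def)

lemma N_rsmult: "\<lbrakk>x \<in> N; r \<in> carrier R\<rbrakk> \<Longrightarrow> x \<triangleleft>\<^bsub>M\<^esub> r \<in> N"
  using submodule by (simp add: right_submodule_def)

lemma N_closed: "x \<in> N \<Longrightarrow> x \<in> carrier M"
  using N.a_Hcarr .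

lemma coset_eq_iff:
  assumes "x \<in> carrier M" "y \<in> carrier M"
  shows "N +>\<^bsub>M\<^esub> x = N +>\<^bsub>M\<^esub> y \<longleftrightarrow> x \<ominus>\<^bsub>M\<^esub> y \<in> N"
proof -
  have "N +>\<^bsub>M\<^esub> x = N +>\<^bsub>M\<^esub> y \<longleftrightarrow> x \<in> N +>\<^bsub>M\<^esub> y"
    using N.a_repr_independence' N.a_rcos_self assms by metis
  also have "\<dots> \<longleftrightarrow> x \<ominus>\<^bsub>M\<^esub> y \<in> N"
    using N.a_rcos_module[OF assms(2,1)] by (simp only: M.minus_eq)
  finally show ?thesis .
qed

lemma quotient_carrier: "carrier (quotient_module M N) = (\<lambda>x. N +>\<^bsub>M\<^esub> x) ` carrier M"
  by (auto simp: quotient_module_def A_RCOSETS_def RCOSETS_def a_r_coset_def)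

lemma quotient_add:
  "\<lbrakk>x \<in> carrier M; y \<in> carrier M\<rbrakk> \<Longrightarrow>
    (N +>\<^bsub>M\<^esub> x) \<oplus>\<^bsub>quotient_module M N\<^esub> (N +>\<^bsub>M\<^esub> y) = N +>\<^bsub>M\<^esub> (x \<oplus>\<^bsub>M\<^esub> y)"
  by (simp add: quotient_module_def N.a_rcos_sum)

lemma quotient_zero: "\<zero>\<^bsub>quotient_module M N\<^esub> = N +>\<^bsub>M\<^esub> \<zero>\<^bsub>M\<^esub>"
  using N.a_subset by (simp add: quotient_module_def M.a_coset_add_zero)

text \<open>The action on a coset is defined as a union over all its representatives. All members of
  this union coincide because \<open>N\<close> is stable under scalars, so the union collapses to a
  single coset.\<close>

lemma quotient_rsmult:
  assumes x: "x \<in> carrier M" and r: "r \<in> carrier R"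
  shows "(N +>\<^bsub>M\<^esub> x) \<triangleleft>\<^bsub>quotient_module M N\<^esub> r = N +>\<^bsub>M\<^esub> (x \<triangleleft>\<^bsub>M\<^esub> r)"
proof -
  have c: "N +>\<^bsub>M\<^esub> (y \<triangleleft>\<^bsub>M\<^esub> r) = N +>\<^bsub>M\<^esub> (x \<triangleleft>\<^bsub>M\<^esub> r)" if y: "y \<in> N +>\<^bsub>M\<^esub> x" for y
  proof -
    have yc: "y \<in> carrier M" using N.a_elemrcos_carrier[OF x y] .
    then have "y \<ominus>\<^bsub>M\<^esub> x \<in> N"
      using N.a_rcos_module[OF x yc] y by (simp only: M.minus_eq)
    then have "(y \<ominus>\<^bsub>M\<^esub> x) \<triangleleft>\<^bsub>M\<^esub> r \<in> N" using r by (rule N_rsmult)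
    then show ?thesis
      using x yc r by (simp add: coset_eq_iff rsmult_closed diff_rsmult)
  qed
  have "(\<Union>y\<in>N +>\<^bsub>M\<^esub> x. N +>\<^bsub>M\<^esub> (y \<triangleleft>\<^bsub>M\<^esub> r)) = N +>\<^bsub>M\<^esub> (x \<triangleleft>\<^bsub>M\<^esub> r)"
    by (rule UN_constant_eq[OF N.a_rcos_self[OF x] ballI[OF c]])
  then show ?thesis unfolding quotient_module_def by (simp only: rmodule.simps)
qed

lemma quotient_right_module: "right_module R (quotient_module M N)"
proof -
  have "abelian_group (quotient_module M N)"
  proof (rule abelian_groupI)
    fix X assume "X \<in> carrier (quotient_module M N)"
    then obtain x where "x \<in> carrier M" "X = N +>\<^bsub>M\<^esub> x" by (auto simp: quotient_carrier)
    then show "\<exists>Y\<in>carrier (quotient_module M N). Y \<oplus>\<^bsub>quotient_module M N\<^esub> X = \<zero>\<^bsub>quotient_module M N\<^esub>"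
      by (intro bexI[of _ "N +>\<^bsub>M\<^esub> (\<ominus>\<^bsub>M\<^esub> x)"])
         (auto simp: quotient_carrier quotient_zero quotient_add M.l_neg)
  qed (auto simp: quotient_carrier quotient_zero quotient_add M.a_ac)
  then show ?thesis
    using R.ring_axioms
    by (intro right_module.intro right_module_axioms.intro)
       (auto simp: quotient_carrier quotient_add quotient_rsmult rsmult_closed rsmult_add_left
          rsmult_add_right rsmult_assoc rsmult_one)
qed

lemma quotient_map_hom: "(\<lambda>x. N +>\<^bsub>M\<^esub> x) \<in> right_hom R M (quotient_module M N)"
  by (auto simp: right_hom_def quotient_carrier quotient_add quotient_rsmult)

end

section \<open>Direct sums of copies and restriction of scalars\<close>

lemma direct_sum_copies_right_module:
  assumes "right_module R M"
  shows "right_module R (direct_sum_copies I M)"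
proof -
  interpret right_module R M by fact
  have fin: "finite {i \<in> I. f i \<oplus>\<^bsub>M\<^esub> g i \<noteq> \<zero>\<^bsub>M\<^esub>}"
    if "finite {i \<in> I. f i \<noteq> \<zero>\<^bsub>M\<^esub>}" "finite {i \<in> I. g i \<noteq> \<zero>\<^bsub>M\<^esub>}" for f g
    by (rule finite_subset[OF _ finite_UnI[OF that]]) auto
  have finr: "finite {i \<in> I. f i \<triangleleft>\<^bsub>M\<^esub> r \<noteq> \<zero>\<^bsub>M\<^esub>}"
    if "finite {i \<in> I. f i \<noteq> \<zero>\<^bsub>M\<^esub>}" "r \<in> carrier R" for f r
    by (rule finite_subset[OF _ that(1)]) (auto simp: zero_rsmult that(2))
  have finm: "finite {i \<in> I. \<ominus>\<^bsub>M\<^esub> (f i) \<noteq> \<zero>\<^bsub>M\<^esub>}"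
    if "finite {i \<in> I. f i \<noteq> \<zero>\<^bsub>M\<^esub>}" for f
    by (rule finite_subset[OF _ that(1)]) auto
  have cl: "f \<oplus>\<^bsub>direct_sum_copies I M\<^esub> g \<in> carrier (direct_sum_copies I M)"
    if "f \<in> carrier (direct_sum_copies I M)" "g \<in> carrier (direct_sum_copies I M)" for f g
    using that fin[of f g] by (auto simp: direct_sum_copies_def PiE_iff cong: conj_cong)
  have clr: "f \<triangleleft>\<^bsub>direct_sum_copies I M\<^esub> r \<in> carrier (direct_sum_copies I M)"
    if "f \<in> carrier (direct_sum_copies I M)" "r \<in> carrier R" for f r
    using that finr[of f r] by (auto simp: direct_sum_copies_def PiE_iff rsmult_closed cong: conj_cong)
  \<comment> \<open>Elements of the direct sum are extensional functions on \<open>I\<close>, so an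
    axiom may be checked pointwise on \<open>I\<close> once both sides are known to lie in the
    carrier; \<open>cl\<close> and \<open>clr\<close> supply this, finite supports included.\<close>
  have ext: "f = g" if "f \<in> carrier (direct_sum_copies I M)" "g \<in> carrier (direct_sum_copies I M)"
    "\<And>i. i \<in> I \<Longrightarrow> f i = g i" for f g
    using that by (intro extensionalityI[of f I g]) (auto simp: direct_sum_copies_def PiE_iff)
  have "abelian_group (direct_sum_copies I M)"
  proof (rule abelian_groupI)
    show z: "\<zero>\<^bsub>direct_sum_copies I M\<^esub> \<in> carrier (direct_sum_copies I M)"
      by (auto simp: direct_sum_copies_def)
    fix f assume f: "f \<in> carrier (direct_sum_copies I M)"
    show "\<zero>\<^bsub>direct_sum_copies I M\<^esub> \<oplus>\<^bsub>direct_sum_copies I M\<^esub> f = f"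
      by (rule ext[OF cl[OF z f] f]) (use f in \<open>auto simp: direct_sum_copies_def PiE_iff\<close>)
    have n: "(\<lambda>i\<in>I. \<ominus>\<^bsub>M\<^esub> (f i)) \<in> carrier (direct_sum_copies I M)"
      using f finm[of f] by (auto simp: direct_sum_copies_def PiE_iff cong: conj_cong)
    show "\<exists>g\<in>carrier (direct_sum_copies I M). g \<oplus>\<^bsub>direct_sum_copies I M\<^esub> f = \<zero>\<^bsub>direct_sum_copies I M\<^esub>"
      by (rule bexI[OF _ n], rule ext[OF cl[OF n f] z])
         (use f in \<open>auto simp: direct_sum_copies_def PiE_iff M.l_neg\<close>)
    fix g assume g: "g \<in> carrier (direct_sum_copies I M)"
    show "f \<oplus>\<^bsub>direct_sum_copies I M\<^esub> g \<in> carrier (direct_sum_copies I M)" using f g by (rule cl)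
    show "f \<oplus>\<^bsub>direct_sum_copies I M\<^esub> g = g \<oplus>\<^bsub>direct_sum_copies I M\<^esub> f"
      by (rule ext[OF cl[OF f g] cl[OF g f]])
         (use f g in \<open>auto simp: direct_sum_copies_def PiE_iff M.a_comm\<close>)
    fix h assume h: "h \<in> carrier (direct_sum_copies I M)"
    show "f \<oplus>\<^bsub>direct_sum_copies I M\<^esub> g \<oplus>\<^bsub>direct_sum_copies I M\<^esub> h
        = f \<oplus>\<^bsub>direct_sum_copies I M\<^esub> (g \<oplus>\<^bsub>direct_sum_copies I M\<^esub> h)"
      by (rule ext[OF cl[OF cl[OF f g] h] cl[OF f cl[OF g h]]])
         (use f g h in \<open>auto simp: direct_sum_copies_def PiE_iff M.a_assoc\<close>)
  qed
  then show ?thesis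
  proof (intro right_module.intro right_module_axioms.intro)
    show "ring R" by (rule R.ring_axioms)
    fix f r assume f: "f \<in> carrier (direct_sum_copies I M)"
    show "f \<triangleleft>\<^bsub>direct_sum_copies I M\<^esub> \<one>\<^bsub>R\<^esub> = f"
      by (rule ext[OF clr[OF f] f]) (use f in \<open>auto simp: direct_sum_copies_def PiE_iff rsmult_one\<close>)
    assume r: "r \<in> carrier R"
    show "f \<triangleleft>\<^bsub>direct_sum_copies I M\<^esub> r \<in> carrier (direct_sum_copies I M)" using f r by (rule clr)
  qed (auto simp: direct_sum_copies_def PiE_iff rsmult_add_left rsmult_add_right rsmult_assoc intro!: restrict_ext)
qed

text \<open>The unit map from R to A, sending r to \<open>\<one> \<triangleleft> r\<close>, is
  additive, unital and, by \<open>mult\<close>, multiplicative, so the action of A pulls back along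
  it.\<close>

lemma right_module_restrict_scalars:
  assumes A: "R_ring R A" and M: "right_module A M"
  shows "right_module R (restrict_scalars A M)"
proof -
  interpret A: R_ring R A by fact
  interpret M: right_module A M by fact
  have one: "\<one>\<^bsub>A\<^esub> \<triangleleft>\<^bsub>A\<^esub> r \<in> carrier A" if "r \<in> carrier R" for r
    using that by (simp add: A.rsmult_closed)
  have mult: "(\<one>\<^bsub>A\<^esub> \<triangleleft>\<^bsub>A\<^esub> r) \<otimes>\<^bsub>A\<^esub> (\<one>\<^bsub>A\<^esub> \<triangleleft>\<^bsub>A\<^esub> s) = \<one>\<^bsub>A\<^esub> \<triangleleft>\<^bsub>A\<^esub> (r \<otimes>\<^bsub>R\<^esub> s)"
    if "r \<in> carrier R" "s \<in> carrier R" for r s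
    using that by (simp add: A.mult_rsmult A.rsmult_assoc one)
  have "abelian_group (restrict_scalars A M)"
    by (rule abelian_groupI)
       (auto simp: restrict_scalars_def M.M.a_ac M.M.l_neg intro: bexI[of _ "\<ominus>\<^bsub>M\<^esub> _"])
  then show ?thesis
    using A.R.ring_axioms
    by (intro right_module.intro right_module_axioms.intro)
       (auto simp: restrict_scalars_def M.rsmult_closed one M.rsmult_add_left A.rsmult_add_right
         M.rsmult_add_right mult[symmetric] M.rsmult_assoc A.rsmult_one M.rsmult_one)
qed

section \<open>Formal sums\<close>

text \<open>This is \<open>f \<otimes> id\<close> on the level of formal sums. Here \<open>f\<close>
  may be an arbitrary function, for instance a section of a quotient map, which would not act on the
  tensor product itself.\<close>

abbreviation frag_map_fst :: "('m \<Rightarrow> 'n) \<Rightarrow> ('m \<times> 'c \<Rightarrow>\<^sub>0 int) \<Rightarrow> 'n \<times> 'c \<Rightarrow>\<^sub>0 int" where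
  "frag_map_fst f z \<equiv> frag_extend (\<lambda>p. frag_of (f (fst p), snd p)) z"

lemma keys_frag_map_fst:
  assumes "Poly_Mapping.keys z \<subseteq> S \<times> T" "\<And>x. x \<in> S \<Longrightarrow> f x \<in> S'"
  shows "Poly_Mapping.keys (frag_map_fst f z) \<subseteq> S' \<times> T"
  using keys_frag_extend[of "\<lambda>p. frag_of (f (fst p), snd p)" z] assms by (fastforce simp: keys_frag_of)

lemma formal_sum_zero: "abelian_group G \<Longrightarrow> formal_sum G h 0 = \<zero>\<^bsub>G\<^esub>"
  by (simp add: formal_sum_def abelian_monoid.finsum_empty abelian_group.axioms)

text \<open>Induction over the free abelian group: the property is checked at 0, at differences and
  at single generators. The same scheme proves \<open>group_hom_formal_sum\<close> and
  \<open>formal_sum_frag_map_fst\<close>.\<close>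

lemma formal_sum_in_subgroup:
  assumes G: "abelian_group G" and H: "additive_subgroup H G"
    and h: "\<And>x y. (x, y) \<in> S \<Longrightarrow> h x y \<in> H" and z: "Poly_Mapping.keys z \<subseteq> S"
  shows "formal_sum G h z \<in> H"
proof -
  interpret abelian_group G by fact
  interpret H: additive_subgroup H G by fact
  have hc: "h x y \<in> carrier G" if "(x, y) \<in> S" for x y
    using h[OF that] H.a_Hcarr by blast
  show ?thesis
  proof (rule free_Abelian_group_induct[OF z])
    show "formal_sum G h 0 \<in> H" by (simp add: formal_sum_zero G)
  next
    fix v w assume vw: "Poly_Mapping.keys v \<subseteq> S" "Poly_Mapping.keys w \<subseteq> S"
      "formal_sum G h v \<in> H" "formal_sum G h w \<in> H"
    then show "formal_sum G h (v - w) \<in> H"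
      using formal_sum_diff[where h = h, OF G hc vw(1,2)] by (simp add: minus_eq)
  next
    fix p assume "p \<in> S"
    then show "formal_sum G h (frag_of p) \<in> H"
      using formal_sum_frag_of[where h = h and x = "fst p" and y = "snd p", OF G] hc[of "fst p" "snd p"] h[of "fst p" "snd p"] by simp
  qed
qed

lemma formal_sum_eq_zero:
  assumes "abelian_group G" "\<And>x y. (x, y) \<in> S \<Longrightarrow> h x y = \<zero>\<^bsub>G\<^esub>" "Poly_Mapping.keys z \<subseteq> S"
  shows "formal_sum G h z = \<zero>\<^bsub>G\<^esub>"
proof -
  interpret abelian_group G by fact
  have "additive_subgroup {\<zero>\<^bsub>G\<^esub>} G"
    by (intro additive_subgroup.intro) (auto intro!: subgroup.intro simp: a_inv_def[symmetric])
  from formal_sum_in_subgroup[where h = h, OF assms(1) this _ assms(3)] assms(2) show ?thesis by simp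
qed

lemma group_hom_formal_sum:
  assumes G: "abelian_group G" and G': "abelian_group G'"
    and f: "group_hom (add_monoid G) (add_monoid G') f"
    and h: "\<And>x y. (x, y) \<in> S \<Longrightarrow> h x y \<in> carrier G \<and> f (h x y) = h' x y"
    and z: "Poly_Mapping.keys z \<subseteq> S"
  shows "f (formal_sum G h z) = formal_sum G' h' z"
proof -
  interpret G: abelian_group G by fact
  interpret G': abelian_group G' by fact
  interpret f: group_hom "add_monoid G" "add_monoid G'" f by fact
  have hc: "h x y \<in> carrier G" if "(x, y) \<in> S" for x y
    using h[OF that] by blast
  have hc': "h' x y \<in> carrier G'" if "(x, y) \<in> S" for x y
    using h[OF that] f.hom_closed[of "h x y"] by simp
  have fdiff: "f (x \<ominus>\<^bsub>G\<^esub> y) = f x \<ominus>\<^bsub>G'\<^esub> f y" if "x \<in> carrier G" "y \<in> carrier G" for x y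
    using f.hom_mult[of x "\<ominus>\<^bsub>G\<^esub> y"] f.hom_inv[of y] that by (simp add: a_minus_def a_inv_def)
  show ?thesis
  proof (rule free_Abelian_group_induct[OF z])
    show "f (formal_sum G h 0) = formal_sum G' h' 0"
      using f.hom_one by (simp add: formal_sum_zero G G')
  next
    fix v w assume vw: "Poly_Mapping.keys v \<subseteq> S" "Poly_Mapping.keys w \<subseteq> S"
      "f (formal_sum G h v) = formal_sum G' h' v" "f (formal_sum G h w) = formal_sum G' h' w"
    then show "f (formal_sum G h (v - w)) = formal_sum G' h' (v - w)"
      using formal_sum_diff[where h = h, OF G hc vw(1,2)] formal_sum_diff[where h = h', OF G' hc' vw(1,2)]
        formal_sum_closed[where h = h, OF G hc vw(1)] formal_sum_closed[where h = h, OF G hc vw(2)] fdiff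
      by simp
  next
    fix p assume "p \<in> S"
    then show "f (formal_sum G h (frag_of p)) = formal_sum G' h' (frag_of p)"
      using formal_sum_frag_of[where h = h and x = "fst p" and y = "snd p", OF G]
        formal_sum_frag_of[where h = h' and x = "fst p" and y = "snd p", OF G']
        h[of "fst p" "snd p"] hc'[of "fst p" "snd p"] by simp
  qed
qed

lemma formal_sum_frag_map_fst:
  assumes G: "abelian_group G" and z: "Poly_Mapping.keys z \<subseteq> S \<times> T"
    and h: "\<And>x y. \<lbrakk>x \<in> S; y \<in> T\<rbrakk> \<Longrightarrow> h (f x) y = h' x y \<and> h' x y \<in> carrier G"
  shows "formal_sum G h (frag_map_fst f z) = formal_sum G h' z"
proof -
  interpret G: abelian_group G by fact
  have hc: "h x y \<in> carrier G" if "(x, y) \<in> f ` S \<times> T" for x y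
    using h that by force
  have hc': "h' x y \<in> carrier G" if "(x, y) \<in> S \<times> T" for x y
    using h that by force
  have keys: "Poly_Mapping.keys (frag_map_fst f w) \<subseteq> f ` S \<times> T" if "Poly_Mapping.keys w \<subseteq> S \<times> T" for w
    using that by (rule keys_frag_map_fst) blast
  show ?thesis
  proof (rule free_Abelian_group_induct[OF z])
    show "formal_sum G h (frag_map_fst f 0) = formal_sum G h' 0" by (simp add: formal_sum_zero G)
  next
    fix v w assume vw: "Poly_Mapping.keys v \<subseteq> S \<times> T" "Poly_Mapping.keys w \<subseteq> S \<times> T"
      "formal_sum G h (frag_map_fst f v) = formal_sum G h' v"
      "formal_sum G h (frag_map_fst f w) = formal_sum G h' w"
    then show "formal_sum G h (frag_map_fst f (v - w)) = formal_sum G h' (v - w)"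
      using formal_sum_diff[where h = h, OF G hc keys[OF vw(1)] keys[OF vw(2)]]
        formal_sum_diff[where h = h', OF G hc' vw(1,2)]
      by (simp add: frag_extend_diff)
  next
    fix p assume p: "p \<in> S \<times> T"
    then show "formal_sum G h (frag_map_fst f (frag_of p)) = formal_sum G h' (frag_of p)"
      using formal_sum_frag_of[where h = h and x = "f (fst p)" and y = "snd p", OF G]
        formal_sum_frag_of[where h = h' and x = "fst p" and y = "snd p", OF G] h[of "fst p" "snd p"]
      by (auto simp: mem_Times_iff)
  qed
qed

section \<open>The pairing\<close>

text \<open>Adds no assumption to \<open>measuring_left_alpha_pairing\<close>. It supplies the
  qualifiers \<open>A\<close> and \<open>C\<close>, which separate the bimodule facts of the two
  factors; without them the names of these facts coincide.\<close>

locale alpha_pairing = A: R_ring R A + C: coring R C + measuring_left_alpha_pairing R A C \<kappa>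
  for R :: "('r, 'x) ring_scheme" (structure) and A :: "('r, 'a, 'y) bimodule_scheme" (structure)
    and C :: "('r, 'c, 'z) coring_scheme" (structure) and \<kappa> :: "'a \<Rightarrow> 'c \<Rightarrow> 'r"

lemma alpha_pairingI: "measuring_left_alpha_pairing R A C \<kappa> \<Longrightarrow> alpha_pairing R A C \<kappa>"
  by (simp add: alpha_pairing_def measuring_left_alpha_pairing_def)

context alpha_pairing
begin

lemma kappa_in_dual: "a \<in> carrier A \<Longrightarrow> \<kappa> a \<in> carrier (left_dual R C)"
  using ring_hom_closed[OF kappa_ring_hom] .

lemma kappa_add_right:
  "\<lbrakk>a \<in> carrier A; c \<in> carrier C; d \<in> carrier C\<rbrakk> \<Longrightarrow> \<kappa> a (c \<oplus>\<^bsub>C\<^esub> d) = \<kappa> a c \<oplus>\<^bsub>R\<^esub> \<kappa> a d"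
  using kappa_in_dual[of a] by (simp add: left_dual_def)

lemma kappa_lsmult:
  "\<lbrakk>a \<in> carrier A; r \<in> carrier R; c \<in> carrier C\<rbrakk> \<Longrightarrow> \<kappa> a (r \<triangleright>\<^bsub>C\<^esub> c) = r \<otimes>\<^bsub>R\<^esub> \<kappa> a c"
  using kappa_in_dual[of a] by (simp add: left_dual_def)

lemma kappa_add_left:
  "\<lbrakk>a \<in> carrier A; b \<in> carrier A; c \<in> carrier C\<rbrakk> \<Longrightarrow> \<kappa> (a \<oplus>\<^bsub>A\<^esub> b) c = \<kappa> a c \<oplus>\<^bsub>R\<^esub> \<kappa> b c"
  using kappa_bimodule_hom by (simp add: bimodule_hom_def right_hom_def left_dual_def)

lemma kappa_rsmult:
  "\<lbrakk>a \<in> carrier A; r \<in> carrier R; c \<in> carrier C\<rbrakk> \<Longrightarrow> \<kappa> (a \<triangleleft>\<^bsub>A\<^esub> r) c = \<kappa> a c \<otimes>\<^bsub>R\<^esub> r"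
  using kappa_bimodule_hom by (simp add: bimodule_hom_def right_hom_def left_dual_def)

lemma kappa_hom_left: "c \<in> carrier C \<Longrightarrow> group_hom (add_monoid A) (add_monoid R) (\<lambda>a. \<kappa> a c)"
  by (intro group_hom.intro group_hom_axioms.intro A.a_group A.R.a_group)
     (auto simp: hom_def kappa_closed kappa_add_left)

lemma kappa_hom_right: "a \<in> carrier A \<Longrightarrow> group_hom (add_monoid C) (add_monoid R) (\<kappa> a)"
  by (intro group_hom.intro group_hom_axioms.intro C.a_group A.R.a_group)
     (auto simp: hom_def kappa_closed kappa_add_right)

lemma kappa_diff_left:
  assumes "a \<in> carrier A" "b \<in> carrier A" "c \<in> carrier C"
  shows "\<kappa> (a \<ominus>\<^bsub>A\<^esub> b) c = \<kappa> a c \<ominus>\<^bsub>R\<^esub> \<kappa> b c"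
proof -
  interpret group_hom "add_monoid A" "add_monoid R" "\<lambda>a. \<kappa> a c" using assms(3) by (rule kappa_hom_left)
  have "\<kappa> (\<ominus>\<^bsub>A\<^esub> b) c = \<ominus>\<^bsub>R\<^esub> \<kappa> b c" using hom_inv[of b] assms by (simp add: a_inv_def)
  then show ?thesis using assms by (simp add: A.minus_eq A.R.minus_eq kappa_add_left)
qed

lemma kappa_diff_right:
  assumes "a \<in> carrier A" "c \<in> carrier C" "d \<in> carrier C"
  shows "\<kappa> a (c \<ominus>\<^bsub>C\<^esub> d) = \<kappa> a c \<ominus>\<^bsub>R\<^esub> \<kappa> a d"
proof -
  interpret group_hom "add_monoid C" "add_monoid R" "\<kappa> a" using assms(1) by (rule kappa_hom_right)
  have "\<kappa> a (\<ominus>\<^bsub>C\<^esub> d) = \<ominus>\<^bsub>R\<^esub> \<kappa> a d" using hom_inv[of d] assms by (simp add: a_inv_def)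
  then show ?thesis using assms by (simp add: C.minus_eq A.R.minus_eq kappa_add_right)
qed

text \<open>The value at \<open>a\<close> of the \<alpha>-map on the class of \<open>z\<close>,
  computed on the representative \<open>z\<close> itself; \<open>alpha_map_coset\<close> relates it
  to \<open>alpha_map\<close>.\<close>

definition alpha_sum :: "('r, 'm, 'w) rmodule_scheme \<Rightarrow> ('m \<times> 'c \<Rightarrow>\<^sub>0 int) \<Rightarrow> 'a \<Rightarrow> 'm" where
  "alpha_sum L z a = formal_sum L (\<lambda>l c. l \<triangleleft>\<^bsub>L\<^esub> \<kappa> a c) z"

lemma alpha_sum_closed:
  assumes L: "right_module R L" and "Poly_Mapping.keys z \<subseteq> carrier L \<times> carrier C" "a \<in> carrier A"
  shows "alpha_sum L z a \<in> carrier L"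
proof -
  interpret L: right_module R L by fact
  show ?thesis unfolding alpha_sum_def
    by (rule formal_sum_closed[OF L.M.abelian_group_axioms _ assms(2)])
       (use assms in \<open>auto simp: L.rsmult_closed kappa_closed\<close>)
qed

lemma alpha_sum_diff:
  assumes L: "right_module R L" and z: "Poly_Mapping.keys z \<subseteq> carrier L \<times> carrier C"
    and w: "Poly_Mapping.keys w \<subseteq> carrier L \<times> carrier C" and a: "a \<in> carrier A"
  shows "alpha_sum L (z - w) a = alpha_sum L z a \<ominus>\<^bsub>L\<^esub> alpha_sum L w a"
proof -
  interpret L: right_module R L by fact
  show ?thesis unfolding alpha_sum_def
    by (rule formal_sum_diff[OF L.M.abelian_group_axioms _ z w])
       (use a in \<open>auto simp: L.rsmult_closed kappa_closed\<close>)
qed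

lemma alpha_sum_add:
  assumes L: "right_module R L" and z: "Poly_Mapping.keys z \<subseteq> carrier L \<times> carrier C"
    and w: "Poly_Mapping.keys w \<subseteq> carrier L \<times> carrier C" and a: "a \<in> carrier A"
  shows "alpha_sum L (z + w) a = alpha_sum L z a \<oplus>\<^bsub>L\<^esub> alpha_sum L w a"
proof -
  interpret L: right_module R L by fact
  show ?thesis unfolding alpha_sum_def
    by (rule formal_sum_add[OF L.M.abelian_group_axioms _ z w])
       (use a in \<open>auto simp: L.rsmult_closed kappa_closed\<close>)
qed

lemma alpha_sum_frag_of:
  assumes L: "right_module R L" and "x \<in> carrier L" "c \<in> carrier C" "a \<in> carrier A"
  shows "alpha_sum L (frag_of (x, c)) a = x \<triangleleft>\<^bsub>L\<^esub> \<kappa> a c"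
proof -
  interpret L: right_module R L by fact
  show ?thesis unfolding alpha_sum_def
    by (rule formal_sum_frag_of[OF L.M.abelian_group_axioms])
       (use assms in \<open>auto simp: L.rsmult_closed kappa_closed\<close>)
qed

text \<open>Naturality of \<alpha> in the module. The set \<open>S\<close> admits formal sums whose
  coefficients lie in a submodule, such as an orthogonal.\<close>

lemma alpha_sum_map:
  assumes L: "right_module R L" and L': "right_module R L'" and S: "S \<subseteq> carrier L"
    and f: "f \<in> right_hom R L L'"
    and z: "Poly_Mapping.keys z \<subseteq> S \<times> carrier C" and a: "a \<in> carrier A"
  shows "alpha_sum L' (frag_map_fst f z) a = f (alpha_sum L z a)"
proof -
  interpret L: right_module R L by fact
  interpret L': right_module R L' by fact
  have hom: "group_hom (add_monoid L) (add_monoid L') f"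
    using f by unfold_locales (auto simp: hom_def right_hom_def)
  have fc: "f x \<in> carrier L'" "f (x \<triangleleft>\<^bsub>L\<^esub> r) = f x \<triangleleft>\<^bsub>L'\<^esub> r" if "x \<in> carrier L" "r \<in> carrier R" for x r
    using f that by (auto simp: right_hom_def)
  have "f (alpha_sum L z a) = formal_sum L' (\<lambda>x c. f x \<triangleleft>\<^bsub>L'\<^esub> \<kappa> a c) z"
    unfolding alpha_sum_def
    by (rule group_hom_formal_sum[OF L.M.abelian_group_axioms L'.M.abelian_group_axioms hom _ z])
       (use S a in \<open>auto simp: L.rsmult_closed kappa_closed fc\<close>)
  also have "\<dots> = alpha_sum L' (frag_map_fst f z) a"
    unfolding alpha_sum_def
    by (rule formal_sum_frag_map_fst[symmetric, OF L'.M.abelian_group_axioms z])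
       (use S a in \<open>auto intro!: L'.rsmult_closed kappa_closed fc(1)[OF _ A.R.zero_closed]\<close>)
  finally show ?thesis ..
qed

text \<open>The form in which injectivity of \<alpha> is used: the class of \<open>z\<close> is
  compared with the class of 0. It rests on \<open>alpha_map_inj\<close>, which covers modules over
  all types, because it is applied to R itself and to quotients whose elements are cosets.\<close>

lemma alpha_sum_eq_zero_imp:
  fixes L :: "('r, 'l, 'w) rmodule_scheme"
  assumes L: "right_module R L" and z: "Poly_Mapping.keys z \<subseteq> carrier L \<times> carrier C"
    and 0: "\<And>a. a \<in> carrier A \<Longrightarrow> alpha_sum L z a = \<zero>\<^bsub>L\<^esub>"
  shows "z \<in> tensor_kernel R L C"
proof -
  interpret L: right_module R L by fact
  have bC: "bimodule R C" by (rule C.bimodule_axioms)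
  interpret T: tensor_factors R L C using L bC by (intro tensor_factors.intro)
  let ?t = "\<lambda>z. tensor_kernel R L C #>\<^bsub>tensor_free L C\<^esub> z"
  have k0: "Poly_Mapping.keys (0 :: 'l \<times> 'c \<Rightarrow>\<^sub>0 int) \<subseteq> carrier L \<times> carrier C" by simp
  have "alpha_map A \<kappa> L (?t z) a = alpha_map A \<kappa> L (?t 0) a" for a
  proof (cases "a \<in> carrier A")
    case True
    then show ?thesis
      using alpha_map_coset(2)[OF L z True] alpha_map_coset(2)[OF L k0 True] 0[OF True]
      by (simp add: formal_sum_zero alpha_sum_def L.M.abelian_group_axioms)
  qed (simp add: alpha_map_def)
  then have "?t z = ?t 0"
    using inj_onD[OF alpha_map_inj[OF L], of "?t z" "?t 0"]
      alpha_map_coset(1)[OF L z A.zero_closed] alpha_map_coset(1)[OF L k0 A.zero_closed] by blast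
  moreover have "z \<in> ?t z"
    by (rule group.rcos_self[OF group_free_Abelian_group _ T.tensor_kernel_subgroup]) (simp add: z)
  ultimately show ?thesis by (auto simp: r_coset_def)
qed

text \<open>Injectivity for the right module R kills \<open>\<one> \<otimes> c\<close>, and the
  balanced map \<open>r \<otimes> c\<close> to \<open>r \<triangleright> c\<close> carries this
  element to \<open>c\<close>.\<close>

lemma kappa_separates:
  assumes c: "c \<in> carrier C" and 0: "\<And>a. a \<in> carrier A \<Longrightarrow> \<kappa> a c = \<zero>\<^bsub>R\<^esub>"
  shows "c = \<zero>\<^bsub>C\<^esub>"
proof -
  let ?R = "regular_bimodule R"
  have R: "right_module R ?R" by (rule right_module_regular[OF A.R.ring_axioms])
  interpret T: tensor_factors R ?R C using R C.bimodule_axioms by (intro tensor_factors.intro)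
  have one: "\<one>\<^bsub>R\<^esub> \<in> carrier ?R" by (simp add: regular_bimodule_def)
  have "frag_of (\<one>\<^bsub>R\<^esub>, c) \<in> tensor_kernel R ?R C"
  proof (rule alpha_sum_eq_zero_imp[OF R])
    show "alpha_sum ?R (frag_of (\<one>\<^bsub>R\<^esub>, c)) a = \<zero>\<^bsub>?R\<^esub>" if a: "a \<in> carrier A" for a
      using alpha_sum_frag_of[OF R one c a] 0[OF a] by (simp add: regular_bimodule_def)
  qed (use one c in \<open>simp add: keys_frag_of\<close>)
  moreover have "balanced R ?R C C (\<lambda>r c. r \<triangleright>\<^bsub>C\<^esub> c)"
    by (auto simp: balanced_def regular_bimodule_def C.lsmult_closed C.lsmult_add_left C.lsmult_add_right C.lsmult_assoc)
  ultimately have "formal_sum C (\<lambda>r c. r \<triangleright>\<^bsub>C\<^esub> c) (frag_of (\<one>\<^bsub>R\<^esub>, c)) = \<zero>\<^bsub>C\<^esub>"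
    by (intro T.formal_sum_tensor_kernel[OF C.M.abelian_group_axioms])
  then show ?thesis
    using formal_sum_frag_of[where h = "\<lambda>r c. r \<triangleright>\<^bsub>C\<^esub> c", OF C.M.abelian_group_axioms] c
    by (simp add: C.lsmult_one)
qed

end

section \<open>The local dual basis\<close>

lemma frag_map_fst_inverse:
  assumes z: "Poly_Mapping.keys z \<subseteq> S \<times> T" and f: "\<And>x. x \<in> S \<Longrightarrow> f (s x) = x"
  shows "frag_map_fst f (frag_map_fst s z) = z"
proof (rule free_Abelian_group_induct[OF z])
  fix p assume "p \<in> S \<times> T"
  then show "frag_map_fst f (frag_map_fst s (frag_of p)) = frag_of p"
    using f by auto
qed (auto simp: frag_extend_diff)

context alpha_pairing
begin

lemma alpha_sum_in_submodule:
  assumes L: "right_module R L" and N: "right_submodule R L N"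
    and z: "Poly_Mapping.keys z \<subseteq> N \<times> carrier C" and a: "a \<in> carrier A"
  shows "alpha_sum L z a \<in> N"
proof -
  interpret L: right_module R L by fact
  have "additive_subgroup N L" "\<And>x r. \<lbrakk>x \<in> N; r \<in> carrier R\<rbrakk> \<Longrightarrow> x \<triangleleft>\<^bsub>L\<^esub> r \<in> N"
    using N by (auto simp: right_submodule_def)
  then show ?thesis
    unfolding alpha_sum_def
    by (intro formal_sum_in_subgroup[OF L.M.abelian_group_axioms _ _ z]) (auto simp: kappa_closed a)
qed

text \<open>
  In the language of tensor products: an element of \<open>L \<otimes> C\<close> whose \<open>\<alpha>\<close>-image takes values in \<open>N\<close>
  vanishes in \<open>L/N \<otimes> C\<close> by injectivity of \<open>\<alpha>\<close>, so it comes from \<open>N \<otimes> C\<close> by right exactness.  The set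
  \<open>H\<close> below consists of the formal sums that agree with one over \<open>N\<close>; it absorbs the relators of
  \<open>L/N \<otimes> C\<close>, lifted along a section of \<open>L \<rightarrow> L/N\<close>.
\<close>

lemma alpha_sum_lift:
  assumes L: "right_module R L" and N: "right_submodule R L N"
    and w: "Poly_Mapping.keys w \<subseteq> carrier L \<times> carrier C"
    and wN: "\<And>a. a \<in> carrier A \<Longrightarrow> alpha_sum L w a \<in> N"
  obtains v where "Poly_Mapping.keys v \<subseteq> N \<times> carrier C"
    "\<And>a. a \<in> carrier A \<Longrightarrow> alpha_sum L w a = alpha_sum L v a"
proof -
  interpret Q: right_quotient R L N
    using L N by (intro right_quotient.intro right_quotient_axioms.intro)
  define q where "q = (\<lambda>x. N +>\<^bsub>L\<^esub> x)"
  let ?Q = "quotient_module L N"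
  have Qm: "right_module R ?Q" by (rule Q.quotient_right_module)
  have q: "q \<in> right_hom R L ?Q" unfolding q_def by (rule Q.quotient_map_hom)
  have qeq: "q x = q y \<longleftrightarrow> x \<ominus>\<^bsub>L\<^esub> y \<in> N" if "x \<in> carrier L" "y \<in> carrier L" for x y
    using that by (simp only: q_def Q.coset_eq_iff)
  have qadd: "q (x \<oplus>\<^bsub>L\<^esub> y) = q x \<oplus>\<^bsub>?Q\<^esub> q y" if "x \<in> carrier L" "y \<in> carrier L" for x y
    using q that by (simp add: right_hom_def)
  have qr: "q (x \<triangleleft>\<^bsub>L\<^esub> r) = q x \<triangleleft>\<^bsub>?Q\<^esub> r" if "x \<in> carrier L" "r \<in> carrier R" for x r
    using q that by (simp add: right_hom_def)
  have qcl: "q x \<in> carrier ?Q" if "x \<in> carrier L" for x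
    using q that by (auto simp: right_hom_def)
  \<comment> \<open>\<open>s\<close> is a section of sets only. Its defects of additivity and of
    R-linearity lie in \<open>N\<close>, and this is why lifted relators fall into
    \<open>H\<close>.\<close>
  define s where "s X = (SOME x. x \<in> carrier L \<and> q x = X)" for X
  have s: "s X \<in> carrier L \<and> q (s X) = X" if "X \<in> carrier ?Q" for X
    unfolding s_def by (rule someI_ex) (use that in \<open>auto simp: q_def Q.quotient_carrier\<close>)
  have NL: "N \<times> carrier C \<subseteq> carrier L \<times> carrier C" using Q.N_closed by auto
  define H where "H = {u. Poly_Mapping.keys u \<subseteq> carrier L \<times> carrier C \<and>
    (\<exists>v. Poly_Mapping.keys v \<subseteq> N \<times> carrier C \<and> (\<forall>a\<in>carrier A. alpha_sum L u a = alpha_sum L v a))}"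
  \<comment> \<open>Lifted relators and lifted generators enter \<open>H\<close> through this case:
    their \<alpha>-values agree with those of one term \<open>(n, c)\<close>, where \<open>n\<close>
    is the defect of the section.\<close>
  have HI: "u \<in> H" if "Poly_Mapping.keys u \<subseteq> carrier L \<times> carrier C" "n \<in> N" "c \<in> carrier C"
    "\<And>a. a \<in> carrier A \<Longrightarrow> alpha_sum L u a = n \<triangleleft>\<^bsub>L\<^esub> \<kappa> a c" for u n c
    using that alpha_sum_frag_of[OF L Q.N_closed[OF that(2)] that(3)]
    unfolding H_def by (intro CollectI conjI exI[of _ "frag_of (n, c)"]) (auto simp: keys_frag_of)
  have Hdiff: "u - u' \<in> H" if H: "u \<in> H" "u' \<in> H" for u u'
  proof -
    obtain v v' where v: "Poly_Mapping.keys v \<subseteq> N \<times> carrier C" "Poly_Mapping.keys v' \<subseteq> N \<times> carrier C"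
      "\<forall>a\<in>carrier A. alpha_sum L u a = alpha_sum L v a" "\<forall>a\<in>carrier A. alpha_sum L u' a = alpha_sum L v' a"
      using H unfolding H_def by blast
    have u: "Poly_Mapping.keys u \<subseteq> carrier L \<times> carrier C" "Poly_Mapping.keys u' \<subseteq> carrier L \<times> carrier C"
      using H unfolding H_def by blast+
    have "\<forall>a\<in>carrier A. alpha_sum L (u - u') a = alpha_sum L (v - v') a"
      using v alpha_sum_diff[OF L u] alpha_sum_diff[OF L subset_trans[OF v(1) NL] subset_trans[OF v(2) NL]] by simp
    then show ?thesis
      unfolding H_def using u v keys_diff[of u u'] keys_diff[of v v']
      by (intro CollectI conjI exI[of _ "v - v'"]) auto
  qed
  have of: "alpha_sum L (frag_of (x, c)) a = x \<triangleleft>\<^bsub>L\<^esub> \<kappa> a c"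
    if "x \<in> carrier L" "c \<in> carrier C" "a \<in> carrier A" for x c a
    by (rule alpha_sum_frag_of[OF L that])
  have keys3: "Poly_Mapping.keys (frag_of p - frag_of p' - frag_of p'') \<subseteq> S"
    if "p \<in> S" "p' \<in> S" "p'' \<in> S" for p p' p'' S
    using that keys_diff[of "frag_of p - frag_of p'" "frag_of p''"] keys_diff[of "frag_of p" "frag_of p'"]
    by (auto simp: keys_frag_of)
  have diff2: "alpha_sum L (frag_of (x, c) - frag_of (y, d)) a = x \<triangleleft>\<^bsub>L\<^esub> \<kappa> a c \<ominus>\<^bsub>L\<^esub> y \<triangleleft>\<^bsub>L\<^esub> \<kappa> a d"
    if "x \<in> carrier L" "y \<in> carrier L" "c \<in> carrier C" "d \<in> carrier C" "a \<in> carrier A" for x y c d a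
    using that alpha_sum_diff[OF L, of "frag_of (x, c)" "frag_of (y, d)" a] by (simp add: keys_frag_of of)
  have diff3: "alpha_sum L (frag_of (x, c) - frag_of (y, d) - frag_of (z, e)) a
      = x \<triangleleft>\<^bsub>L\<^esub> \<kappa> a c \<ominus>\<^bsub>L\<^esub> y \<triangleleft>\<^bsub>L\<^esub> \<kappa> a d \<ominus>\<^bsub>L\<^esub> z \<triangleleft>\<^bsub>L\<^esub> \<kappa> a e"
    if "x \<in> carrier L" "y \<in> carrier L" "z \<in> carrier L" "c \<in> carrier C" "d \<in> carrier C" "e \<in> carrier C" "a \<in> carrier A"
    for x y z c d e a
    using that alpha_sum_diff[OF L, of "frag_of (x, c) - frag_of (y, d)" "frag_of (z, e)" a]
    by (simp add: keys_frag_of of diff2 keys_relator2)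
  have H0: "0 \<in> H"
    unfolding H_def by (intro CollectI conjI exI[of _ 0]) auto
  have rel: "frag_map_fst s u \<in> H" if u: "u \<in> tensor_relators R ?Q C" for u
    using u unfolding tensor_relators_def
  proof (elim UnE CollectE exE conjE)
    fix X Y c assume *: "u = frag_of (X \<oplus>\<^bsub>?Q\<^esub> Y, c) - frag_of (X, c) - frag_of (Y, c)"
      "X \<in> carrier ?Q" "Y \<in> carrier ?Q" "c \<in> carrier C"
    have XY: "X \<oplus>\<^bsub>?Q\<^esub> Y \<in> carrier ?Q"
      using * Qm by (simp add: right_module_def abelian_group.axioms(1) abelian_monoid.a_closed)
    note S = s[OF *(2)] s[OF *(3)] s[OF XY]
    let ?n = "s (X \<oplus>\<^bsub>?Q\<^esub> Y) \<ominus>\<^bsub>L\<^esub> (s X \<oplus>\<^bsub>L\<^esub> s Y)"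
    have "?n \<in> N"
      using S qeq[of "s (X \<oplus>\<^bsub>?Q\<^esub> Y)" "s X \<oplus>\<^bsub>L\<^esub> s Y"] by (simp add: qadd)
    moreover have "?n \<triangleleft>\<^bsub>L\<^esub> k = s (X \<oplus>\<^bsub>?Q\<^esub> Y) \<triangleleft>\<^bsub>L\<^esub> k \<ominus>\<^bsub>L\<^esub> s X \<triangleleft>\<^bsub>L\<^esub> k \<ominus>\<^bsub>L\<^esub> s Y \<triangleleft>\<^bsub>L\<^esub> k"
      if "k \<in> carrier R" for k
      using S that
      by (simp add: Q.diff_rsmult Q.minus_rsmult Q.rsmult_add_left Q.rsmult_closed Q.M.minus_eq Q.M.minus_add Q.M.a_ac)
    ultimately show ?thesis
      using S *(4) unfolding *(1)
      by (intro HI[of _ ?n c]) (simp_all add: frag_extend_diff keys3 diff3 kappa_closed)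
  next
    fix X c d assume *: "u = frag_of (X, c \<oplus>\<^bsub>C\<^esub> d) - frag_of (X, c) - frag_of (X, d)"
      "X \<in> carrier ?Q" "c \<in> carrier C" "d \<in> carrier C"
    note S = s[OF *(2)]
    \<comment> \<open>Additivity in the second factor uses the same representative
      \<open>s X\<close> in all three terms, so the defect is zero.\<close>
    have "s X \<triangleleft>\<^bsub>L\<^esub> (j \<oplus>\<^bsub>R\<^esub> k) \<ominus>\<^bsub>L\<^esub> s X \<triangleleft>\<^bsub>L\<^esub> j \<ominus>\<^bsub>L\<^esub> s X \<triangleleft>\<^bsub>L\<^esub> k = \<zero>\<^bsub>L\<^esub>"
      if "j \<in> carrier R" "k \<in> carrier R" for j k
      using S that tensor_factors.relator_zero[OF tensor_factors.intro[OF L C.bimodule_axioms] Q.M.abelian_group_axioms,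
          of "s X \<triangleleft>\<^bsub>L\<^esub> j" "s X \<triangleleft>\<^bsub>L\<^esub> k"]
      by (simp add: Q.rsmult_closed Q.rsmult_add_right)
    then show ?thesis
      using S *(3,4) unfolding *(1)
      by (intro HI[of _ "\<zero>\<^bsub>L\<^esub>" c])
         (simp_all add: frag_extend_diff keys3 diff3 kappa_closed kappa_add_right Q.zero_rsmult)
  next
    fix X r c assume *: "u = frag_of (X \<triangleleft>\<^bsub>?Q\<^esub> r, c) - frag_of (X, r \<triangleright>\<^bsub>C\<^esub> c)"
      "X \<in> carrier ?Q" "r \<in> carrier R" "c \<in> carrier C"
    have Xr: "X \<triangleleft>\<^bsub>?Q\<^esub> r \<in> carrier ?Q"
      using *(2,3) right_module.rsmult_closed[OF Qm] by blast
    note S = s[OF *(2)] s[OF Xr]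
    let ?n = "s (X \<triangleleft>\<^bsub>?Q\<^esub> r) \<ominus>\<^bsub>L\<^esub> (s X \<triangleleft>\<^bsub>L\<^esub> r)"
    have "?n \<in> N"
      using S *(3) qeq[of "s (X \<triangleleft>\<^bsub>?Q\<^esub> r)" "s X \<triangleleft>\<^bsub>L\<^esub> r"] by (simp add: qr Q.rsmult_closed)
    then show ?thesis
      using S *(3,4) unfolding *(1)
      by (intro HI[of _ ?n c])
         (simp_all add: frag_extend_diff keys_relator2 diff2 kappa_closed kappa_lsmult C.lsmult_closed
           Q.diff_rsmult Q.rsmult_closed Q.rsmult_assoc)
  qed
  have kernel: "frag_map_fst s u \<in> H" if "u \<in> tensor_kernel R ?Q C" for u
  proof -
    interpret T: tensor_factors R ?Q C using Qm C.bimodule_axioms by (rule tensor_factors.intro)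
    have "u \<in> generate (tensor_free ?Q C) (tensor_relators R ?Q C)"
      using that by (simp add: tensor_kernel_def)
    then show ?thesis
    proof (induction u rule: generate.induct)
      case one
      then show ?case using H0 by simp
    next
      case (incl u)
      then show ?case by (rule rel)
    next
      case (inv u)
      then show ?case
        using Hdiff[OF H0 rel[OF inv]] subsetD[OF T.tensor_relators_closed inv]
        by (simp add: frag_extend_minus)
    next
      \<comment> \<open>\<open>Hdiff\<close> handles differences, so the sum is taken as u - (0 -
        v).\<close>
      case (eng u v)
      then show ?case
        using Hdiff[OF eng(3) Hdiff[OF H0 eng(4)]] by (simp add: frag_extend_add)
    qed
  qed
  have "frag_map_fst q w \<in> tensor_kernel R ?Q C"
  proof (rule alpha_sum_eq_zero_imp[OF Qm])
    show "Poly_Mapping.keys (frag_map_fst q w) \<subseteq> carrier ?Q \<times> carrier C"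
      using w qcl by (rule keys_frag_map_fst)
    fix a assume a: "a \<in> carrier A"
    have "alpha_sum ?Q (frag_map_fst q w) a = q (alpha_sum L w a)"
      by (rule alpha_sum_map[OF L Qm subset_refl q w a])
    also have "\<dots> = q \<zero>\<^bsub>L\<^esub>"
      using wN[OF a] Q.N_closed[OF wN[OF a]] by (simp add: qeq Q.M.minus_eq)
    finally show "alpha_sum ?Q (frag_map_fst q w) a = \<zero>\<^bsub>?Q\<^esub>"
      by (simp add: q_def Q.quotient_zero)
  qed
  then have "frag_map_fst s (frag_map_fst q w) \<in> H" by (rule kernel)
  \<comment> \<open>Going to the quotient and back along \<open>s\<close> changes a generator
    \<open>(x, c)\<close> by something with the values of a term whose coefficient
    \<open>x \<ominus> s (q x)\<close> lies in \<open>N\<close>.\<close>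
  moreover have "w - frag_map_fst s (frag_map_fst q w) \<in> H"
  proof (rule free_Abelian_group_induct[OF w])
    fix p assume "p \<in> carrier L \<times> carrier C"
    then obtain x c where p: "p = (x, c)" "x \<in> carrier L" "c \<in> carrier C" by auto
    note S = s[OF qcl[OF p(2)]]
    have "x \<ominus>\<^bsub>L\<^esub> s (q x) \<in> N" using S p qeq[of x "s (q x)"] by simp
    then show "frag_of p - frag_map_fst s (frag_map_fst q (frag_of p)) \<in> H"
      using S p by (intro HI[of _ "x \<ominus>\<^bsub>L\<^esub> s (q x)" c])
        (simp_all add: keys_relator2 diff2 Q.diff_rsmult kappa_closed)
  next
    fix u v assume "u - frag_map_fst s (frag_map_fst q u) \<in> H" "v - frag_map_fst s (frag_map_fst q v) \<in> H"
    from Hdiff[OF this] show "u - v - frag_map_fst s (frag_map_fst q (u - v)) \<in> H"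
      by (simp add: frag_extend_diff algebra_simps)
  qed (simp add: H0)
  ultimately have "w \<in> H"
    using Hdiff[of "w - frag_map_fst s (frag_map_fst q w)" "0 - frag_map_fst s (frag_map_fst q w)"] Hdiff[OF H0] by simp
  then show ?thesis using that unfolding H_def by blast
qed

lemma orth_right_submodule:
  assumes "F \<subseteq> carrier C"
  shows "right_submodule R A (orth R A \<kappa> F)"
proof (rule A.right_submoduleI)
  have "\<kappa> \<zero>\<^bsub>A\<^esub> c = \<zero>\<^bsub>R\<^esub>" if "c \<in> F" for c
    using group_hom.hom_one[OF kappa_hom_left[of c]] that assms by auto
  then show "\<zero>\<^bsub>A\<^esub> \<in> orth R A \<kappa> F" by (simp add: orth_def)
qed (use assms in \<open>auto simp: orth_def kappa_add_left kappa_rsmult A.rsmult_closed subset_iff\<close>)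

text \<open>
  To pass from \<open>F\<close> to \<open>insert c F\<close>, lift the element \<open>1 \<otimes> c - \<Sum> \<langle>b\<^sub>j, c\<rangle> \<otimes> x\<^sub>j\<close> of \<open>R \<otimes> C\<close> to
  \<open>\<langle>F\<^sup>\<bottom>, c\<rangle> \<otimes> C\<close> and correct the sum \<open>\<Sum> b\<^sub>j \<langle>a, x\<^sub>j\<rangle>\<close> accordingly.
\<close>

lemma local_dual_basis:
  assumes "finite F" "F \<subseteq> carrier C"
  shows "\<exists>z. Poly_Mapping.keys z \<subseteq> carrier A \<times> carrier C \<and>
    (\<forall>a\<in>carrier A. \<forall>c\<in>F. \<kappa> (alpha_sum A z a) c = \<kappa> a c)"
  using assms
proof (induction F rule: finite_induct)
  case empty
  then show ?case by (intro exI[of _ 0]) auto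
next
  case (insert c F)
  then obtain z where z: "Poly_Mapping.keys z \<subseteq> carrier A \<times> carrier C"
    "\<And>a d. \<lbrakk>a \<in> carrier A; d \<in> F\<rbrakk> \<Longrightarrow> \<kappa> (alpha_sum A z a) d = \<kappa> a d" by auto
  have c: "c \<in> carrier C" and F: "F \<subseteq> carrier C" using insert by auto
  let ?O = "orth R A \<kappa> F" and ?f = "\<lambda>b. \<kappa> b c" and ?R = "regular_bimodule R"
  have Am: "right_module R A" by (rule A.right_module_axioms)
  have Rm: "right_module R ?R" by (rule right_module_regular[OF A.R.ring_axioms])
  have f: "?f \<in> right_hom R A ?R"
    using c by (auto simp: right_hom_def regular_bimodule_def kappa_closed kappa_add_left kappa_rsmult)
  have O: "right_submodule R A ?O" using F by (rule orth_right_submodule)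
  have Oc: "?O \<subseteq> carrier A" by (auto simp: orth_def)
  have za: "alpha_sum A z a \<in> carrier A" if "a \<in> carrier A" for a
    using alpha_sum_closed[OF Am z(1) that] .
  have N: "right_submodule R ?R (?f ` ?O)" by (rule right_submodule_image[OF Am Rm f O])
  define w where "w = frag_of (\<one>\<^bsub>R\<^esub>, c) - frag_map_fst ?f z"
  have k1: "Poly_Mapping.keys (frag_of (\<one>\<^bsub>R\<^esub>, c)) \<subseteq> carrier ?R \<times> carrier C"
    using c by (simp add: keys_frag_of regular_bimodule_def)
  have k2: "Poly_Mapping.keys (frag_map_fst ?f z) \<subseteq> carrier ?R \<times> carrier C"
    using z(1) by (rule keys_frag_map_fst) (simp add: c regular_bimodule_def kappa_closed)
  have w: "Poly_Mapping.keys w \<subseteq> carrier ?R \<times> carrier C"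
    unfolding w_def by (rule subset_trans[OF keys_diff Un_least[OF k1 k2]])
  \<comment> \<open>The \<alpha>-values of \<open>w\<close> are the current errors at
    \<open>c\<close>. By \<open>aO\<close> the error is orthogonal to \<open>F\<close>, so these
    values lie in the right ideal of pairings of \<open>?O\<close> with \<open>c\<close>, and
    \<open>alpha_sum_lift\<close> applies.\<close>
  have wa: "alpha_sum ?R w a = \<kappa> (a \<ominus>\<^bsub>A\<^esub> alpha_sum A z a) c" if a: "a \<in> carrier A" for a
  proof -
    have "alpha_sum ?R (frag_of (\<one>\<^bsub>R\<^esub>, c)) a = \<one>\<^bsub>R\<^esub> \<triangleleft>\<^bsub>?R\<^esub> \<kappa> a c"
      by (rule alpha_sum_frag_of[OF Rm _ c a]) (simp add: regular_bimodule_def)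
    then have "alpha_sum ?R w a = \<kappa> a c \<ominus>\<^bsub>?R\<^esub> \<kappa> (alpha_sum A z a) c"
      unfolding w_def
      using alpha_sum_diff[OF Rm k1 k2 a] alpha_sum_map[OF Am Rm subset_refl f z(1) a] a c
      by (simp add: regular_bimodule_def kappa_closed)
    also have "\<dots> = \<kappa> a c \<ominus>\<^bsub>R\<^esub> \<kappa> (alpha_sum A z a) c"
      by (simp add: a_minus_def a_inv_def regular_bimodule_def m_inv_def)
    finally show ?thesis using a za[OF a] c by (simp add: kappa_diff_left)
  qed
  have aO: "a \<ominus>\<^bsub>A\<^esub> alpha_sum A z a \<in> ?O" if a: "a \<in> carrier A" for a
    using a za[OF a] z(2)[OF a] F
    by (auto simp: orth_def kappa_diff_left subset_iff kappa_closed A.R.minus_eq A.R.r_neg)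
  obtain v where v: "Poly_Mapping.keys v \<subseteq> ?f ` ?O \<times> carrier C"
    "\<And>a. a \<in> carrier A \<Longrightarrow> alpha_sum ?R w a = alpha_sum ?R v a"
    by (rule alpha_sum_lift[OF Rm N w]) (use wa aO in auto)
  \<comment> \<open>\<open>g\<close> chooses preimages in \<open>?O\<close> of the coefficients of
    \<open>v\<close>. Linearity of \<open>g\<close> is not at issue, because it only acts on a
    formal sum and \<open>?f\<close> undoes it there.\<close>
  define g where "g = inv_into ?O ?f"
  have g: "g x \<in> ?O" "?f (g x) = x" if "x \<in> ?f ` ?O" for x
    using f_inv_into_f[OF that] inv_into_into[OF that] by (simp_all only: g_def)
  define u where "u = frag_map_fst g v"
  have u: "Poly_Mapping.keys u \<subseteq> ?O \<times> carrier C"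
    unfolding u_def using v(1) g(1) by (rule keys_frag_map_fst)
  then have u': "Poly_Mapping.keys u \<subseteq> carrier A \<times> carrier C" using Oc by blast
  have uO: "alpha_sum A u a \<in> ?O" if "a \<in> carrier A" for a
    by (rule alpha_sum_in_submodule[OF Am O u that])
  have ua: "\<kappa> (alpha_sum A u a) c = \<kappa> (a \<ominus>\<^bsub>A\<^esub> alpha_sum A z a) c" if a: "a \<in> carrier A" for a
  proof -
    have "frag_map_fst ?f u = v"
      unfolding u_def by (rule frag_map_fst_inverse[OF v(1)]) (rule g(2))
    then show ?thesis
      using alpha_sum_map[OF Am Rm Oc f u a] v(2)[OF a] wa[OF a] by simp
  qed
  show ?case
  proof (intro exI[of _ "z + u"] conjI ballI)
    show "Poly_Mapping.keys (z + u) \<subseteq> carrier A \<times> carrier C"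
      using keys_add[of z u] z(1) u' by auto
    fix a d assume a: "a \<in> carrier A" and d: "d \<in> insert c F"
    have dc: "d \<in> carrier C" using d c F by auto
    have "\<kappa> (alpha_sum A (z + u) a) d = \<kappa> (alpha_sum A z a) d \<oplus>\<^bsub>R\<^esub> \<kappa> (alpha_sum A u a) d"
      using alpha_sum_add[OF Am z(1) u' a] za[OF a] subsetD[OF Oc uO[OF a]] dc by (simp add: kappa_add_left)
    also have "\<dots> = \<kappa> a d"
    \<comment> \<open>On the old elements the correction \<open>u\<close> vanishes, since its values
      are orthogonal to \<open>F\<close>; at \<open>c\<close> it contributes exactly the missing
      error, by \<open>ua\<close>.\<close>
    proof (cases "d \<in> F")
      case True
      then show ?thesis using z(2)[OF a True] uO[OF a] a dc by (simp add: orth_def kappa_closed)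
    next
      case False
      then have "d = c" using d by simp
      moreover have "x \<oplus>\<^bsub>R\<^esub> (y \<ominus>\<^bsub>R\<^esub> x) = y" if "x \<in> carrier R" "y \<in> carrier R" for x y
        using that by (simp add: A.R.minus_eq A.R.a_comm[of y] A.R.r_neg2)
      ultimately show ?thesis
        using ua[OF a] a za[OF a] c by (simp add: kappa_diff_left kappa_closed)
    qed
    finally show "\<kappa> (alpha_sum A (z + u) a) d = \<kappa> a d" .
  qed
qed

end

section \<open>Artinian modules\<close>

lemma (in abelian_group) diff_eq_zero_iff:
  assumes "x \<in> carrier G" "y \<in> carrier G"
  shows "x \<ominus> y = \<zero> \<longleftrightarrow> x = y"
proof
  assume "x \<ominus> y = \<zero>"
  then have "x = \<ominus> (\<ominus> y)"
    using minus_equality[of x "\<ominus> y"] assms by (simp add: minus_eq)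
  then show "x = y" using assms by simp
qed (use assms in \<open>simp add: minus_eq r_neg\<close>)

text \<open>A descending chain inside Y + gR is controlled by its intersections with
  \<open>Y\<close> and by the right ideals of coefficients that \<open>g\<close> takes in it; both
  stabilise. The chain condition on \<open>Y\<close> is phrased for submodules of \<open>M\<close>,
  so \<open>Y\<close> need not become a module record of its own.\<close>

lemma (in right_module) artinian_extend_by_one:
  assumes R: "artinian_right_module R (regular_bimodule R)" and g: "g \<in> carrier M"
    and Y: "right_submodule R M Y"
    and dcc: "\<And>I :: nat \<Rightarrow> 'm set. \<lbrakk>\<And>n. right_submodule R M (I n); \<And>n. I (Suc n) \<subseteq> I n; I 0 \<subseteq> Y\<rbrakk> \<Longrightarrow>
      \<exists>n. \<forall>k\<ge>n. I k = I n"
    and I: "\<And>n. right_submodule R M (I n)" "\<And>n. I (Suc n) \<subseteq> I n"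
    and I0: "I (0 :: nat) \<subseteq> {y \<oplus>\<^bsub>M\<^esub> g \<triangleleft>\<^bsub>M\<^esub> r | y r. y \<in> Y \<and> r \<in> carrier R}"
  shows "\<exists>n. \<forall>k\<ge>n. I k = I n"
proof -
  interpret Y: right_quotient R M Y using Y by unfold_locales
  have IM: "x \<in> carrier M" if "x \<in> I n" for x n
    using I(1)[of n] that by (auto simp: right_submodule_def additive_subgroup.a_Hcarr)
  have Iadd: "x \<oplus>\<^bsub>M\<^esub> y \<in> I n" if "x \<in> I n" "y \<in> I n" for x y n
    using I(1)[of n] that by (auto simp: right_submodule_def additive_subgroup.a_closed)
  have Izero: "\<zero>\<^bsub>M\<^esub> \<in> I n" for n
    using I(1)[of n] by (auto simp: right_submodule_def additive_subgroup.zero_closed)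
  have Ir: "x \<triangleleft>\<^bsub>M\<^esub> r \<in> I n" if "x \<in> I n" "r \<in> carrier R" for x r n
    using I(1)[of n] that by (auto simp: right_submodule_def)
  have Yadd: "x \<oplus>\<^bsub>M\<^esub> y \<in> Y" if "x \<in> Y" "y \<in> Y" for x y
    using that by (rule Y.N.a_closed)
  have mono: "I k \<subseteq> I n" if "n \<le> k" for n k
    using I(2) that by (rule lift_Suc_antimono_le)
  have neg: "\<ominus>\<^bsub>M\<^esub> x = x \<triangleleft>\<^bsub>M\<^esub> (\<ominus>\<^bsub>R\<^esub> \<one>\<^bsub>R\<^esub>)" if "x \<in> carrier M" for x
    using that by (simp add: rsmult_minus rsmult_one)
  \<comment> \<open>\<open>J n\<close> is the preimage of (I n + Y)/Y under the map from R to M/Y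
    that sends r to the class of g r.\<close>
  define J where "J n = {r \<in> carrier R. \<exists>y\<in>Y. y \<oplus>\<^bsub>M\<^esub> g \<triangleleft>\<^bsub>M\<^esub> r \<in> I n}" for n
  have "\<exists>n. \<forall>k\<ge>n. I k \<inter> Y = I n \<inter> Y"
  proof (rule dcc)
    show "right_submodule R M (I n \<inter> Y)" for n
      by (rule right_submoduleI) (auto simp: IM Iadd Izero Ir Yadd Y.N_rsmult)
  qed (use I(2) in auto)
  then obtain n1 where n1: "\<And>k. k \<ge> n1 \<Longrightarrow> I k \<inter> Y = I n1 \<inter> Y" by blast
  have "right_submodule R (regular_bimodule R) (J n)" for n
  proof (rule right_module.right_submoduleI[OF right_module_regular[OF R.ring_axioms]])
    show "J n \<subseteq> carrier (regular_bimodule R)" by (auto simp: J_def regular_bimodule_def)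
    show "\<zero>\<^bsub>regular_bimodule R\<^esub> \<in> J n"
      using g Izero Y.N.zero_closed by (auto simp: J_def regular_bimodule_def rsmult_zero intro!: bexI[of _ "\<zero>\<^bsub>M\<^esub>"])
    show "r \<oplus>\<^bsub>regular_bimodule R\<^esub> s \<in> J n" if rs: "r \<in> J n" "s \<in> J n" for r s
    proof -
      obtain y y' where y: "y \<in> Y" "y \<oplus>\<^bsub>M\<^esub> g \<triangleleft>\<^bsub>M\<^esub> r \<in> I n" "y' \<in> Y" "y' \<oplus>\<^bsub>M\<^esub> g \<triangleleft>\<^bsub>M\<^esub> s \<in> I n"
        using rs unfolding J_def by blast
      have c: "r \<in> carrier R" "s \<in> carrier R" using rs by (auto simp: J_def)
      have "(y \<oplus>\<^bsub>M\<^esub> y') \<oplus>\<^bsub>M\<^esub> g \<triangleleft>\<^bsub>M\<^esub> (r \<oplus>\<^bsub>R\<^esub> s) = (y \<oplus>\<^bsub>M\<^esub> g \<triangleleft>\<^bsub>M\<^esub> r) \<oplus>\<^bsub>M\<^esub> (y' \<oplus>\<^bsub>M\<^esub> g \<triangleleft>\<^bsub>M\<^esub> s)"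
        using y(1,3) c g by (simp add: rsmult_add_right rsmult_closed Y.N_closed M.a_ac)
      then show ?thesis
        using Iadd[OF y(2,4)] Yadd[OF y(1,3)] c by (auto simp: J_def regular_bimodule_def intro!: bexI[of _ "y \<oplus>\<^bsub>M\<^esub> y'"])
    qed
    show "r \<triangleleft>\<^bsub>regular_bimodule R\<^esub> s \<in> J n" if rs: "r \<in> J n" "s \<in> carrier R" for r s
    proof -
      obtain y where y: "y \<in> Y" "y \<oplus>\<^bsub>M\<^esub> g \<triangleleft>\<^bsub>M\<^esub> r \<in> I n"
        using rs unfolding J_def by blast
      have c: "r \<in> carrier R" using rs by (auto simp: J_def)
      have "y \<triangleleft>\<^bsub>M\<^esub> s \<oplus>\<^bsub>M\<^esub> g \<triangleleft>\<^bsub>M\<^esub> (r \<otimes>\<^bsub>R\<^esub> s) = (y \<oplus>\<^bsub>M\<^esub> g \<triangleleft>\<^bsub>M\<^esub> r) \<triangleleft>\<^bsub>M\<^esub> s"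
        using y(1) c g rs(2) by (simp add: rsmult_add_left rsmult_closed Y.N_closed rsmult_assoc)
      then show ?thesis
        using Ir[OF y(2) rs(2)] Y.N_rsmult[OF y(1) rs(2)] c rs(2)
        by (auto simp: J_def regular_bimodule_def intro!: bexI[of _ "y \<triangleleft>\<^bsub>M\<^esub> s"])
    qed
  qed
  moreover have "J (Suc n) \<subseteq> J n" for n using I(2)[of n] by (auto simp: J_def)
  ultimately obtain n2 where n2: "\<And>k. k \<ge> n2 \<Longrightarrow> J k = J n2"
    using R unfolding artinian_right_module_def by blast
  let ?n = "max n1 n2"
  have sub: "I ?n \<subseteq> I k" if k: "k \<ge> ?n" for k
  proof
    fix x assume x: "x \<in> I ?n"
    have "I ?n \<subseteq> I 0" by (rule mono) simp
    then obtain y r where yr: "x = y \<oplus>\<^bsub>M\<^esub> g \<triangleleft>\<^bsub>M\<^esub> r" "y \<in> Y" "r \<in> carrier R" using x I0 by blast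
    then have "r \<in> J ?n" using x by (auto simp: J_def)
    then have "r \<in> J k" using n2[of k] n2[of ?n] k by simp
    then obtain y' where y': "y' \<in> Y" "y' \<oplus>\<^bsub>M\<^esub> g \<triangleleft>\<^bsub>M\<^esub> r \<in> I k" by (auto simp: J_def)
    \<comment> \<open>\<open>x\<close> and \<open>?i\<close> have the same coefficient at
      \<open>g\<close>, so they differ by an element of \<open>Y\<close>, and inside
      \<open>Y\<close> the chain is already constant.\<close>
    let ?i = "y' \<oplus>\<^bsub>M\<^esub> g \<triangleleft>\<^bsub>M\<^esub> r"
    have c: "y \<in> carrier M" "y' \<in> carrier M" "g \<triangleleft>\<^bsub>M\<^esub> r \<in> carrier M"
      using yr y' g by (auto simp: Y.N_closed rsmult_closed)
    have "x \<ominus>\<^bsub>M\<^esub> ?i = y \<ominus>\<^bsub>M\<^esub> y'"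
      using c by (simp add: yr(1) M.minus_eq M.minus_add M.a_ac M.r_neg M.r_neg2)
    moreover have "y \<ominus>\<^bsub>M\<^esub> y' \<in> Y"
      using yr(2) y'(1) by (simp add: M.minus_eq Yadd)
    moreover have "x \<ominus>\<^bsub>M\<^esub> ?i \<in> I ?n"
      using x subsetD[OF mono[OF k] y'(2)] IM[OF y'(2)] by (simp add: M.minus_eq neg Iadd Ir)
    ultimately have "x \<ominus>\<^bsub>M\<^esub> ?i \<in> I ?n \<inter> Y" by simp
    then have "x \<ominus>\<^bsub>M\<^esub> ?i \<in> I k" using n1[of k] n1[of ?n] k by auto
    then have "(x \<ominus>\<^bsub>M\<^esub> ?i) \<oplus>\<^bsub>M\<^esub> ?i \<in> I k" using y'(2) by (rule Iadd)
    then show "x \<in> I k" using IM[OF x] IM[OF y'(2)] by (simp add: M.minus_eq M.a_assoc M.l_neg)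
  qed
  show ?thesis
  proof (rule exI[of _ ?n], rule allI, rule impI)
    fix k assume k: "?n \<le> k"
    show "I k = I ?n" by (rule subset_antisym[OF mono[OF k] sub[OF k]])
  qed
qed

text \<open>Induction over the generators: each one enlarges, by its multiples, a submodule below
  which descending chains stabilise. Once this submodule contains all generators it is the whole
  module.\<close>

lemma (in right_module) fg_imp_artinian:
  assumes R: "artinian_right_module R (regular_bimodule R)" and fg: "fg_right_module R M"
  shows "artinian_right_module R M"
proof -
  obtain G where G: "finite G" "G \<subseteq> carrier M" "\<Inter> {N. right_submodule R M N \<and> G \<subseteq> N} = carrier M"
    using fg unfolding fg_right_module_def by blast
  let ?dcc = "\<lambda>Y. \<forall>I :: nat \<Rightarrow> 'm set. (\<forall>n. right_submodule R M (I n)) \<longrightarrow> (\<forall>n. I (Suc n) \<subseteq> I n) \<longrightarrow> I 0 \<subseteq> Y \<longrightarrow>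
      (\<exists>n. \<forall>k\<ge>n. I k = I n)"
  have "\<exists>Y. right_submodule R M Y \<and> G \<subseteq> Y \<and> ?dcc Y"
    using G(1,2)
  proof (induction G rule: finite_induct)
    case empty
    have Z: "right_submodule R M {\<zero>\<^bsub>M\<^esub>}" by (rule right_submoduleI) (auto simp: zero_rsmult)
    have "\<forall>k\<ge>0. I k = I 0" if I: "\<forall>n. right_submodule R M (I n)" "\<forall>n. I (Suc n) \<subseteq> I n" "I 0 \<subseteq> {\<zero>\<^bsub>M\<^esub>}"
      for I :: "nat \<Rightarrow> 'm set"
    proof -
      have "I k \<subseteq> I 0" for k by (rule lift_Suc_antimono_le[of I, OF spec[OF I(2)] le0])
      moreover have "\<zero>\<^bsub>M\<^esub> \<in> I k" for k
        using I(1) by (auto simp: right_submodule_def additive_subgroup.zero_closed)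
      ultimately show ?thesis using I(3) by blast
    qed
    then show ?case using Z by (intro exI[of _ "{\<zero>\<^bsub>M\<^esub>}"]) blast
  next
    case (insert g G)
    then obtain Y where Y: "right_submodule R M Y" "G \<subseteq> Y" "?dcc Y" by auto
    have g: "g \<in> carrier M" using insert by simp
    interpret Y: right_quotient R M Y using Y(1) by unfold_locales
    let ?Y = "{y \<oplus>\<^bsub>M\<^esub> g \<triangleleft>\<^bsub>M\<^esub> r | y r. y \<in> Y \<and> r \<in> carrier R}"
    have mem: "x \<in> ?Y" if "y \<in> Y" "r \<in> carrier R" "x = y \<oplus>\<^bsub>M\<^esub> g \<triangleleft>\<^bsub>M\<^esub> r" for x y r
      using that by blast
    have "right_submodule R M ?Y"
    proof (rule right_submoduleI)
      show "?Y \<subseteq> carrier M" using g by (auto simp: Y.N_closed rsmult_closed)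
      show "\<zero>\<^bsub>M\<^esub> \<in> ?Y" by (rule mem[of "\<zero>\<^bsub>M\<^esub>" "\<zero>\<^bsub>R\<^esub>"]) (use g in \<open>simp_all add: rsmult_zero\<close>)
      fix x assume "x \<in> ?Y"
      then obtain y r where x: "y \<in> Y" "r \<in> carrier R" "x = y \<oplus>\<^bsub>M\<^esub> g \<triangleleft>\<^bsub>M\<^esub> r" by blast
      show "x \<triangleleft>\<^bsub>M\<^esub> s \<in> ?Y" if s: "s \<in> carrier R" for s
        by (rule mem[of "y \<triangleleft>\<^bsub>M\<^esub> s" "r \<otimes>\<^bsub>R\<^esub> s"])
           (use x g s in \<open>simp_all add: Y.N_rsmult rsmult_add_left rsmult_closed Y.N_closed rsmult_assoc\<close>)
      fix x' assume "x' \<in> ?Y"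
      then obtain y' r' where x': "y' \<in> Y" "r' \<in> carrier R" "x' = y' \<oplus>\<^bsub>M\<^esub> g \<triangleleft>\<^bsub>M\<^esub> r'" by blast
      show "x \<oplus>\<^bsub>M\<^esub> x' \<in> ?Y"
        by (rule mem[of "y \<oplus>\<^bsub>M\<^esub> y'" "r \<oplus>\<^bsub>R\<^esub> r'"])
           (use x x' g in \<open>simp_all add: Y.N.a_closed rsmult_add_right rsmult_closed Y.N_closed M.a_ac\<close>)
    qed
    moreover have "insert g G \<subseteq> ?Y"
    proof -
      have "g \<in> ?Y" by (rule mem[of "\<zero>\<^bsub>M\<^esub>" "\<one>\<^bsub>R\<^esub>"]) (use g in \<open>simp_all add: rsmult_one\<close>)
      moreover have "x \<in> ?Y" if "x \<in> G" for x
        by (rule mem[of x "\<zero>\<^bsub>R\<^esub>"]) (use g that subsetD[OF Y(2) that] in \<open>simp_all add: rsmult_zero Y.N_closed\<close>)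
      ultimately show ?thesis by blast
    qed
    moreover have "?dcc ?Y"
    proof (intro allI impI)
      fix I :: "nat \<Rightarrow> 'm set"
      assume I: "\<forall>n. right_submodule R M (I n)" "\<forall>n. I (Suc n) \<subseteq> I n" "I 0 \<subseteq> ?Y"
      have dcc: "\<exists>n. \<forall>k\<ge>n. J k = J n"
        if "\<And>n. right_submodule R M (J n)" "\<And>n. J (Suc n) \<subseteq> J n" "J 0 \<subseteq> Y" for J :: "nat \<Rightarrow> 'm set"
        using Y(3)[rule_format, of J] that by blast
      show "\<exists>n. \<forall>k\<ge>n. I k = I n"
        by (rule artinian_extend_by_one[OF R g Y(1) dcc spec[OF I(1)] spec[OF I(2)] I(3)])
    qed
    ultimately show ?case by blast
  qed
  then obtain Y where Y: "right_submodule R M Y" "G \<subseteq> Y" "?dcc Y" by blast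
  have "carrier M \<subseteq> Y" using Y(1,2) G(3) by blast
  moreover have "I 0 \<subseteq> carrier M" if "right_submodule R M (I 0)" for I :: "nat \<Rightarrow> 'm set"
    using that by (auto simp: right_submodule_def dest: additive_subgroup.a_subset)
  ultimately show ?thesis
    using Y(3) unfolding artinian_right_module_def by (meson subset_trans)
qed

section \<open>The coring as a right module\<close>

context alpha_pairing
begin

abbreviation C\<^sub>A :: "('a, 'c) rmodule" where "C\<^sub>A \<equiv> coring_right_module C \<kappa>"

text \<open>A single formal sum representing the coproduct of \<open>c\<close> computes both the
  action on \<open>c\<close> and the product of the dual ring at \<open>c\<close>, so that
  \<open>kappa_mult\<close> can compare the two term by term.\<close>

lemma comult_representative:
  assumes c: "c \<in> carrier C"
  obtains z where "Poly_Mapping.keys z \<subseteq> carrier C \<times> carrier C"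
    "\<And>a. a \<in> carrier A \<Longrightarrow> c \<triangleleft>\<^bsub>C\<^sub>A\<^esub> a = alpha_sum C z a"
    "\<And>a b. \<lbrakk>a \<in> carrier A; b \<in> carrier A\<rbrakk> \<Longrightarrow>
      \<kappa> (a \<otimes>\<^bsub>A\<^esub> b) c = formal_sum R (\<lambda>x y. \<kappa> b (x \<triangleleft>\<^bsub>C\<^esub> \<kappa> a y)) z"
proof -
  interpret T: tensor_factors R C C
    using C.right_module_axioms C.bimodule_axioms by (rule tensor_factors.intro)
  have t: "comult C c \<in> carrier (tensor R C C)"
    using C.comult_hom c by (auto simp: bimodule_hom_def right_hom_def tensor_bimodule_def)
  obtain z where z: "Poly_Mapping.keys z \<subseteq> carrier C \<times> carrier C" "z \<in> comult C c"
    by (rule T.tensor_carrierE[OF t])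
  have 1: "c \<triangleleft>\<^bsub>C\<^sub>A\<^esub> a = alpha_sum C z a" if a: "a \<in> carrier A" for a
    using T.tensor_lift_eq[OF C.M.abelian_group_axioms alpha_balanced[OF C.right_module_axioms a] t z(2)]
    by (simp add: coring_right_module_def alpha_sum_def)
  have 2: "\<kappa> (a \<otimes>\<^bsub>A\<^esub> b) c = formal_sum R (\<lambda>x y. \<kappa> b (x \<triangleleft>\<^bsub>C\<^esub> \<kappa> a y)) z"
    if a: "a \<in> carrier A" and b: "b \<in> carrier A" for a b
  proof -
    have "balanced R C C R (\<lambda>x y. \<kappa> b (x \<triangleleft>\<^bsub>C\<^esub> \<kappa> a y))"
      using alpha_balanced[OF C.right_module_axioms a] b
      by (simp add: balanced_def kappa_closed kappa_add_right)
    from T.tensor_lift_eq[OF A.R.abelian_group_axioms this t z(2)]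
    show ?thesis
      using ring_hom_mult[OF kappa_ring_hom a b] c by (simp add: left_dual_def)
  qed
  show ?thesis using that[OF z(1) 1 2] .
qed

lemma act_closed: "\<lbrakk>c \<in> carrier C; a \<in> carrier A\<rbrakk> \<Longrightarrow> c \<triangleleft>\<^bsub>C\<^sub>A\<^esub> a \<in> carrier C"
  by (rule comult_representative[of c]) (auto simp: alpha_sum_closed[OF C.right_module_axioms])

text \<open>Both sides are the sum of the terms <b, c_1 <a, c_2>>: on the left by the product of the
  dual ring, on the right because pairing with \<open>b\<close> is additive.\<close>

lemma kappa_mult:
  assumes "a \<in> carrier A" "b \<in> carrier A" "c \<in> carrier C"
  shows "\<kappa> (a \<otimes>\<^bsub>A\<^esub> b) c = \<kappa> b (c \<triangleleft>\<^bsub>C\<^sub>A\<^esub> a)"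
proof -
  obtain z where z: "Poly_Mapping.keys z \<subseteq> carrier C \<times> carrier C" "c \<triangleleft>\<^bsub>C\<^sub>A\<^esub> a = alpha_sum C z a"
    "\<kappa> (a \<otimes>\<^bsub>A\<^esub> b) c = formal_sum R (\<lambda>x y. \<kappa> b (x \<triangleleft>\<^bsub>C\<^esub> \<kappa> a y)) z"
    using comult_representative[OF assms(3)] assms(1,2) by metis
  have "\<kappa> b (alpha_sum C z a) = formal_sum R (\<lambda>x y. \<kappa> b (x \<triangleleft>\<^bsub>C\<^esub> \<kappa> a y)) z"
    unfolding alpha_sum_def
    by (rule group_hom_formal_sum[OF C.M.abelian_group_axioms A.R.abelian_group_axioms kappa_hom_right[OF assms(2)] _ z(1)])
       (use assms in \<open>auto simp: C.rsmult_closed kappa_closed\<close>)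
  then show ?thesis using z by simp
qed

lemma kappa_eqI:
  assumes "c \<in> carrier C" "d \<in> carrier C" "\<And>a. a \<in> carrier A \<Longrightarrow> \<kappa> a c = \<kappa> a d"
  shows "c = d"
proof -
  have "c \<ominus>\<^bsub>C\<^esub> d = \<zero>\<^bsub>C\<^esub>"
    by (rule kappa_separates) (use assms in \<open>auto simp: kappa_diff_right kappa_closed A.R.minus_eq A.R.r_neg\<close>)
  then show ?thesis using assms(1,2) by (simp add: C.M.diff_eq_zero_iff)
qed

text \<open>Since \<open>C\<close> is separated by \<open>A\<close>, its module axioms are inherited from the ring \<open>A\<close> via \<open>kappa_mult\<close>.\<close>

lemma right_module_coring: "right_module A C\<^sub>A"
proof -
  have fields: "carrier C\<^sub>A = carrier C" "ring.add C\<^sub>A = ring.add C" "\<zero>\<^bsub>C\<^sub>A\<^esub> = \<zero>\<^bsub>C\<^esub>"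
    by (simp_all add: coring_right_module_def)
  have "abelian_group C\<^sub>A"
    by (rule abelian_groupI) (auto simp: fields C.M.a_ac C.M.l_neg intro: bexI[of _ "\<ominus>\<^bsub>C\<^esub> _"])
  moreover have "ring A" by (rule A.ring_axioms)
  ultimately show ?thesis
    by (intro right_module.intro right_module_axioms.intro kappa_eqI)
       (simp_all add: fields act_closed kappa_mult[symmetric] kappa_add_right kappa_add_left
          A.l_distr A.r_distr A.m_assoc)
qed

section \<open>Annihilators for the action against orthogonals for the pairing\<close>

lemma annihilator_subset_orth:
  assumes "F \<subseteq> carrier C"
  shows "annihilator A C\<^sub>A F \<subseteq> orth R A \<kappa> F"
proof
  fix a assume a: "a \<in> annihilator A C\<^sub>A F"
  have "\<kappa> a c = \<zero>\<^bsub>R\<^esub>" if "c \<in> F" for c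
  proof -
    \<comment> \<open>The unit recovers the pairing from the action: \<open>kappa_mult\<close> is
      read for the product of \<open>a\<close> with the unit.\<close>
    have "\<kappa> a c = \<kappa> \<one>\<^bsub>A\<^esub> (c \<triangleleft>\<^bsub>C\<^sub>A\<^esub> a)"
      using kappa_mult[of a "\<one>\<^bsub>A\<^esub>" c] a that assms by (auto simp: annihilator_def)
    also have "\<dots> = \<kappa> \<one>\<^bsub>A\<^esub> \<zero>\<^bsub>C\<^esub>"
      using a that by (simp add: annihilator_def) (simp add: coring_right_module_def)
    also have "\<dots> = \<zero>\<^bsub>R\<^esub>"
      using group_hom.hom_one[OF kappa_hom_right[OF A.one_closed]] by simp
    finally show ?thesis .
  qed
  then show "a \<in> orth R A \<kappa> F" using a by (simp add: annihilator_def orth_def)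
qed

text \<open>\<open>F'\<close> collects the second components of representatives of the coproducts of
  the elements of \<open>F\<close>. If \<open>a\<close> is orthogonal to these, every term of the
  sum of c_1 <a, c_2> vanishes.\<close>

lemma orth_subset_annihilator:
  assumes "finite F" "F \<subseteq> carrier C"
  obtains F' where "finite F'" "F' \<subseteq> carrier C" "orth R A \<kappa> F' \<subseteq> annihilator A C\<^sub>A F"
proof -
  have "\<forall>c\<in>F. \<exists>z. Poly_Mapping.keys z \<subseteq> carrier C \<times> carrier C \<and>
      (\<forall>a\<in>carrier A. c \<triangleleft>\<^bsub>C\<^sub>A\<^esub> a = alpha_sum C z a)"
    using assms(2) comult_representative by (metis subsetD)
  then obtain Z where Z: "\<And>c. c \<in> F \<Longrightarrow> Poly_Mapping.keys (Z c) \<subseteq> carrier C \<times> carrier C"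
    "\<And>c a. \<lbrakk>c \<in> F; a \<in> carrier A\<rbrakk> \<Longrightarrow> c \<triangleleft>\<^bsub>C\<^sub>A\<^esub> a = alpha_sum C (Z c) a"
    by (metis bchoice)
  let ?F = "\<Union>c\<in>F. snd ` Poly_Mapping.keys (Z c)"
  have "c \<triangleleft>\<^bsub>C\<^sub>A\<^esub> a = \<zero>\<^bsub>C\<^sub>A\<^esub>" if c: "c \<in> F" and a: "a \<in> orth R A \<kappa> ?F" for c a
  proof -
    have "alpha_sum C (Z c) a = \<zero>\<^bsub>C\<^esub>"
      unfolding alpha_sum_def
    proof (rule formal_sum_eq_zero[OF C.M.abelian_group_axioms])
      fix x y assume xy: "(x, y) \<in> Poly_Mapping.keys (Z c)"
      then have "\<kappa> a y = \<zero>\<^bsub>R\<^esub>" using a c by (force simp: orth_def)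
      then show "x \<triangleleft>\<^bsub>C\<^esub> \<kappa> a y = \<zero>\<^bsub>C\<^esub>" using xy Z(1)[OF c] by (auto simp: C.rsmult_zero)
    qed simp
    then show ?thesis using Z(2)[OF c] a by (simp add: orth_def) (simp add: coring_right_module_def)
  qed
  then have "orth R A \<kappa> ?F \<subseteq> annihilator A C\<^sub>A F" by (auto simp: annihilator_def orth_def)
  moreover have "finite ?F" "?F \<subseteq> carrier C" using assms Z(1) by force+
  ultimately show ?thesis using that by blast
qed

theorem adic_topology_eq_weak_topology: "adic_topology A C \<kappa> = weak_topology R A C \<kappa>"
proof (rule topology_eq[THEN iffD2], rule allI)
  fix U
  have mono: "u <+\<^bsub>A\<^esub> B \<subseteq> U" if "u <+\<^bsub>A\<^esub> B' \<subseteq> U" "B \<subseteq> B'" for u B B'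
    using that unfolding a_l_coset_def l_coset_def by blast
  have "(\<exists>F. finite F \<and> F \<subseteq> carrier C \<and> u <+\<^bsub>A\<^esub> annihilator A C\<^sub>A F \<subseteq> U) \<longleftrightarrow>
      (\<exists>F. finite F \<and> F \<subseteq> carrier C \<and> u <+\<^bsub>A\<^esub> orth R A \<kappa> F \<subseteq> U)" for u
    by (meson mono annihilator_subset_orth orth_subset_annihilator)
  then show "openin (adic_topology A C \<kappa>) U = openin (weak_topology R A C \<kappa>) U"
    unfolding openin_adic_topology openin_weak_topology by simp
qed

lemma annihilator_subset_iff_orth_subset:
  "(\<exists>F. finite F \<and> F \<subseteq> carrier C \<and> annihilator A C\<^sub>A F \<subseteq> X) \<longleftrightarrow>
   (\<exists>F. finite F \<and> F \<subseteq> carrier C \<and> orth R A \<kappa> F \<subseteq> X)"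
  by (meson annihilator_subset_orth orth_subset_annihilator subset_trans)

text \<open>For fixed \<open>a\<close>, the elements of C that pair to zero with \<open>a\<close>
  form a left submodule, so they contain the submodule generated by \<open>F\<close> as soon as they
  contain \<open>F\<close>.\<close>

lemma orth_generated:
  assumes "F \<subseteq> carrier C"
  shows "orth R A \<kappa> (\<Inter> {N. left_submodule R C N \<and> F \<subseteq> N}) = orth R A \<kappa> F"
proof (rule antisym)
  show "orth R A \<kappa> (\<Inter> {N. left_submodule R C N \<and> F \<subseteq> N}) \<subseteq> orth R A \<kappa> F"
    by (auto simp: orth_def)
  show "orth R A \<kappa> F \<subseteq> orth R A \<kappa> (\<Inter> {N. left_submodule R C N \<and> F \<subseteq> N})"
  proof
    fix a assume a: "a \<in> orth R A \<kappa> F"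
    then have ac: "a \<in> carrier A" by (simp add: orth_def)
    let ?N = "{c \<in> carrier C. \<kappa> a c = \<zero>\<^bsub>R\<^esub>}"
    have "subgroup (kernel (add_monoid C) (add_monoid R) (\<kappa> a)) (add_monoid C)"
      by (rule group_hom.subgroup_kernel[OF kappa_hom_right[OF ac]])
    then have "left_submodule R C ?N"
      unfolding left_submodule_def
      by (simp add: kernel_def ac kappa_lsmult C.lsmult_closed additive_subgroup_def)
    moreover have "F \<subseteq> ?N" using a assms by (auto simp: orth_def)
    ultimately have "\<Inter> {N. left_submodule R C N \<and> F \<subseteq> N} \<subseteq> ?N" by (intro Inter_lower CollectI conjI)
    then show "a \<in> orth R A \<kappa> (\<Inter> {N. left_submodule R C N \<and> F \<subseteq> N})"
      unfolding orth_def using ac by blast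
  qed
qed

lemma fg_orth_subset_iff:
  "(\<exists>K. fg_left_submodule R C K \<and> orth R A \<kappa> K \<subseteq> X) \<longleftrightarrow>
   (\<exists>F. finite F \<and> F \<subseteq> carrier C \<and> orth R A \<kappa> F \<subseteq> X)"
proof
  assume "\<exists>K. fg_left_submodule R C K \<and> orth R A \<kappa> K \<subseteq> X"
  then obtain K F where "finite F" "F \<subseteq> carrier C" "K = \<Inter> {N. left_submodule R C N \<and> F \<subseteq> N}" "orth R A \<kappa> K \<subseteq> X"
    unfolding fg_left_submodule_def by (elim exE conjE)
  then show "\<exists>F. finite F \<and> F \<subseteq> carrier C \<and> orth R A \<kappa> F \<subseteq> X"
    by (intro exI[of _ F]) (simp add: orth_generated)
next
  assume "\<exists>F. finite F \<and> F \<subseteq> carrier C \<and> orth R A \<kappa> F \<subseteq> X"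
  then obtain F where F: "finite F" "F \<subseteq> carrier C" "orth R A \<kappa> F \<subseteq> X" by (elim exE conjE)
  show "\<exists>K. fg_left_submodule R C K \<and> orth R A \<kappa> K \<subseteq> X"
  proof (intro exI conjI)
    show "fg_left_submodule R C (\<Inter> {N. left_submodule R C N \<and> F \<subseteq> N})"
      unfolding fg_left_submodule_def using F(1,2) by (intro exI[of _ F] conjI refl)
    show "orth R A \<kappa> (\<Inter> {N. left_submodule R C N \<and> F \<subseteq> N}) \<subseteq> X"
      using F(3) by (simp only: orth_generated[OF F(2)])
  qed
qed

text \<open>From a rational parametrization of \<open>m\<close>, \<open>F\<close> is the set of
  second components of a representing formal sum. Conversely the parametrization is the image of the
  local dual basis of \<open>F\<close> under the map sending \<open>a\<close> to
  \<open>m \<triangleleft> a\<close>.\<close>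

lemma rational_iff_orth_subset:
  assumes M: "right_module A M" and m: "m \<in> carrier M"
  shows "m \<in> rational_part R A C \<kappa> M \<longleftrightarrow>
    (\<exists>F. finite F \<and> F \<subseteq> carrier C \<and> orth R A \<kappa> F \<subseteq> annihilator A M {m})"
proof -
  interpret M: right_module A M by fact
  let ?M = "restrict_scalars A M"
  have Mr: "right_module R ?M"
    by (rule right_module_restrict_scalars[OF A.R_ring_axioms M])
  interpret Mr: right_module R ?M by fact
  interpret T: tensor_factors R ?M C using Mr C.bimodule_axioms by (rule tensor_factors.intro)
  have fields: "carrier ?M = carrier M" "\<zero>\<^bsub>?M\<^esub> = \<zero>\<^bsub>M\<^esub>" "ring.add ?M = ring.add M"
    by (simp_all add: restrict_scalars_def)
  show ?thesis
  proof
    assume "m \<in> rational_part R A C \<kappa> M"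
    then obtain t where t: "t \<in> carrier (tensor R ?M C)"
      "\<And>a. a \<in> carrier A \<Longrightarrow> m \<triangleleft>\<^bsub>M\<^esub> a = alpha_map A \<kappa> ?M t a"
      unfolding rational_part_def by blast
    obtain z where z: "Poly_Mapping.keys z \<subseteq> carrier ?M \<times> carrier C"
      "t = tensor_kernel R ?M C #>\<^bsub>tensor_free ?M C\<^esub> z"
      by (rule T.tensor_carrierE[OF t(1)])
    have ma: "m \<triangleleft>\<^bsub>M\<^esub> a = alpha_sum ?M z a" if "a \<in> carrier A" for a
      using t(2)[OF that] alpha_map_coset(2)[OF Mr z(1) that] z(2) by (simp add: alpha_sum_def)
    let ?F = "snd ` Poly_Mapping.keys z"
    have "m \<triangleleft>\<^bsub>M\<^esub> a = \<zero>\<^bsub>M\<^esub>" if a: "a \<in> orth R A \<kappa> ?F" for a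
    proof -
      have "alpha_sum ?M z a = \<zero>\<^bsub>?M\<^esub>"
        unfolding alpha_sum_def
      proof (rule formal_sum_eq_zero[OF Mr.M.abelian_group_axioms])
        fix x y assume xy: "(x, y) \<in> Poly_Mapping.keys z"
        then have "\<kappa> a y = \<zero>\<^bsub>R\<^esub>" using a by (force simp: orth_def)
        then show "x \<triangleleft>\<^bsub>?M\<^esub> \<kappa> a y = \<zero>\<^bsub>?M\<^esub>" using xy z(1) by (auto simp: Mr.rsmult_zero)
      qed simp
      then show ?thesis using ma a by (simp add: orth_def fields)
    qed
    then have "orth R A \<kappa> ?F \<subseteq> annihilator A M {m}" by (auto simp: orth_def annihilator_def)
    moreover have "finite ?F" "?F \<subseteq> carrier C" using z(1) by auto
    ultimately show "\<exists>F. finite F \<and> F \<subseteq> carrier C \<and> orth R A \<kappa> F \<subseteq> annihilator A M {m}" by blast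
  next
    assume "\<exists>F. finite F \<and> F \<subseteq> carrier C \<and> orth R A \<kappa> F \<subseteq> annihilator A M {m}"
    then obtain F where F: "finite F" "F \<subseteq> carrier C" "orth R A \<kappa> F \<subseteq> annihilator A M {m}" by blast
    obtain z where z: "Poly_Mapping.keys z \<subseteq> carrier A \<times> carrier C"
      "\<And>a c. \<lbrakk>a \<in> carrier A; c \<in> F\<rbrakk> \<Longrightarrow> \<kappa> (alpha_sum A z a) c = \<kappa> a c"
      using local_dual_basis[OF F(1,2)] by auto
    let ?f = "\<lambda>a. m \<triangleleft>\<^bsub>M\<^esub> a"
    \<comment> \<open>R acts on \<open>?M\<close> through the unit map of A, so linearity over R is
      associativity of the action of A once \<open>a \<triangleleft> r\<close> is written as a
      product in A.\<close>
    have f: "?f \<in> right_hom R A ?M"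
    proof -
      have "m \<triangleleft>\<^bsub>M\<^esub> (a \<triangleleft>\<^bsub>A\<^esub> r) = (m \<triangleleft>\<^bsub>M\<^esub> a) \<triangleleft>\<^bsub>?M\<^esub> r" if "a \<in> carrier A" "r \<in> carrier R" for a r
      proof -
        have "a \<triangleleft>\<^bsub>A\<^esub> r = a \<otimes>\<^bsub>A\<^esub> (\<one>\<^bsub>A\<^esub> \<triangleleft>\<^bsub>A\<^esub> r)"
          using that by (simp add: A.mult_rsmult)
        then show ?thesis
          using that m by (simp add: restrict_scalars_def M.rsmult_assoc A.rsmult_closed)
      qed
      then show ?thesis
        using m by (auto simp: right_hom_def fields M.rsmult_closed M.rsmult_add_right)
    qed
    have w: "Poly_Mapping.keys (frag_map_fst ?f z) \<subseteq> carrier ?M \<times> carrier C"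
      using z(1) by (rule keys_frag_map_fst) (simp add: fields M.rsmult_closed m)
    have "m \<triangleleft>\<^bsub>M\<^esub> a = alpha_sum ?M (frag_map_fst ?f z) a" if a: "a \<in> carrier A" for a
    proof -
      have za: "alpha_sum A z a \<in> carrier A"
        by (rule alpha_sum_closed[OF A.right_module_axioms z(1) a])
      have "a \<ominus>\<^bsub>A\<^esub> alpha_sum A z a \<in> orth R A \<kappa> F"
        using a za z(2)[OF a] F(2)
        by (auto simp: orth_def kappa_diff_left subset_iff kappa_closed A.R.minus_eq A.R.r_neg)
      then have "m \<triangleleft>\<^bsub>M\<^esub> (a \<ominus>\<^bsub>A\<^esub> alpha_sum A z a) = \<zero>\<^bsub>M\<^esub>"
        using F(3) by (auto simp: annihilator_def)
      then have "m \<triangleleft>\<^bsub>M\<^esub> a = m \<triangleleft>\<^bsub>M\<^esub> alpha_sum A z a"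
        using a za m by (simp add: M.rsmult_diff M.rsmult_closed M.M.diff_eq_zero_iff)
      also have "\<dots> = alpha_sum ?M (frag_map_fst ?f z) a"
        by (rule alpha_sum_map[OF A.right_module_axioms Mr subset_refl f z(1) a, symmetric])
      finally show ?thesis .
    qed
    then show "m \<in> rational_part R A C \<kappa> M"
      unfolding rational_part_def
      using m alpha_map_coset(1)[OF Mr w A.zero_closed] alpha_map_coset(2)[OF Mr w]
      by (auto simp: alpha_sum_def intro!: bexI[of _ "tensor_kernel R ?M C #>\<^bsub>tensor_free ?M C\<^esub> frag_map_fst ?f z"])
  qed
qed

end

section \<open>Cyclic subgenerated modules\<close>

text \<open>Right ideals of A are expressed as submodules of
  \<open>regular_bimodule A\<close>.\<close>

lemma annihilator_right_submodule:
  assumes "right_module A M" "F \<subseteq> carrier M"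
  shows "right_submodule A (regular_bimodule A) (annihilator A M F)"
proof -
  interpret M: right_module A M by fact
  show ?thesis
  proof (rule right_module.right_submoduleI[OF right_module_regular[OF M.R.ring_axioms]])
  qed (use assms(2) in \<open>auto simp: annihilator_def regular_bimodule_def M.rsmult_zero M.rsmult_add_right
      M.rsmult_assoc M.zero_rsmult subset_iff\<close>)
qed

text \<open>The image of \<open>m\<close> in a quotient of a direct sum lifts to a finitely
  supported tuple, whose entries form \<open>F\<close>. Conversely the tuple \<open>f\<close> of the
  elements of \<open>F\<close> generates a copy of A modulo the annihilator of \<open>F\<close>, and
  m A is a quotient of it. An infinite index type provides index sets of every finite size.\<close>

lemma subgenerated_cyclic_iff:
  fixes X :: "('a, 'c, 'x) rmodule_scheme" and M :: "('a, 'm, 'y) rmodule_scheme"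
  assumes X: "right_module A X" and M: "right_module A M" and m: "m \<in> carrier M"
  shows "subgenerated TYPE('i::infinite) A X (M\<lparr>carrier := {m \<triangleleft>\<^bsub>M\<^esub> a | a. a \<in> carrier A}\<rparr>) \<longleftrightarrow>
    (\<exists>F. finite F \<and> F \<subseteq> carrier X \<and> annihilator A X F \<subseteq> annihilator A M {m})"
    (is "subgenerated _ _ _ ?mA \<longleftrightarrow> _")
proof
  interpret X: right_module A X by fact
  interpret M: right_module A M by fact
  have mA: "m \<triangleleft>\<^bsub>M\<^esub> a \<in> carrier ?mA" if "a \<in> carrier A" for a using that by auto
  have m1: "m \<in> carrier ?mA" using mA[of "\<one>\<^bsub>A\<^esub>"] m by (simp add: M.rsmult_one)
  assume "subgenerated TYPE('i) A X ?mA"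
  then obtain I :: "'i set" and V W \<phi> where
    V: "right_submodule A (direct_sum_copies I X) V" and
    \<phi>: "\<phi> \<in> right_hom A ?mA (quotient_module (direct_sum_copies I X) V)" "bij_betw \<phi> (carrier ?mA) W"
    unfolding subgenerated_def by (elim exE conjE)
  define D where "D = direct_sum_copies I X"
  interpret Q: right_quotient A D V
    using V direct_sum_copies_right_module[OF X, of I]
    by (intro right_quotient.intro right_quotient_axioms.intro) (simp_all add: D_def)
  have "\<phi> m \<in> carrier (quotient_module D V)"
    using \<phi>(1) m1 by (auto simp: right_hom_def D_def)
  then obtain f where f: "f \<in> carrier D" "\<phi> m = V +>\<^bsub>D\<^esub> f" by (auto simp: Q.quotient_carrier)
  have \<phi>m: "\<phi> (m \<triangleleft>\<^bsub>M\<^esub> a) = V +>\<^bsub>D\<^esub> (f \<triangleleft>\<^bsub>D\<^esub> a)" if a: "a \<in> carrier A" for a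
  proof -
    have "\<forall>x\<in>carrier ?mA. \<forall>a\<in>carrier A. \<phi> (x \<triangleleft>\<^bsub>?mA\<^esub> a) = \<phi> x \<triangleleft>\<^bsub>quotient_module D V\<^esub> a"
      using \<phi>(1) unfolding right_hom_def D_def by (elim CollectE conjE)
    from bspec[OF bspec[OF this m1] a]
    have "\<phi> (m \<triangleleft>\<^bsub>M\<^esub> a) = \<phi> m \<triangleleft>\<^bsub>quotient_module D V\<^esub> a" by simp
    then show ?thesis using Q.quotient_rsmult[OF f(1) a] f(2) by simp
  qed
  let ?F = "f ` {i \<in> I. f i \<noteq> \<zero>\<^bsub>X\<^esub>}"
  have "m \<triangleleft>\<^bsub>M\<^esub> a = \<zero>\<^bsub>M\<^esub>" if a: "a \<in> annihilator A X ?F" for a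
  proof -
    have ac: "a \<in> carrier A" using a by (simp add: annihilator_def)
    \<comment> \<open>The comparison is with multiplication by the zero of A, so that
      \<open>\<phi>m\<close> applies to both sides and injectivity of \<phi> yields that m a equals
      m 0.\<close>
    have "f i \<triangleleft>\<^bsub>X\<^esub> a = f i \<triangleleft>\<^bsub>X\<^esub> \<zero>\<^bsub>A\<^esub>" if i: "i \<in> I" for i
    proof -
      have "f i \<in> carrier X" using f(1) i by (auto simp: D_def direct_sum_copies_def)
      then show ?thesis
        using a i by (cases "f i = \<zero>\<^bsub>X\<^esub>") (auto simp: annihilator_def X.rsmult_zero X.zero_rsmult)
    qed
    then have "f \<triangleleft>\<^bsub>D\<^esub> a = f \<triangleleft>\<^bsub>D\<^esub> \<zero>\<^bsub>A\<^esub>"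
      by (simp add: D_def direct_sum_copies_def cong: restrict_cong)
    then have "\<phi> (m \<triangleleft>\<^bsub>M\<^esub> a) = \<phi> (m \<triangleleft>\<^bsub>M\<^esub> \<zero>\<^bsub>A\<^esub>)"
      using \<phi>m[OF ac] \<phi>m[of "\<zero>\<^bsub>A\<^esub>"] by simp
    then have "m \<triangleleft>\<^bsub>M\<^esub> a = m \<triangleleft>\<^bsub>M\<^esub> \<zero>\<^bsub>A\<^esub>"
      using inj_onD[OF bij_betw_imp_inj_on[OF \<phi>(2)] _ mA[OF ac] mA[OF X.R.zero_closed]] by simp
    then show ?thesis using m by (simp add: M.rsmult_zero)
  qed
  then have "annihilator A X ?F \<subseteq> annihilator A M {m}" by (auto simp: annihilator_def)
  moreover have "finite ?F" "?F \<subseteq> carrier X"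
    using f(1) by (auto simp: D_def direct_sum_copies_def)
  ultimately show "\<exists>F. finite F \<and> F \<subseteq> carrier X \<and> annihilator A X F \<subseteq> annihilator A M {m}"
    by (intro exI conjI)
next
  interpret X: right_module A X by fact
  interpret M: right_module A M by fact
  assume "\<exists>F. finite F \<and> F \<subseteq> carrier X \<and> annihilator A X F \<subseteq> annihilator A M {m}"
  then obtain F where F: "finite F" "F \<subseteq> carrier X" "annihilator A X F \<subseteq> annihilator A M {m}"
    by (elim exE conjE)
  obtain I :: "'i set" where I: "finite I" "card I = card F"
    using infinite_arbitrarily_large[OF infinite_UNIV, of "card F"] by blast
  then obtain g where g: "bij_betw g I F" using finite_same_card_bij[OF I(1) F(1)] by blast
  define f where "f = restrict g I"
  define D where "D = direct_sum_copies I X"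
  have D: "right_module A D" unfolding D_def by (rule direct_sum_copies_right_module[OF X])
  interpret D: right_module A D by fact
  have gX: "g i \<in> carrier X" if "i \<in> I" for i using bij_betwE[OF g] F(2) that by blast
  have f: "f \<in> carrier D" using I(1) gX by (auto simp: f_def D_def direct_sum_copies_def)
  let ?R = "regular_bimodule A"
  have R: "right_module A ?R" by (rule right_module_regular[OF X.R.ring_axioms])
  have ann: "right_submodule A ?R (annihilator A M {m})"
    by (rule annihilator_right_submodule[OF M]) (simp add: m)
  have fh: "(\<lambda>a. f \<triangleleft>\<^bsub>D\<^esub> a) \<in> right_hom A ?R D"
    using f by (auto simp: right_hom_def regular_bimodule_def D.rsmult_closed D.rsmult_add_right D.rsmult_assoc)
  \<comment> \<open>\<open>V\<close> is the kernel of the map from f A to m A sending f a to m a.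
    This map is well defined because the annihilator of \<open>f\<close> lies in that of
    \<open>F\<close> (\<open>fD0\<close>), hence in that of \<open>m\<close>.\<close>
  define V where "V = (\<lambda>a. f \<triangleleft>\<^bsub>D\<^esub> a) ` annihilator A M {m}"
  have V: "right_submodule A D V"
    unfolding V_def by (rule right_submodule_image[OF R D fh ann])
  interpret Q: right_quotient A D V
    using D V by (intro right_quotient.intro right_quotient_axioms.intro)
  define \<theta> where "\<theta> a = V +>\<^bsub>D\<^esub> (f \<triangleleft>\<^bsub>D\<^esub> a)" for a
  have fa: "f \<triangleleft>\<^bsub>D\<^esub> a \<in> carrier D" if "a \<in> carrier A" for a using f that by (rule D.rsmult_closed)
  have fD0: "a \<in> annihilator A X F" if a: "a \<in> carrier A" and 0: "f \<triangleleft>\<^bsub>D\<^esub> a = \<zero>\<^bsub>D\<^esub>" for a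
  proof -
    have "c \<triangleleft>\<^bsub>X\<^esub> a = \<zero>\<^bsub>X\<^esub>" if "c \<in> F" for c
    proof -
      obtain i where i: "i \<in> I" "c = g i" using \<open>c \<in> F\<close> bij_betw_imp_surj_on[OF g] by blast
      have "(f \<triangleleft>\<^bsub>D\<^esub> a) i = \<zero>\<^bsub>X\<^esub>" using 0 i by (simp add: D_def direct_sum_copies_def)
      then show ?thesis using i by (simp add: D_def direct_sum_copies_def f_def)
    qed
    then show ?thesis using a by (simp add: annihilator_def)
  qed
  have \<theta>_eq: "\<theta> a = \<theta> b \<longleftrightarrow> m \<triangleleft>\<^bsub>M\<^esub> a = m \<triangleleft>\<^bsub>M\<^esub> b" if a: "a \<in> carrier A" and b: "b \<in> carrier A" for a b
  proof -
    have "\<theta> a = \<theta> b \<longleftrightarrow> f \<triangleleft>\<^bsub>D\<^esub> (a \<ominus>\<^bsub>A\<^esub> b) \<in> V"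
      unfolding \<theta>_def Q.coset_eq_iff[OF fa[OF a] fa[OF b]] D.rsmult_diff[OF f a b] ..
    also have "\<dots> \<longleftrightarrow> a \<ominus>\<^bsub>A\<^esub> b \<in> annihilator A M {m}"
    proof
      assume "f \<triangleleft>\<^bsub>D\<^esub> (a \<ominus>\<^bsub>A\<^esub> b) \<in> V"
      then obtain d where d: "d \<in> annihilator A M {m}" "f \<triangleleft>\<^bsub>D\<^esub> (a \<ominus>\<^bsub>A\<^esub> b) = f \<triangleleft>\<^bsub>D\<^esub> d"
        unfolding V_def by blast
      have dc: "d \<in> carrier A" using d(1) by (simp add: annihilator_def)
      \<comment> \<open>The multiple of \<open>f\<close> determines the coefficient only up to the
        annihilator of \<open>F\<close>, an ambiguity that \<open>m\<close> does not see.\<close>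
      have "f \<triangleleft>\<^bsub>D\<^esub> ((a \<ominus>\<^bsub>A\<^esub> b) \<ominus>\<^bsub>A\<^esub> d) = \<zero>\<^bsub>D\<^esub>"
        using D.rsmult_diff[OF f, of "a \<ominus>\<^bsub>A\<^esub> b" d] a b dc d(2) fa[OF dc]
        by (simp add: D.M.minus_eq D.M.r_neg)
      then have "(a \<ominus>\<^bsub>A\<^esub> b) \<ominus>\<^bsub>A\<^esub> d \<in> annihilator A M {m}"
        using fD0[of "(a \<ominus>\<^bsub>A\<^esub> b) \<ominus>\<^bsub>A\<^esub> d"] a b dc F(3) by auto
      then have "m \<triangleleft>\<^bsub>M\<^esub> ((a \<ominus>\<^bsub>A\<^esub> b) \<ominus>\<^bsub>A\<^esub> d) = \<zero>\<^bsub>M\<^esub>" by (simp add: annihilator_def)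
      moreover have "m \<triangleleft>\<^bsub>M\<^esub> d = \<zero>\<^bsub>M\<^esub>" using d(1) by (simp add: annihilator_def)
      ultimately have "m \<triangleleft>\<^bsub>M\<^esub> (a \<ominus>\<^bsub>A\<^esub> b) = \<zero>\<^bsub>M\<^esub>"
        using M.rsmult_diff[OF m, of "a \<ominus>\<^bsub>A\<^esub> b" d] a b dc m by (simp add: M.M.diff_eq_zero_iff M.rsmult_closed)
      then show "a \<ominus>\<^bsub>A\<^esub> b \<in> annihilator A M {m}" using a b by (simp add: annihilator_def)
    qed (simp add: V_def)
    also have "\<dots> \<longleftrightarrow> m \<triangleleft>\<^bsub>M\<^esub> a = m \<triangleleft>\<^bsub>M\<^esub> b"
      using a b m by (simp add: annihilator_def M.rsmult_diff M.M.diff_eq_zero_iff M.rsmult_closed)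
    finally show ?thesis .
  qed
  \<comment> \<open>By \<open>\<theta>_eq\<close> the coset does not depend on the chosen
    coefficient \<open>a\<close> of \<open>x\<close>.\<close>
  define \<phi> where "\<phi> x = \<theta> (SOME a. a \<in> carrier A \<and> m \<triangleleft>\<^bsub>M\<^esub> a = x)" for x
  have \<phi>: "\<phi> (m \<triangleleft>\<^bsub>M\<^esub> a) = \<theta> a" if a: "a \<in> carrier A" for a
  proof -
    let ?b = "SOME b. b \<in> carrier A \<and> m \<triangleleft>\<^bsub>M\<^esub> b = m \<triangleleft>\<^bsub>M\<^esub> a"
    have "?b \<in> carrier A \<and> m \<triangleleft>\<^bsub>M\<^esub> ?b = m \<triangleleft>\<^bsub>M\<^esub> a" by (rule someI[of _ a]) (simp add: a)
    then show ?thesis unfolding \<phi>_def using a by (simp add: \<theta>_eq)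
  qed
  have \<theta>h: "\<theta> \<in> right_hom A ?R (quotient_module D V)"
    using f by (auto simp: \<theta>_def right_hom_def regular_bimodule_def Q.quotient_carrier Q.quotient_add
        Q.quotient_rsmult D.rsmult_closed D.rsmult_add_right D.rsmult_assoc)
  have W: "right_submodule A (quotient_module D V) (\<theta> ` carrier A)"
  proof (rule right_submodule_image[OF R Q.quotient_right_module \<theta>h])
    show "right_submodule A ?R (carrier A)"
      by (rule right_module.right_submoduleI[OF R]) (auto simp: regular_bimodule_def)
  qed
  have "\<phi> \<in> right_hom A ?mA (quotient_module D V)"
    unfolding right_hom_def
  proof (intro CollectI conjI Pi_I ballI)
    fix x assume "x \<in> carrier ?mA"
    then obtain a where a: "a \<in> carrier A" "x = m \<triangleleft>\<^bsub>M\<^esub> a" by auto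
    show "\<phi> x \<in> carrier (quotient_module D V)"
      using \<theta>h a \<phi> by (auto simp: right_hom_def regular_bimodule_def)
    show "\<phi> (x \<triangleleft>\<^bsub>?mA\<^esub> b) = \<phi> x \<triangleleft>\<^bsub>quotient_module D V\<^esub> b" if b: "b \<in> carrier A" for b
    proof -
      have "\<phi> (x \<triangleleft>\<^bsub>?mA\<^esub> b) = \<theta> (a \<otimes>\<^bsub>A\<^esub> b)"
        using a b m \<phi>[of "a \<otimes>\<^bsub>A\<^esub> b"] by (simp add: M.rsmult_assoc)
      then show ?thesis using \<theta>h a b \<phi>[OF a(1)] by (simp add: right_hom_def regular_bimodule_def)
    qed
    fix y assume "y \<in> carrier ?mA"
    then obtain b where b: "b \<in> carrier A" "y = m \<triangleleft>\<^bsub>M\<^esub> b" by auto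
    have "\<phi> (x \<oplus>\<^bsub>?mA\<^esub> y) = \<theta> (a \<oplus>\<^bsub>A\<^esub> b)"
      using a b m \<phi>[of "a \<oplus>\<^bsub>A\<^esub> b"] by (simp add: M.rsmult_add_right)
    then show "\<phi> (x \<oplus>\<^bsub>?mA\<^esub> y) = \<phi> x \<oplus>\<^bsub>quotient_module D V\<^esub> \<phi> y"
      using \<theta>h a b \<phi> by (simp add: right_hom_def regular_bimodule_def)
  qed
  moreover have "bij_betw \<phi> (carrier ?mA) (\<theta> ` carrier A)"
    unfolding bij_betw_def
  proof
    show "inj_on \<phi> (carrier ?mA)" by (rule inj_onI) (auto simp: \<phi> \<theta>_eq)
    have "carrier ?mA = (\<lambda>a. m \<triangleleft>\<^bsub>M\<^esub> a) ` carrier A" by auto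
    then show "\<phi> ` carrier ?mA = \<theta> ` carrier A" by (simp add: image_image \<phi>)
  qed
  ultimately show "subgenerated TYPE('i) A X ?mA"
    unfolding subgenerated_def using V W D_def by (intro exI conjI) simp_all
qed

section \<open>Cofinite closed submodules\<close>

context alpha_pairing
begin

lemma topspace_weak: "topspace (weak_topology R A C \<kappa>) = carrier A"
proof (rule antisym)
  have "openin (weak_topology R A C \<kappa>) (carrier A)"
    unfolding openin_weak_topology
    by (intro conjI ballI exI[of _ "{}"]) (auto simp: orth_def a_l_coset_def l_coset_def)
  then show "carrier A \<subseteq> topspace (weak_topology R A C \<kappa>)" by (rule openin_subset)
  show "topspace (weak_topology R A C \<kappa>) \<subseteq> carrier A"
    using openin_topspace[of "weak_topology R A C \<kappa>"] unfolding openin_weak_topology by (rule conjunct1)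
qed

text \<open>Modulo \<open>X\<close> each \<open>a\<close> equals \<open>alpha_sum A z a\<close>, so
  the classes of the first components of the dual basis \<open>z\<close> generate A/X. Closedness is
  the usual fact that a subgroup containing a neighbourhood of zero has an open complement: if u
  lies outside \<open>X\<close>, then so does u + b for every b in the orthogonal.\<close>

lemma cofinite_closed_if_orth_subset:
  assumes X: "right_submodule R A X" and F: "finite F" "F \<subseteq> carrier C" "orth R A \<kappa> F \<subseteq> X"
  shows "R_cofinite R A X" "closedin (weak_topology R A C \<kappa>) X"
proof -
  interpret X: right_quotient R A X
    using X A.right_module_axioms by (intro right_quotient.intro right_quotient_axioms.intro)
  let ?Q = "quotient_module A X" and ?q = "\<lambda>a. X +>\<^bsub>A\<^esub> a"
  obtain z where z: "Poly_Mapping.keys z \<subseteq> carrier A \<times> carrier C"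
    "\<And>a c. \<lbrakk>a \<in> carrier A; c \<in> F\<rbrakk> \<Longrightarrow> \<kappa> (alpha_sum A z a) c = \<kappa> a c"
    using local_dual_basis[OF F(1,2)] by auto
  let ?G = "?q ` fst ` Poly_Mapping.keys z"
  have G: "?G \<subseteq> carrier ?Q" unfolding X.quotient_carrier using z(1) by (intro image_mono) auto
  have gen: "carrier ?Q \<subseteq> N" if N: "right_submodule R ?Q N" "?G \<subseteq> N" for N
  proof
    fix Y assume "Y \<in> carrier ?Q"
    then obtain a where a: "a \<in> carrier A" "Y = ?q a" unfolding X.quotient_carrier by blast
    \<comment> \<open>The preimage of \<open>N\<close> in A is a submodule containing all
      coefficients of \<open>z\<close>, hence all values of \<open>alpha_sum A z\<close>.\<close>
    let ?P = "{b \<in> carrier A. ?q b \<in> N}"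
    have za: "alpha_sum A z a \<in> carrier A"
      by (rule alpha_sum_closed[OF A.right_module_axioms z(1) a(1)])
    have "alpha_sum A z a \<in> ?P"
    proof (rule alpha_sum_in_submodule[OF A.right_module_axioms _ _ a(1)])
      show "right_submodule R A ?P"
        by (rule right_submodule_vimage[OF A.right_module_axioms X.quotient_right_module X.quotient_map_hom N(1)])
      show "Poly_Mapping.keys z \<subseteq> ?P \<times> carrier C"
      proof
        fix p assume p: "p \<in> Poly_Mapping.keys z"
        then have "?q (fst p) \<in> N" using N(2) by (intro subsetD[OF N(2)] imageI)
        then show "p \<in> ?P \<times> carrier C" using subsetD[OF z(1) p] by (simp add: mem_Times_iff)
      qed
    qed
    moreover have "a \<ominus>\<^bsub>A\<^esub> alpha_sum A z a \<in> orth R A \<kappa> F"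
      using a(1) za z(2)[OF a(1)] F(2)
      by (auto simp: orth_def kappa_diff_left subset_iff kappa_closed A.R.minus_eq A.R.r_neg)
    then have "?q a = ?q (alpha_sum A z a)"
      unfolding X.coset_eq_iff[OF a(1) za] using F(3) by (rule rev_subsetD)
    ultimately show "Y \<in> N" using a(2) by simp
  qed
  have "right_submodule R ?Q (carrier ?Q)"
  proof -
    interpret Q: right_module R ?Q by (rule X.quotient_right_module)
    show ?thesis by (rule Q.right_submoduleI) (auto simp: Q.rsmult_closed)
  qed
  then have "\<Inter> {N. right_submodule R ?Q N \<and> ?G \<subseteq> N} = carrier ?Q"
    using gen G by (intro antisym Inter_lower Inter_greatest) simp_all
  then show "R_cofinite R A X"
    unfolding R_cofinite_def fg_right_module_def using X G by (intro conjI exI[of _ ?G]) simp_all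
  show "closedin (weak_topology R A C \<kappa>) X"
    unfolding closedin_def topspace_weak openin_weak_topology
  proof (intro conjI ballI)
    show "X \<subseteq> carrier A" by (rule X.N.a_subset)
    fix u assume u: "u \<in> carrier A - X"
    have "u <+\<^bsub>A\<^esub> orth R A \<kappa> F \<subseteq> carrier A - X"
    proof
      fix x assume "x \<in> u <+\<^bsub>A\<^esub> orth R A \<kappa> F"
      then obtain b where b: "b \<in> orth R A \<kappa> F" "x = u \<oplus>\<^bsub>A\<^esub> b" by (auto simp: a_l_coset_def l_coset_def)
      have bX: "b \<in> X" "b \<in> carrier A" using b F(3) by (auto simp: orth_def)
      have "x \<notin> X"
      proof
        assume "x \<in> X"
        then have "x \<oplus>\<^bsub>A\<^esub> \<ominus>\<^bsub>A\<^esub> b \<in> X" using bX(1) by simp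
        moreover have "x \<oplus>\<^bsub>A\<^esub> \<ominus>\<^bsub>A\<^esub> b = u" using b(2) bX(2) u by (simp add: A.a_assoc A.r_neg)
        ultimately show False using u by simp
      qed
      then show "x \<in> carrier A - X" using b bX u by simp
    qed
    then show "\<exists>F. finite F \<and> F \<subseteq> carrier C \<and> u <+\<^bsub>A\<^esub> orth R A \<kappa> F \<subseteq> carrier A - X"
      using F(1,2) by (intro exI conjI)
  qed simp
qed

text \<open>
  If \<open>X\<close> contained no \<open>F\<^sup>\<bottom>\<close>, closedness would yield finite sets \<open>S n\<close> whose orthogonals have
  strictly decreasing images in the artinian module \<open>A/X\<close>.
\<close>

lemma orth_subset_if_cofinite_closed:
  assumes R: "artinian_right_module R (regular_bimodule R)"
    and X: "R_cofinite R A X" "closedin (weak_topology R A C \<kappa>) X"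
  shows "\<exists>F. finite F \<and> F \<subseteq> carrier C \<and> orth R A \<kappa> F \<subseteq> X"
proof (rule ccontr)
  assume no: "\<not> ?thesis"
  interpret X: right_quotient R A X
    using X(1) A.right_module_axioms by (intro right_quotient.intro right_quotient_axioms.intro) (simp_all add: R_cofinite_def)
  let ?Q = "quotient_module A X" and ?q = "\<lambda>a. X +>\<^bsub>A\<^esub> a"
  have art: "artinian_right_module R ?Q"
    by (rule right_module.fg_imp_artinian[OF X.quotient_right_module R]) (use X(1) in \<open>simp add: R_cofinite_def\<close>)
  \<comment> \<open>An element \<open>y\<close> of the orthogonal of \<open>F\<close> outside
    \<open>X\<close> has a neighbourhood missing \<open>X\<close>. So the class of \<open>y\<close>
    in A/X lies in the image of the orthogonal of \<open>F\<close> but not in that of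
    \<open>F'\<close>.\<close>
  have sep: "\<exists>F'. finite F' \<and> F' \<subseteq> carrier C \<and> (\<exists>y\<in>orth R A \<kappa> F. \<forall>b\<in>orth R A \<kappa> F'. y \<ominus>\<^bsub>A\<^esub> b \<notin> X)"
    if F: "finite F" "F \<subseteq> carrier C" for F
  proof -
    obtain y where y: "y \<in> orth R A \<kappa> F" "y \<notin> X" using no F by blast
    have "openin (weak_topology R A C \<kappa>) (carrier A - X)"
      using X(2) by (simp add: closedin_def topspace_weak)
    moreover have "y \<in> carrier A" using y(1) by (simp add: orth_def)
    ultimately obtain F' where F': "finite F'" "F' \<subseteq> carrier C" "y <+\<^bsub>A\<^esub> orth R A \<kappa> F' \<subseteq> carrier A - X"
      unfolding openin_weak_topology using y(2) by blast
    have "y \<ominus>\<^bsub>A\<^esub> b \<notin> X" if b: "b \<in> orth R A \<kappa> F'" for b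
    proof -
      have "\<ominus>\<^bsub>A\<^esub> b \<in> orth R A \<kappa> F'"
        using orth_right_submodule[OF F'(2)] b by (simp add: right_submodule_def additive_subgroup.a_inv_closed)
      then have "y \<ominus>\<^bsub>A\<^esub> b \<in> y <+\<^bsub>A\<^esub> orth R A \<kappa> F'"
        by (auto simp: a_l_coset_def l_coset_def A.minus_eq)
      then show ?thesis using F'(3) by auto
    qed
    then show ?thesis using F'(1,2) y(1) by blast
  qed
  define h where "h F = (SOME F'. finite F' \<and> F' \<subseteq> carrier C \<and>
      (\<exists>y\<in>orth R A \<kappa> F. \<forall>b\<in>orth R A \<kappa> F'. y \<ominus>\<^bsub>A\<^esub> b \<notin> X))" for F
  have h: "finite (h F) \<and> h F \<subseteq> carrier C \<and> (\<exists>y\<in>orth R A \<kappa> F. \<forall>b\<in>orth R A \<kappa> (h F). y \<ominus>\<^bsub>A\<^esub> b \<notin> X)"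
    if "finite F" "F \<subseteq> carrier C" for F
    unfolding h_def by (rule someI_ex[OF sep[OF that]])
  \<comment> \<open>Each \<open>h F\<close> is added to \<open>F\<close> instead of replacing it, so
    that the orthogonals decrease; the inclusion of \<open>h (S n)\<close> in the next set makes the
    decrease strict modulo \<open>X\<close>.\<close>
  define S where "S = rec_nat {} (\<lambda>_ F. F \<union> h F)"
  have S_Suc: "S (Suc n) = S n \<union> h (S n)" for n by (simp add: S_def)
  have S: "finite (S n) \<and> S n \<subseteq> carrier C" for n
  proof (induction n)
    case 0
    then show ?case by (simp add: S_def)
  next
    case (Suc n)
    then show ?case using h[of "S n"] by (simp add: S_Suc)
  qed
  let ?J = "\<lambda>n. ?q ` orth R A \<kappa> (S n)"
  have "right_submodule R ?Q (?J n)" for n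
    using S[of n] by (intro right_submodule_image[OF A.right_module_axioms X.quotient_right_module X.quotient_map_hom]
        orth_right_submodule) simp
  moreover have "?J (Suc n) \<subseteq> ?J n" for n
    by (intro image_mono) (auto simp: orth_def S_Suc)
  ultimately obtain n where n: "\<And>k. k \<ge> n \<Longrightarrow> ?J k = ?J n"
    using art[unfolded artinian_right_module_def, rule_format, of ?J] by blast
  obtain y where y: "y \<in> orth R A \<kappa> (S n)" "\<And>b. b \<in> orth R A \<kappa> (h (S n)) \<Longrightarrow> y \<ominus>\<^bsub>A\<^esub> b \<notin> X"
    using h[of "S n"] S[of n] by blast
  have "?q y \<in> ?J (Suc n)" using n[of "Suc n"] y(1) by simp
  then obtain b where b: "b \<in> orth R A \<kappa> (S (Suc n))" "?q y = ?q b" by blast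
  have "y \<in> carrier A" "b \<in> carrier A" using y(1) b(1) by (simp_all add: orth_def)
  then have "y \<ominus>\<^bsub>A\<^esub> b \<in> X" using b(2) by (simp only: X.coset_eq_iff)
  moreover have "b \<in> orth R A \<kappa> (h (S n))" using b(1) by (simp add: orth_def S_Suc)
  ultimately show False using y(2) by blast
qed

text \<open>Here the scalars come from R instead of A: \<open>a \<triangleleft> r\<close> is the
  product of \<open>a\<close> with \<open>\<one> \<triangleleft> r\<close>, so an R-multiple of an
  annihilating element is also an A-multiple.\<close>

lemma annihilator_R_submodule:
  assumes M: "right_module A M" and m: "m \<in> carrier M"
  shows "right_submodule R A (annihilator A M {m})"
proof -
  interpret M: right_module A M by fact
  have "m \<triangleleft>\<^bsub>M\<^esub> (a \<triangleleft>\<^bsub>A\<^esub> r) = \<zero>\<^bsub>M\<^esub>" if "a \<in> carrier A" "m \<triangleleft>\<^bsub>M\<^esub> a = \<zero>\<^bsub>M\<^esub>" "r \<in> carrier R" for a r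
  proof -
    have "a \<triangleleft>\<^bsub>A\<^esub> r = a \<otimes>\<^bsub>A\<^esub> (\<one>\<^bsub>A\<^esub> \<triangleleft>\<^bsub>A\<^esub> r)" using that by (simp add: A.mult_rsmult)
    then show ?thesis using that m by (simp add: M.rsmult_assoc A.rsmult_closed M.zero_rsmult)
  qed
  then show ?thesis
    using m by (intro A.right_submoduleI)
      (auto simp: annihilator_def M.rsmult_zero M.rsmult_add_right A.rsmult_closed)
qed

end

theorem proposition2p28:
  fixes R :: "'r ring" and A :: "('r, 'a) bimodule" and C :: "('r, 'c) coring"
    and \<kappa> :: "'a \<Rightarrow> 'c \<Rightarrow> 'r" and M :: "('a, 'm) rmodule" and m :: 'm
  assumes "measuring_left_alpha_pairing R A C \<kappa>"
    and "right_module A M"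
    and "m \<in> carrier M"
  shows "adic_topology A C \<kappa> = weak_topology R A C \<kappa> \<and>
    ((\<exists>F. finite F \<and> F \<subseteq> carrier C \<and>
          annihilator A (coring_right_module C \<kappa>) F \<subseteq> annihilator A M {m})
      \<longleftrightarrow> subgenerated TYPE('i::infinite) A (coring_right_module C \<kappa>)
            (M\<lparr>carrier := {m \<triangleleft>\<^bsub>M\<^esub> a | a. a \<in> carrier A}\<rparr>)) \<and>
    (subgenerated TYPE('i) A (coring_right_module C \<kappa>)
          (M\<lparr>carrier := {m \<triangleleft>\<^bsub>M\<^esub> a | a. a \<in> carrier A}\<rparr>)
      \<longleftrightarrow> m \<in> rational_part R A C \<kappa> M) \<and>
    (m \<in> rational_part R A C \<kappa> M
      \<longleftrightarrow> (\<exists>K. fg_left_submodule R C K \<and> orth R A \<kappa> K \<subseteq> annihilator A M {m})) \<and>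
    (artinian_right_module R (regular_bimodule R) \<longrightarrow>
      ((\<exists>K. fg_left_submodule R C K \<and> orth R A \<kappa> K \<subseteq> annihilator A M {m})
        \<longleftrightarrow> (\<exists>X. R_cofinite R A X \<and> closedin (adic_topology A C \<kappa>) X \<and> X \<subseteq> annihilator A M {m})) \<and>
      ((\<exists>X. R_cofinite R A X \<and> closedin (adic_topology A C \<kappa>) X \<and> X \<subseteq> annihilator A M {m})
        \<longleftrightarrow> R_cofinite R A (annihilator A M {m}) \<and>
            closedin (adic_topology A C \<kappa>) (annihilator A M {m}) \<and>
            right_submodule A (regular_bimodule A) (annihilator A M {m})))"
proof -
  interpret alpha_pairing R A C \<kappa> by (rule alpha_pairingI[OF assms(1)])
  let ?ann = "annihilator A M {m}"
  let ?open = "\<exists>F. finite F \<and> F \<subseteq> carrier C \<and> orth R A \<kappa> F \<subseteq> ?ann"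
  have topology: "adic_topology A C \<kappa> = weak_topology R A C \<kappa>"
    by (rule adic_topology_eq_weak_topology)
  have "carrier C\<^sub>A = carrier C" by (simp add: coring_right_module_def)
  then have subgenerated: "subgenerated TYPE('i) A C\<^sub>A (M\<lparr>carrier := {m \<triangleleft>\<^bsub>M\<^esub> a | a. a \<in> carrier A}\<rparr>) \<longleftrightarrow> ?open"
    using subgenerated_cyclic_iff[OF right_module_coring assms(2,3)]
      annihilator_subset_iff_orth_subset[of ?ann] by simp
  have rational: "m \<in> rational_part R A C \<kappa> M \<longleftrightarrow> ?open"
    by (rule rational_iff_orth_subset[OF assms(2,3)])
  \<comment> \<open>The annihilator itself serves as the cofinite closed submodule, which gives
    conditions 5 and 6 at once; \<open>artinian\<close> leads back from any smaller cofinite closed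
    submodule to \<open>?open\<close>.\<close>
  have cofinite_closed: "R_cofinite R A ?ann \<and> closedin (weak_topology R A C \<kappa>) ?ann" if ?open
    using that cofinite_closed_if_orth_subset[OF annihilator_R_submodule[OF assms(2,3)]] by blast
  have artinian: "?open" if "artinian_right_module R (regular_bimodule R)"
    "R_cofinite R A X" "closedin (weak_topology R A C \<kappa>) X" "X \<subseteq> ?ann" for X
    using orth_subset_if_cofinite_closed[OF that(1-3)] that(4) by (meson subset_trans)
  have ideal: "right_submodule A (regular_bimodule A) ?ann"
    by (rule annihilator_right_submodule[OF assms(2)]) (simp add: assms(3))
  show ?thesis
    unfolding topology annihilator_subset_iff_orth_subset subgenerated rational fg_orth_subset_iff
    using ideal cofinite_closed artinian by blast
qed

end
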